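(* For each positive integer $k$ there exists a Coxeter system $(G_k,S_k)$ such that $G_k$ is a word-hyperbolic Coxeter group, and $G_k$ cannot be embedded into the pseudo-orthogonal group $O(n,k-1)$ for any $n$ as a reflection group with generators being reflections with respect to $(G_k,S_k)$.
   Context: A Coxeter system $(G,S)$ consists of a Coxeter group $G$ and a generating set $S$ of $G$ with defining relations $s^2=t^2=(st)^{m_{st}}=1$ for some $m_{st}\in\{2,3,\dots,\infty\}$ for any pair of distinct $s,t\in S$ ($m_{st}=\infty$ meaning that no relation is imposed on $st$). The set of reflections of the group $G$ with respect to $(G,S)$ is the set of all conjugates in $G$ of elements of $S$. A group is word-hyperbolic if it is finitely generated and its Cayley graph with respect to a finite generating set is hyperbolic in the sense of Gromov. $O(n,m)$ denotes the group of linear automorphisms of $\mathbb{R}^{n+m}$ preserving a nondegenerate symmetric bilinear form $(\cdot,\cdot)$ with positive inertia index $n$ and negative inertia index $m$. A reflection in $O(n,m)$ is a map $x\mapsto x-2\frac{(x,e)}{(e,e)}e$ with $(e,e)\neq 0$. A reflection group in $O(n,m)$ is a subgroup generated by reflections. The condition "with generators being reflections with respect to $(G_k,S_k)$" means that the reflections generating the image of $G_k$ are images of elements of $G_k$ that are conjugates of elements of $S_k$. *)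

theory Defs
  imports
    "HOL-Algebra.Generated_Groups"
    "HOL-Library.Extended_Nat"
    "Jordan_Normal_Form.Matrix"
begin

section \<open>Group presentations and Coxeter systems\<close>

text \<open>
  A letter (s, True) stands for the generator s, and (s, False) for its formal inverse.  The
  elements of the free group on S are the words over S up to free cancellation; a word is trivial
  in the group presented by S and R iff it can be turned into the empty word by finitely many
  insertions and deletions of cancelling pairs and of relators.
\<close>

definition words_over :: "'a set \<Rightarrow> ('a \<times> bool) list set" where
  "words_over S = lists (S \<times> UNIV)"

fun eval_word :: "('a, 'b) monoid_scheme \<Rightarrow> ('a \<times> bool) list \<Rightarrow> 'a" where
  "eval_word G [] = \<one>\<^bsub>G\<^esub>"
| "eval_word G ((s, b) # w) = (if b then s else inv\<^bsub>G\<^esub> s) \<otimes>\<^bsub>G\<^esub> eval_word G w"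

inductive insertion :: "'a set \<Rightarrow> ('a \<times> bool) list set \<Rightarrow>
    ('a \<times> bool) list \<Rightarrow> ('a \<times> bool) list \<Rightarrow> bool"
  for S and R where
  cancelling_pair: "s \<in> S \<Longrightarrow> insertion S R (u @ v) (u @ [(s, b), (s, \<not> b)] @ v)"
| relator: "r \<in> R \<Longrightarrow> insertion S R (u @ v) (u @ r @ v)"

definition presented_by ::
    "('a, 'b) monoid_scheme \<Rightarrow> 'a set \<Rightarrow> ('a \<times> bool) list set \<Rightarrow> bool" where
  "presented_by G S R \<longleftrightarrow>
     group G \<and> S \<subseteq> carrier G \<and> R \<subseteq> words_over S \<and> generate G S = carrier G \<and>
     (\<forall>w \<in> words_over S. eval_word G w = \<one>\<^bsub>G\<^esub> \<longleftrightarrow> equivclp (insertion S R) w [])"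

definition coxeter_relators :: "'a set \<Rightarrow> ('a \<Rightarrow> 'a \<Rightarrow> enat) \<Rightarrow> ('a \<times> bool) list set" where
  "coxeter_relators S m =
     {[(s, True), (s, True)] | s. s \<in> S} \<union>
     {concat (replicate n [(s, True), (t, True)]) | s t n.
        s \<in> S \<and> t \<in> S \<and> s \<noteq> t \<and> m s t = enat n}"

definition coxeter_system :: "('a, 'b) monoid_scheme \<Rightarrow> 'a set \<Rightarrow> bool" where
  "coxeter_system G S \<longleftrightarrow>
     (\<exists>m. (\<forall>s \<in> S. \<forall>t \<in> S. s \<noteq> t \<longrightarrow> 2 \<le> m s t \<and> m t s = m s t) \<and>
          presented_by G S (coxeter_relators S m))"

definition reflections :: "('a, 'b) monoid_scheme \<Rightarrow> 'a set \<Rightarrow> 'a set" where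
  "reflections G S = {g \<otimes>\<^bsub>G\<^esub> s \<otimes>\<^bsub>G\<^esub> inv\<^bsub>G\<^esub> g | g s. g \<in> carrier G \<and> s \<in> S}"


section \<open>Word-hyperbolic groups\<close>

definition cayley_graph :: "('a, 'b) monoid_scheme \<Rightarrow> 'a set \<Rightarrow> ('a \<times> 'a) set" where
  "cayley_graph G A =
     {(g, h). g \<in> carrier G \<and> h \<in> carrier G \<and>
        (\<exists>a \<in> A. h = g \<otimes>\<^bsub>G\<^esub> a \<or> g = h \<otimes>\<^bsub>G\<^esub> a)}"

text \<open>The path metric; it is only meaningful for vertices of a connected graph.\<close>

definition graph_dist :: "('a \<times> 'a) set \<Rightarrow> 'a \<Rightarrow> 'a \<Rightarrow> nat" where
  "graph_dist E x y = (LEAST n. (x, y) \<in> E ^^ n)"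

definition gromov_product :: "('a \<Rightarrow> 'a \<Rightarrow> real) \<Rightarrow> 'a \<Rightarrow> 'a \<Rightarrow> 'a \<Rightarrow> real" where
  "gromov_product d w x y = (d w x + d w y - d x y) / 2"

definition gromov_hyperbolic :: "'a set \<Rightarrow> ('a \<Rightarrow> 'a \<Rightarrow> real) \<Rightarrow> bool" where
  "gromov_hyperbolic V d \<longleftrightarrow>
     (\<exists>\<delta> \<ge> 0. \<forall>w \<in> V. \<forall>x \<in> V. \<forall>y \<in> V. \<forall>z \<in> V.
        gromov_product d w x z \<ge> min (gromov_product d w x y) (gromov_product d w y z) - \<delta>)"

definition word_hyperbolic :: "('a, 'b) monoid_scheme \<Rightarrow> bool" where
  "word_hyperbolic G \<longleftrightarrow>
     (\<exists>A. finite A \<and> A \<subseteq> carrier G \<and> generate G A = carrier G \<and>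
          gromov_hyperbolic (carrier G) (\<lambda>x y. real (graph_dist (cayley_graph G A) x y)))"


section \<open>Pseudo-orthogonal groups\<close>

text \<open>
  A bilinear form on the space of real vectors of dimension N is given by its Gram matrix B.  Its
  inertia indices are read off from a diagonalization by a change of basis P; by Sylvester's law
  they do not depend on P.  The form is nondegenerate iff their sum is N.
\<close>

definition bform :: "real mat \<Rightarrow> real vec \<Rightarrow> real vec \<Rightarrow> real" where
  "bform B x y = x \<bullet> (B *\<^sub>v y)"

definition symmetric_form :: "nat \<Rightarrow> nat \<Rightarrow> real mat \<Rightarrow> bool" where
  "symmetric_form n m B \<longleftrightarrow>
     B \<in> carrier_mat (n + m) (n + m) \<and> transpose_mat B = B \<and>
     (\<exists>P \<in> carrier_mat (n + m) (n + m).
        let D = transpose_mat P * B * P in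
        invertible_mat P \<and> diagonal_mat D \<and>
        card {i. i < n + m \<and> D $$ (i, i) > 0} = n \<and>
        card {i. i < n + m \<and> D $$ (i, i) < 0} = m)"

text \<open>For \<open>symmetric_form n m B\<close> the following is the group O(n, m) of the form B.\<close>

definition pseudo_orthogonal :: "real mat \<Rightarrow> real mat monoid" where
  "pseudo_orthogonal B =
     \<lparr>carrier = {A \<in> carrier_mat (dim_row B) (dim_row B). invertible_mat A \<and>
        (\<forall>x \<in> carrier_vec (dim_row B). \<forall>y \<in> carrier_vec (dim_row B).
           bform B (A *\<^sub>v x) (A *\<^sub>v y) = bform B x y)},
      monoid.mult = (*),
      monoid.one = 1\<^sub>m (dim_row B)\<rparr>"

lemma group_pseudo_orthogonal: "group (pseudo_orthogonal B)"
proof -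
  let ?n = "dim_row B"
  let ?O = "pseudo_orthogonal B"
  have carr: "A \<in> carrier ?O \<longleftrightarrow> A \<in> carrier_mat ?n ?n \<and> invertible_mat A \<and>
      (\<forall>x \<in> carrier_vec ?n. \<forall>y \<in> carrier_vec ?n. bform B (A *\<^sub>v x) (A *\<^sub>v y) = bform B x y)" for A
    by (simp add: pseudo_orthogonal_def)
  have inv: "\<exists>C \<in> carrier_mat ?n ?n. A * C = 1\<^sub>m ?n \<and> C * A = 1\<^sub>m ?n"
    if A: "A \<in> carrier_mat ?n ?n" and i: "invertible_mat A" for A
  proof -
    from i obtain C where C: "A * C = 1\<^sub>m (dim_row A)" "C * A = 1\<^sub>m (dim_row C)"
      by (auto simp: invertible_mat_def inverts_mat_def)
    have "dim_col C = ?n" using arg_cong[OF C(1), of dim_col] A by simp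
    moreover have "dim_row C = ?n" using arg_cong[OF C(2), of dim_col] A by simp
    ultimately show ?thesis using C A by auto
  qed
  have invI: "invertible_mat A"
    if "A \<in> carrier_mat ?n ?n" "C \<in> carrier_mat ?n ?n" "A * C = 1\<^sub>m ?n" "C * A = 1\<^sub>m ?n" for A C
    using that by (auto simp: invertible_mat_def inverts_mat_def square_mat.simps)
  have inverse: "\<exists>C \<in> carrier ?O. C * A = 1\<^sub>m ?n" if A: "A \<in> carrier ?O" for A
  proof -
    from A have A': "A \<in> carrier_mat ?n ?n" "invertible_mat A" by (auto simp: carr)
    obtain C where C: "C \<in> carrier_mat ?n ?n" "A * C = 1\<^sub>m ?n" "C * A = 1\<^sub>m ?n"
      using inv[OF A'] by blast
    have "bform B (C *\<^sub>v x) (C *\<^sub>v y) = bform B x y"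
      if "x \<in> carrier_vec ?n" "y \<in> carrier_vec ?n" for x y
    proof -
      have AC: "A *\<^sub>v (C *\<^sub>v z) = z" if "z \<in> carrier_vec ?n" for z
        using that A' C by (metis assoc_mult_mat_vec one_mult_mat_vec)
      have Cz: "C *\<^sub>v z \<in> carrier_vec ?n" if "z \<in> carrier_vec ?n" for z
        using that C by auto
      have "bform B (C *\<^sub>v x) (C *\<^sub>v y) = bform B (A *\<^sub>v (C *\<^sub>v x)) (A *\<^sub>v (C *\<^sub>v y))"
        using A Cz that by (simp add: carr)
      then show ?thesis using AC that by simp
    qed
    moreover have "invertible_mat C" using invI C A' by blast
    ultimately show ?thesis using C carr by blast
  qed
  have closed: "A * C \<in> carrier ?O" if A: "A \<in> carrier ?O" and C: "C \<in> carrier ?O" for A C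
  proof -
    from A C have A': "A \<in> carrier_mat ?n ?n" "invertible_mat A"
      and C': "C \<in> carrier_mat ?n ?n" "invertible_mat C" by (auto simp: carr)
    obtain A1 where A1: "A1 \<in> carrier_mat ?n ?n" "A * A1 = 1\<^sub>m ?n" "A1 * A = 1\<^sub>m ?n"
      using inv[OF A'] by blast
    obtain C1 where C1: "C1 \<in> carrier_mat ?n ?n" "C * C1 = 1\<^sub>m ?n" "C1 * C = 1\<^sub>m ?n"
      using inv[OF C'] by blast
    have "(A * C) * (C1 * A1) = A * ((C * C1) * A1)" using A' C' A1(1) C1(1)
      by (simp add: assoc_mult_mat[of _ ?n ?n _ ?n _ ?n])
    then have 1: "(A * C) * (C1 * A1) = 1\<^sub>m ?n" using A1 C1 by simp
    have "(C1 * A1) * (A * C) = C1 * ((A1 * A) * C)" using A' C' A1(1) C1(1)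
      by (simp add: assoc_mult_mat[of _ ?n ?n _ ?n _ ?n])
    then have 2: "(C1 * A1) * (A * C) = 1\<^sub>m ?n" using A1 C1 C' by simp
    have "invertible_mat (A * C)" using invI[of "A * C" "C1 * A1"] 1 2 A' C' A1 C1 by auto
    moreover have "bform B ((A * C) *\<^sub>v x) ((A * C) *\<^sub>v y) = bform B x y"
      if "x \<in> carrier_vec ?n" "y \<in> carrier_vec ?n" for x y
    proof -
      have Cz: "C *\<^sub>v z \<in> carrier_vec ?n" if "z \<in> carrier_vec ?n" for z
        using that C' by auto
      have ac: "(A * C) *\<^sub>v z = A *\<^sub>v (C *\<^sub>v z)" if "z \<in> carrier_vec ?n" for z
        using A' C' that by (simp add: assoc_mult_mat_vec)
      show ?thesis using A C Cz that by (simp add: carr ac)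
    qed
    ultimately show ?thesis using A' C' by (simp add: carr)
  qed
  have one: "1\<^sub>m ?n \<in> carrier ?O" using invI[of "1\<^sub>m ?n" "1\<^sub>m ?n"] by (simp add: carr)
  have [simp]: "monoid.mult ?O = (*)" "monoid.one ?O = 1\<^sub>m ?n"
    by (simp_all add: pseudo_orthogonal_def)
  show ?thesis
  proof (rule groupI)
    fix x y z assume "x \<in> carrier ?O" "y \<in> carrier ?O" "z \<in> carrier ?O"
    then show "x \<otimes>\<^bsub>?O\<^esub> y \<otimes>\<^bsub>?O\<^esub> z = x \<otimes>\<^bsub>?O\<^esub> (y \<otimes>\<^bsub>?O\<^esub> z)"
      by (simp add: carr assoc_mult_mat[of _ ?n ?n _ ?n _ ?n])
  qed (use closed one inverse in \<open>auto simp: carr\<close>)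
qed

definition linear_reflections :: "real mat \<Rightarrow> real mat set" where
  "linear_reflections B =
     {A \<in> carrier (pseudo_orthogonal B).
        \<exists>e \<in> carrier_vec (dim_row B). bform B e e \<noteq> 0 \<and>
          (\<forall>x \<in> carrier_vec (dim_row B).
             A *\<^sub>v x = x - (2 * (bform B x e / bform B e e)) \<cdot>\<^sub>v e)}"

text \<open>
  The image of \<open>\<phi>\<close> is a reflection group, generated by linear reflections that are images of
  reflections of G with respect to S.
\<close>

definition reflection_embedding ::
    "('a, 'b) monoid_scheme \<Rightarrow> 'a set \<Rightarrow> real mat \<Rightarrow> ('a \<Rightarrow> real mat) \<Rightarrow> bool" where
  "reflection_embedding G S B \<phi> \<longleftrightarrow>
     \<phi> \<in> hom G (pseudo_orthogonal B) \<and> inj_on \<phi> (carrier G) \<and>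
     (\<exists>R \<subseteq> reflections G S.
        \<phi> ` R \<subseteq> linear_reflections B \<and>
        generate (pseudo_orthogonal B) (\<phi> ` R) = \<phi> ` carrier G)"

end

theory Submission
  imports
    Defs
    "HOL-Library.FuncSet"
    "HOL-Library.Nat_Bijection"
    "HOL-Library.Infinite_Set"
    "HOL-Computational_Algebra.Primes"
begin

text \<open>
  The group. Take \<open>k\<close> generators \<open>B\<close> and many generators \<open>A\<close>. All labels are even; two elements of
  \<open>A\<close> commute, and every other label is at least 8. The labels between \<open>A\<close> and \<open>B\<close> are chosen at the
  end.

  Why it does not embed. Because the labels are even, the parity of the number of letters \<open>s\<close> is a
  homomorphism for every generator \<open>s\<close>, so a generating set of reflections contains a conjugate of
  every \<open>s\<close> (\<open>conjugate_is_linear_reflection\<close>). Hence all generators act as linear reflections, with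
  vectors of norm \<open>\<plusminus>1\<close>. If the product of two of these reflections has finite order \<open>m > 2\<close>, the two
  norms have the same sign, and the square of the inner product lies in a finite set that depends on
  \<open>m\<close> only (\<open>product_finite_order\<close>). So all norms are equal. The vectors of \<open>A\<close> are pairwise
  orthogonal; if the norms are \<open>-1\<close>, they alone give \<open>k\<close> negative directions. If the norms are \<open>1\<close>,
  project the \<open>k\<close> vectors of \<open>B\<close> to the orthogonal complement of the span of \<open>A\<close>
  (\<open>bil_projection\<close>). On their combinations with coefficients \<open>v\<close> the form is
  \<open>v\<^sup>T G v - \<bar>R v\<bar>\<^sup>2\<close>, where \<open>G\<close> is the Gram matrix of \<open>B\<close>, with entries in \<open>[-1, 1]\<close>, and the rows
  of \<open>R\<close> consist of the inner products of an element of \<open>A\<close> with those of \<open>B\<close>. This is negative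
  definite as soon as \<open>R\<close> is large, and then again there are \<open>k\<close> negative directions, one more than
  \<open>O(n, k - 1)\<close> has.

  Making \<open>R\<close> large. An embedding may replace the angle \<open>\<pi>/m\<close> by any multiple with the same
  denominator, independently for each pair of generators, so no entry of \<open>R\<close> can be prescribed or
  bounded below a priori. What survives is that labels \<open>2p\<close> and \<open>2q\<close> with distinct primes \<open>p\<close>, \<open>q\<close>
  give distinct inner products (\<open>cosines_disjoint\<close>). For each column \<open>j0\<close> take more rows than there
  are choices of entries for the label 8 in the other columns, all with label 8 outside the column
  \<open>j0\<close> and with distinct labels \<open>2p\<close> in it. Two of them agree outside \<open>j0\<close>, and their difference
  controls the coordinate \<open>v j0\<close> (\<open>gram_lower_bound\<close>). Repeating every row \<open>t\<close> times with \<open>t\<close> large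
  beats \<open>G\<close>.

  Why it is hyperbolic. The subgroup \<open>Q\<close> generated by \<open>A\<close> is finite, and the group is \<open>K Q\<close>, where
  \<open>K\<close> is generated by the set \<open>X\<close> of all conjugates of elements of \<open>B\<close> by elements of \<open>Q\<close>. Tits'
  action on signed reflections, with sign changes only for letters in \<open>B\<close>, shows that \<open>K\<close> behaves
  like a Coxeter group with generators \<open>X\<close>, and two elements of \<open>X\<close> never commute nor satisfy a braid
  relation of length 3. So in the Cayley graph of \<open>K\<close> an element with two descents is the top of a
  polygon with \<open>2m\<close> sides, \<open>m \<ge> 4\<close>. Such elements are isolated (\<open>desc_isolated\<close>). It follows that the
  geodesics from the identity to a given element form a chain of polygons (\<open>common_below\<close>), and that
  a suitable geodesic between any two elements passes over at most two polygons (\<open>bottom_meets\<close>).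
  Together these give the Gromov inequality. Dividing out the finite group \<open>Q\<close> changes distances by
  at most 2.
\<close>

section \<open>Chamber graphs with large polygons are hyperbolic\<close>

text \<open>
  Walks along the sides of a polygon: letters \<open>s\<close>, \<open>t\<close> act alternately, \<open>s\<close> first.
\<close>

fun alt :: "('s \<Rightarrow> 'v \<Rightarrow> 'v) \<Rightarrow> 's \<Rightarrow> 's \<Rightarrow> nat \<Rightarrow> 'v \<Rightarrow> 'v" where
  "alt act s t 0 v = v"
| "alt act s t (Suc j) v = alt act t s j (act s v)"

definition alt_letter :: "'s \<Rightarrow> 's \<Rightarrow> nat \<Rightarrow> 's" where
  "alt_letter s t j = (if even j then s else t)"

lemma alt_Suc_last: "alt act s t (Suc j) v = act (alt_letter s t j) (alt act s t j v)"
  by (induction j arbitrary: s t v) (simp_all add: alt_letter_def)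

text \<open>
  The Cayley graph of a reflection group, without the group: \<open>act\<close> is multiplication by a generator,
  \<open>d\<close> the word metric. The last assumption is the gate property of dihedral cosets; the bound
  \<open>4 \<le> m\<close> is where the large labels enter, and \<open>M\<close> becomes the unit of the hyperbolicity constant.
\<close>

locale chamber_graph =
  fixes V :: "'v set" and X :: "'s set" and act :: "'s \<Rightarrow> 'v \<Rightarrow> 'v"
    and d :: "'v \<Rightarrow> 'v \<Rightarrow> nat" and e :: 'v and M :: nat
  assumes act_closed: "s \<in> X \<Longrightarrow> v \<in> V \<Longrightarrow> act s v \<in> V"
    and act_act: "s \<in> X \<Longrightarrow> v \<in> V \<Longrightarrow> act s (act s v) = v"
    and base: "e \<in> V"
    and dist_zero: "x \<in> V \<Longrightarrow> y \<in> V \<Longrightarrow> d x y = 0 \<longleftrightarrow> x = y"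
    and dist_sym: "x \<in> V \<Longrightarrow> y \<in> V \<Longrightarrow> d x y = d y x"
    and dist_triangle: "x \<in> V \<Longrightarrow> y \<in> V \<Longrightarrow> z \<in> V \<Longrightarrow> d x z \<le> d x y + d y z"
    and dist_step: "s \<in> X \<Longrightarrow> x \<in> V \<Longrightarrow> y \<in> V \<Longrightarrow>
        d (act s x) y = Suc (d x y) \<or> Suc (d (act s x) y) = d x y"
    and dist_geodesic: "x \<in> V \<Longrightarrow> y \<in> V \<Longrightarrow> x \<noteq> y \<Longrightarrow> \<exists>s\<in>X. Suc (d (act s x) y) = d x y"
    and two_descents: "w \<in> V \<Longrightarrow> s \<in> X \<Longrightarrow> t \<in> X \<Longrightarrow> s \<noteq> t \<Longrightarrow>
        Suc (d (act s w) e) = d w e \<Longrightarrow> Suc (d (act t w) e) = d w e \<Longrightarrow>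
        \<exists>m. 4 \<le> m \<and> m \<le> M \<and>
          (\<forall>j\<le>m. d (alt act s t j w) e + j = d w e \<and> d (alt act t s j w) e + j = d w e) \<and>
          (\<forall>v\<in>V. alt act s t m v = alt act t s m v)"
begin

abbreviation len :: "'v \<Rightarrow> nat" where "len v \<equiv> d v e"

definition desc :: "'v \<Rightarrow> 's set" where
  "desc v = {s \<in> X. Suc (len (act s v)) = len v}"

definition polygon :: "'v \<Rightarrow> 's \<Rightarrow> 's \<Rightarrow> nat \<Rightarrow> bool" where
  "polygon w s t m \<longleftrightarrow> w \<in> V \<and> s \<in> X \<and> t \<in> X \<and> s \<noteq> t \<and> 4 \<le> m \<and> m \<le> M \<and>
     (\<forall>j\<le>m. len (alt act s t j w) + j = len w \<and> len (alt act t s j w) + j = len w) \<and>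
     (\<forall>v\<in>V. alt act s t m v = alt act t s m v)"

lemma polygon_exists:
  assumes "w \<in> V" "s \<in> desc w" "t \<in> desc w" "s \<noteq> t"
  obtains m where "polygon w s t m"
  using assms two_descents[of w s t] unfolding polygon_def desc_def by blast

lemma polygon_swap: "polygon w s t m \<Longrightarrow> polygon w t s m"
  unfolding polygon_def by metis

lemma alt_closed: "s \<in> X \<Longrightarrow> t \<in> X \<Longrightarrow> v \<in> V \<Longrightarrow> alt act s t j v \<in> V"
  by (induction j arbitrary: s t v) (simp_all add: act_closed)

lemma alt_letter_mem: "s \<in> X \<Longrightarrow> t \<in> X \<Longrightarrow> alt_letter s t j \<in> X"
  by (simp add: alt_letter_def)

lemma polygon_closed: "polygon w s t m \<Longrightarrow> alt act s t j w \<in> V"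
  unfolding polygon_def by (simp add: alt_closed)

lemma polygon_len: "polygon w s t m \<Longrightarrow> j \<le> m \<Longrightarrow> len (alt act s t j w) + j = len w"
  unfolding polygon_def by blast

lemma polygon_desc:
  assumes "polygon w s t m" "j < m"
  shows "alt_letter s t j \<in> desc (alt act s t j w)"
proof -
  have "len (alt act s t (Suc j) w) + Suc j = len w" "len (alt act s t j w) + j = len w"
    using polygon_len[OF assms(1)] assms(2) by (meson Suc_leI less_imp_le)+
  moreover have "alt_letter s t j \<in> X"
    using assms(1) alt_letter_mem unfolding polygon_def by blast
  ultimately show ?thesis
    unfolding desc_def by (simp add: alt_Suc_last del: alt.simps)
qed

lemma polygon_back:
  assumes "polygon w s t m"
  shows "act (alt_letter s t j) (alt act s t (Suc j) w) = alt act s t j w"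
  using assms act_act[OF alt_letter_mem alt_closed] unfolding polygon_def
  by (simp add: alt_Suc_last del: alt.simps)

lemma desc_mem: "s \<in> desc v \<Longrightarrow> s \<in> X"
  by (simp add: desc_def)

lemma desc_back: "v \<in> V \<Longrightarrow> s \<in> desc v \<Longrightarrow> s \<notin> desc (act s v)"
  by (auto simp: desc_def act_act)

text \<open>
  An element with two descents is never directly below another one. If the descents of \<open>w\<close> are \<open>s\<close>,
  \<open>t\<close> and \<open>s w\<close> had a further descent \<open>u\<close>, then \<open>s w\<close> with descents \<open>t\<close>, \<open>u\<close> would be the same
  configuration one level lower, and this descent would never stop.
\<close>

lemma desc_isolated:
  assumes "w \<in> V" "s \<in> desc w" "t \<in> desc w" "s \<noteq> t" "u \<in> desc (act s w)"
  shows "u = t"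
  using assms
proof (induction "len w" arbitrary: w s t u rule: less_induct)
  case less
  show ?case
  proof (rule ccontr)
    assume "u \<noteq> t"
    obtain m where P: "polygon w s t m" using polygon_exists less.prems by blast
    hence m: "4 \<le> m" by (simp add: polygon_def)
    have a: "act s w \<in> V" using less.prems act_closed desc_mem by blast
    have t: "t \<in> desc (act s w)"
      using polygon_desc[OF P, of 1] m by (simp add: alt_letter_def)
    have s: "s \<in> desc (act t (act s w))"
      using polygon_desc[OF P, of 2] m by (simp add: alt_letter_def numeral_2_eq_2)
    have "u \<noteq> s" using desc_back less.prems by blast
    moreover have "len (act s w) < len w" using less.prems(2) by (auto simp: desc_def)
    (* the same configuration one level lower, with t, u, s in place of s, t, u *)
    ultimately show False using less.hyps[OF _ a t less.prems(5) _ s] \<open>u \<noteq> t\<close> by blast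
  qed
qed

text \<open>
  A descent that leaves the polygon from the middle of a side would produce two vertices with two
  descents, one directly below the other. Only the top, the bottom vertex and its two neighbours
  escape this argument.
\<close>

lemma polygon_side:
  assumes P: "polygon w s t m" and j: "1 \<le> j" "j + 2 \<le> m" and u: "u \<in> desc (alt act s t j w)"
  shows "u = alt_letter s t j"
proof (rule ccontr)
  assume n: "u \<noteq> alt_letter s t j"
  let ?v = "alt act s t j w" and ?p = "alt_letter s t j" and ?q = "alt_letter s t (Suc j)"
  have v: "?v \<in> V" using P polygon_closed by blast
  have "?p \<in> desc ?v" using polygon_desc[OF P] j by simp
  moreover have "?q \<in> desc (act ?p ?v)"
    using polygon_desc[OF P, of "Suc j"] j by (simp add: alt_Suc_last del: alt.simps)
  ultimately have "?q = u" using desc_isolated[OF v _ u] n by metis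
  moreover have "?q \<notin> desc ?v"
  proof -
    obtain i where i: "j = Suc i" using j by (cases j) auto
    hence q: "?q = alt_letter s t i" by (simp add: alt_letter_def)
    have "alt_letter s t i \<in> desc (alt act s t i w)" using polygon_desc[OF P, of i] i j by simp
    thus ?thesis using desc_back[OF polygon_closed[OF P]] i q by (simp add: alt_Suc_last del: alt.simps)
  qed
  ultimately show False using u by blast
qed

text \<open>
  At most one of the two sides can be left at its lowest vertex. If both were, the two extra descents
  would be the same letter \<open>u\<close>, and the vertex that \<open>u\<close> reaches from the bottom vertex would lie in the
  middle of a side of two polygons which continue by different letters. This step needs \<open>m \<ge> 4\<close>.
\<close>

lemma polygon_bottom:
  assumes P: "polygon w s t m"
    and u: "u \<in> desc (alt act s t (m - 1) w)" "u \<noteq> alt_letter s t (m - 1)"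
    and u': "u' \<in> desc (alt act t s (m - 1) w)" "u' \<noteq> alt_letter t s (m - 1)"
  shows False
proof -
  let ?z = "alt act s t m w"
  let ?p = "alt_letter s t (m - 1)" and ?p' = "alt_letter t s (m - 1)"
  let ?zp = "alt act s t (m - 1) w" and ?zp' = "alt act t s (m - 1) w"
  have m: "Suc (m - 1) = m" "4 \<le> m" using P by (simp_all add: polygon_def)
  have P': "polygon w t s m" using P polygon_swap by blast
  have V: "?zp \<in> V" "?zp' \<in> V" using P P' polygon_closed by blast+
  have z: "act ?p ?zp = ?z" "act ?p' ?zp' = ?z"
    using P alt_Suc_last[of act s t "m-1" w] alt_Suc_last[of act t s "m-1" w]
    unfolding m by (auto simp: polygon_def)
  have pd: "?p \<in> desc ?zp" "?p' \<in> desc ?zp'"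
    using polygon_desc[OF P, of "m-1"] polygon_desc[OF P', of "m-1"] m by simp_all
  have pp: "?p \<noteq> ?p'" using P by (auto simp: alt_letter_def polygon_def)
  obtain m1 where m1: "polygon ?zp ?p u m1" using polygon_exists[OF V(1) pd(1) u(1)] u(2) by metis
  obtain m2 where m2: "polygon ?zp' ?p' u' m2" using polygon_exists[OF V(2) pd(2) u'(1)] u'(2) by metis
  have m12: "4 \<le> m1" "4 \<le> m2" using m1 m2 by (simp_all add: polygon_def)
  (* both extra descents survive at the bottom vertex, where isolation leaves room for one only *)
  have "u \<in> desc ?z" using polygon_desc[OF m1, of 1] m12 z by (simp add: alt_letter_def)
  hence uu: "u = u'" using desc_isolated[OF V(2) pd(2) u'(1)] u'(2) z by metis
  have "?p' \<in> desc (act u ?z)"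
    using polygon_desc[OF m2, of 2] m12 z uu by (simp add: alt_letter_def numeral_2_eq_2)
  hence "?p' \<in> desc (alt act ?p u 2 ?zp)" using z by (simp add: numeral_2_eq_2)
  from polygon_side[OF m1 _ _ this] m12 have "?p' = ?p" by (simp add: alt_letter_def)
  thus False using pp by simp
qed

text \<open>
  The weak order: \<open>x\<close> lies on a geodesic from the base point to \<open>y\<close>.
\<close>

definition le :: "'v \<Rightarrow> 'v \<Rightarrow> bool" where
  "le = (\<lambda>x y. \<exists>s\<in>desc y. x = act s y)\<^sup>*\<^sup>*"

lemma le_refl [simp]: "le x x" by (simp add: le_def)

lemma le_trans: "le x y \<Longrightarrow> le y z \<Longrightarrow> le x z" by (simp add: le_def)

lemma le_step: "s \<in> desc y \<Longrightarrow> le (act s y) y" unfolding le_def by blast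

lemma le_cases:
  assumes "le x y"
  obtains "x = y" | s where "s \<in> desc y" "le x (act s y)"
  using assms unfolding le_def by (cases rule: rtranclp.cases) auto

lemma le_strict: "le x y \<Longrightarrow> x \<noteq> y \<Longrightarrow> \<exists>s\<in>desc y. le x (act s y)"
  using le_cases[of x y] by blast

lemma le_props:
  assumes "le x y" "y \<in> V"
  shows "x \<in> V \<and> len x \<le> len y \<and> d x y + len x \<le> len y"
  using assms unfolding le_def
proof (induction rule: converse_rtranclp_induct)
  case base
  then show ?case using dist_zero by simp
next
  case (step x z)
  then obtain s where s: "s \<in> desc z" "x = act s z" by blast
  with step have z: "z \<in> V" "len z \<le> len y" "d z y + len z \<le> len y" by auto
  have "s \<in> X" using s desc_mem by blast
  moreover have "d x y \<le> Suc (d z y)" using dist_step[OF \<open>s \<in> X\<close> z(1) step.prems] s by auto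
  ultimately show ?case using z s act_closed by (auto simp: desc_def)
qed

lemma le_mem: "le x y \<Longrightarrow> y \<in> V \<Longrightarrow> x \<in> V" using le_props by blast
lemma le_len: "le x y \<Longrightarrow> y \<in> V \<Longrightarrow> len x \<le> len y" using le_props by blast
lemma le_dist: "le x y \<Longrightarrow> y \<in> V \<Longrightarrow> d x y + len x \<le> len y" using le_props by blast

lemma le_len_eq: "le x y \<Longrightarrow> y \<in> V \<Longrightarrow> len x = len y \<Longrightarrow> x = y"
  using le_props dist_zero by (metis add_is_0 add_le_same_cancel2 le_zero_eq)

lemma le_truncate:
  assumes "y \<in> V" "n \<le> len y"
  shows "\<exists>x. le x y \<and> len x = n"
  using assms
proof (induction "len y" arbitrary: y)
  case 0
  then show ?case by (intro exI[of _ y]) simp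
next
  case (Suc k)
  show ?case
  proof (cases "n = len y")
    case False
    have "y \<noteq> e" using Suc.hyps(2) dist_zero[OF base base] by auto
    then obtain s where s: "s \<in> X" "Suc (len (act s y)) = len y"
      using dist_geodesic Suc base by blast
    then obtain x where "le x (act s y)" "len x = n"
      using Suc.hyps(1)[of "act s y"] Suc.hyps(2) Suc.prems False act_closed by fastforce
    thus ?thesis using le_step[of s y] s le_trans desc_def by blast
  next
    case True
    then show ?thesis by (intro exI[of _ y]) simp
  qed
qed

lemma polygon_le:
  assumes P: "polygon w s t m" and "i \<le> j" "j \<le> m"
  shows "le (alt act s t j w) (alt act s t i w)"
  using assms(2,3)
proof (induction rule: dec_induct)
  case (step n)
  hence "le (alt act s t (Suc n) w) (alt act s t n w)"
    using le_step[OF polygon_desc[OF P, of n]] by (simp add: alt_Suc_last del: alt.simps)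
  thus ?case using step le_trans by (meson Suc_leD)
qed simp

lemma below_polygon_side:
  assumes P: "polygon w s t m" and "le u (alt act s t j w)" "1 \<le> j" "j \<le> m - 1"
  shows "(\<exists>i. j \<le> i \<and> i + 2 \<le> m \<and> u = alt act s t i w) \<or> le u (alt act s t (m - 1) w)"
  using assms(2-)
proof (induction "m - 1 - j" arbitrary: j)
  case 0
  hence "j = m - 1" by simp
  then show ?case using 0 by simp
next
  case (Suc k)
  hence j2: "j + 2 \<le> m" by simp
  from Suc.prems(1) show ?case
  proof (cases rule: le_cases)
    case 1
    then show ?thesis using j2 by auto
  next
    case (2 a)
    hence "a = alt_letter s t j" using polygon_side[OF P _ j2] Suc.prems by blast
    hence "le u (alt act s t (Suc j) w)" using 2 by (simp add: alt_Suc_last del: alt.simps)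
    moreover have "k = m - 1 - Suc j" "Suc j \<le> m - 1" using Suc.hyps(2) by simp_all
    ultimately have "(\<exists>i\<ge>Suc j. i + 2 \<le> m \<and> u = alt act s t i w) \<or> le u (alt act s t (m - 1) w)"
      using Suc.hyps(1)[of "Suc j"] by simp
    thus ?thesis using Suc_leD by blast
  qed
qed

lemma common_below_one_side:
  assumes P: "polygon y a b m" and le: "le u (alt act a b (m - 1) y)" "le v (alt act b a (m - 1) y)"
    and eq: "len u = len v"
    and a: "desc (alt act a b (m - 1) y) \<subseteq> {alt_letter a b (m - 1)}"
    and IH: "\<And>y' u v. y' \<in> V \<Longrightarrow> len y' < len y \<Longrightarrow> le u y' \<Longrightarrow> le v y' \<Longrightarrow> len u = len v \<Longrightarrow>
      \<exists>z. le z u \<and> le z v \<and> len u \<le> len z + M"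
  shows "\<exists>z. le z u \<and> le z v \<and> len u \<le> len z + M"
proof -
  have P': "polygon y b a m" using P polygon_swap by blast
  have m: "4 \<le> m" "m \<le> M" "Suc (m - 1) = m" "m - 1 \<le> m" using P by (auto simp: polygon_def)
  let ?z = "alt act a b m y"
  have zz: "?z = alt act b a m y" using P by (simp add: polygon_def)
  have lz: "le ?z (alt act a b (m - 1) y)" "le ?z (alt act b a (m - 1) y)"
    using polygon_le[OF P, of "m-1" m] polygon_le[OF P', of "m-1" m] m zz by auto
  have Vs: "alt act a b (m - 1) y \<in> V" "alt act b a (m - 1) y \<in> V" using P P' polygon_closed by blast+
  have lens: "len (alt act a b (m - 1) y) + (m - 1) = len y" "len (alt act b a (m - 1) y) + (m - 1) = len y"
     "len ?z + m = len y"
    using polygon_len[OF P, of "m-1"] polygon_len[OF P', of "m-1"] polygon_len[OF P, of m] m by auto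
  from le(1) show ?thesis
  proof (cases rule: le_cases)
    case 1
    hence "v = alt act b a (m - 1) y" using le_len_eq[OF le(2) Vs(2)] eq lens by simp
    thus ?thesis using 1 lz lens m by (intro exI[of _ ?z]) auto
  next
    case (2 s)
    hence "le u ?z" using a alt_Suc_last[of act a b "m-1" y] m by auto
    hence "le u (alt act b a (m - 1) y)" using lz le_trans by blast
    thus ?thesis using IH[OF Vs(2) _ _ le(2) eq] lens m by auto
  qed
qed

text \<open>
  Thinness of bigons. Going down from \<open>y\<close>, geodesics separate only at the top of a polygon, and by
  \<open>polygon_bottom\<close> at least one of the two sides can only be continued through the bottom vertex. So
  either both elements are still on the polygon, or both are below one of its lower vertices.
\<close>

lemma common_below:
  assumes "y \<in> V" "le u y" "le v y" "len u = len v"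
  shows "\<exists>z. le z u \<and> le z v \<and> len u \<le> len z + M"
  using assms
proof (induction "len y" arbitrary: y u v rule: less_induct)
  case less
  show ?case
  proof (cases "u = y \<or> v = y")
    case True
    hence "u = y" "v = y"
      using le_len_eq[OF less.prems(2,1)] le_len_eq[OF less.prems(3,1)] less.prems(4) by auto
    thus ?thesis by (intro exI[of _ y]) simp
  next
    case False
    obtain a where a: "a \<in> desc y" "le u (act a y)" using le_strict[OF less.prems(2)] False by blast
    obtain b where b: "b \<in> desc y" "le v (act b y)" using le_strict[OF less.prems(3)] False by blast
    have IH: "\<exists>z. le z u \<and> le z v \<and> len u \<le> len z + M"
      if "y' \<in> V" "len y' < len y" "le u y'" "le v y'" "len u = len v" for y' u v
      using less.hyps[OF that(2,1,3,4,5)] .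
    show ?thesis
    proof (cases "a = b")
      case True
      have "act a y \<in> V" "len (act a y) < len y"
        using act_closed[OF desc_mem[OF a(1)] less.prems(1)] a(1) by (simp_all add: desc_def)
      then show ?thesis using IH[OF _ _ a(2) b(2)[folded True] less.prems(4)] by blast
    next
      case ab: False
      obtain m where P: "polygon y a b m" using polygon_exists[OF less.prems(1) a(1) b(1) ab] .
      have P': "polygon y b a m" using P polygon_swap by blast
      have m: "4 \<le> m" "m \<le> M" "Suc (m - 1) = m" "m - 1 \<le> m" using P by (auto simp: polygon_def)
      let ?z = "alt act a b m y"
      have zz: "?z = alt act b a m y" using P by (simp add: polygon_def)
      have u: "(\<exists>i. 1 \<le> i \<and> i + 2 \<le> m \<and> u = alt act a b i y) \<or> le u (alt act a b (m - 1) y)"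
        using below_polygon_side[OF P, of u 1] a m by simp
      have v: "(\<exists>i. 1 \<le> i \<and> i + 2 \<le> m \<and> v = alt act b a i y) \<or> le v (alt act b a (m - 1) y)"
        using below_polygon_side[OF P', of v 1] b m by simp
      have Vs: "alt act a b (m - 1) y \<in> V" "alt act b a (m - 1) y \<in> V" using P P' polygon_closed by blast+
      have lens: "len (alt act a b (m - 1) y) + (m - 1) = len y" "len (alt act b a (m - 1) y) + (m - 1) = len y"
        "len ?z + m = len y"
        using polygon_len[OF P, of "m-1"] polygon_len[OF P', of "m-1"] polygon_len[OF P, of m] m by auto
      show ?thesis
      proof (cases "\<exists>i. 1 \<le> i \<and> i + 2 \<le> m \<and> u = alt act a b i y")
        case True
        then obtain i where i: "i + 2 \<le> m" "u = alt act a b i y" by blast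
        have lu: "len u + i = len y" using polygon_len[OF P, of i] i by simp
        have "\<not> le v (alt act b a (m - 1) y)"
          using le_len[OF _ Vs(2)] lens lu i less.prems(4) m by fastforce
        then obtain i' where i': "i' + 2 \<le> m" "v = alt act b a i' y" using v by blast
        have "le ?z u" "le ?z v" using polygon_le[OF P, of i m] polygon_le[OF P', of i' m] i i' zz by auto
        thus ?thesis using lens lu m by (intro exI[of _ ?z]) auto
      next
        case False
        hence u1: "le u (alt act a b (m - 1) y)" using u by blast
        have v1: "le v (alt act b a (m - 1) y)"
        proof (rule ccontr)
          assume "\<not> ?thesis"
          then obtain i where i: "i + 2 \<le> m" "v = alt act b a i y" using v by blast
          have "len v + i = len y" using polygon_len[OF P', of i] i by simp
          thus False using le_len[OF u1 Vs(1)] lens i less.prems(4) m by simp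
        qed
        show ?thesis
        proof (cases "desc (alt act a b (m - 1) y) \<subseteq> {alt_letter a b (m - 1)}")
          case True
          show ?thesis by (rule common_below_one_side[OF P u1 v1 less.prems(4) True]) (rule IH)
        next
          case False
          hence "desc (alt act b a (m - 1) y) \<subseteq> {alt_letter b a (m - 1)}"
            using polygon_bottom[OF P] by blast
          hence "\<exists>z. le z v \<and> le z u \<and> len v \<le> len z + M"
            by (rule common_below_one_side[OF P' v1 u1 less.prems(4)[symmetric]]) (rule IH)
          thus ?thesis unfolding less.prems(4) by blast
        qed
      qed
    qed
  qed
qed

text \<open>
  No descent of \<open>x\<close> is a step towards \<open>y\<close>. From such an \<open>x\<close>, a geodesic to \<open>y\<close> can only start
  upwards.
\<close>

definition bottom :: "'v \<Rightarrow> 'v \<Rightarrow> bool" where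
  "bottom x y \<longleftrightarrow> (\<forall>s\<in>desc x. d (act s x) y = Suc (d x y))"

lemma reach_bottom:
  assumes "x \<in> V" "y \<in> V"
  shows "\<exists>x0. le x0 x \<and> bottom x0 y \<and> d x y + len x0 = len x + d x0 y"
  using assms
proof (induction "len x" arbitrary: x rule: less_induct)
  case less
  show ?case
  proof (cases "bottom x y")
    case True
    then show ?thesis by (intro exI[of _ x]) auto
  next
    case False
    then obtain s where s: "s \<in> desc x" "Suc (d (act s x) y) = d x y"
      using dist_step less.prems desc_mem unfolding bottom_def by meson
    have "act s x \<in> V" "Suc (len (act s x)) = len x" using s less.prems act_closed by (auto simp: desc_def)
    with less.hyps[of "act s x"] obtain x0
      where "le x0 (act s x)" "bottom x0 y" "d (act s x) y + len x0 = len (act s x) + d x0 y"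
      using less.prems by auto
    thus ?thesis using s le_step le_trans \<open>Suc (len (act s x)) = len x\<close>
      by (intro exI[of _ x0]) fastforce
  qed
qed

lemma polygon_dist:
  assumes P: "polygon w s t m" and "i \<le> j" "j \<le> m"
  shows "d (alt act s t i w) (alt act s t j w) \<le> j - i"
    and "d (alt act s t j w) (alt act s t i w) \<le> j - i"
proof -
  have "d (alt act s t j w) (alt act s t i w) + len (alt act s t j w) \<le> len (alt act s t i w)"
    using le_dist[OF polygon_le[OF assms] polygon_closed[OF P]] .
  thus "d (alt act s t j w) (alt act s t i w) \<le> j - i"
    using polygon_len[OF P, of i] polygon_len[OF P, of j] assms by linarith
  thus "d (alt act s t i w) (alt act s t j w) \<le> j - i"
    using dist_sym polygon_closed[OF P] by metis
qed

lemma polygon_dist_other: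
  assumes P: "polygon w s t m" and "i \<le> m" "j \<le> m"
  shows "d (alt act s t i w) (alt act t s j w) \<le> (m - i) + (m - j)"
proof -
  have P': "polygon w t s m" using P polygon_swap by blast
  have "alt act s t m w = alt act t s m w" using P by (simp add: polygon_def)
  thus ?thesis
    using dist_triangle[OF polygon_closed[OF P, of i] polygon_closed[OF P, of m] polygon_closed[OF P', of j]]
      polygon_dist(1)[OF P, of i m] polygon_dist(2)[OF P', of j m] assms by simp
qed

text \<open>
  Follow a geodesic upwards, turning down at the first opportunity. The turning point is the top of a
  polygon, and the ascent runs along a side of it, because the descents on a side are unique.
\<close>

lemma bottom_up_run:
  assumes "x \<in> V" "y \<in> V" "bottom x y"
  shows "le x y \<or> (\<exists>w s t m k. polygon w s t m \<and> 1 \<le> k \<and> k + 2 \<le> m \<and> x = alt act s t k w \<and>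
            Suc (d (act t w) y) = d w y \<and> d x y = k + d w y)"
  using assms
proof (induction "d x y" arbitrary: x)
  case 0
  then show ?case using dist_zero by force
next
  case (Suc n)
  have "x \<noteq> y" using Suc dist_zero by force
  then obtain s where s: "s \<in> X" "Suc (d (act s x) y) = d x y" using dist_geodesic Suc.prems by blast
  let ?x1 = "act s x"
  have x1: "?x1 \<in> V" "act s ?x1 = x" using s Suc.prems act_closed act_act by auto
  have "s \<notin> desc x" using Suc.prems(3) s unfolding bottom_def by fastforce
  hence sd: "s \<in> desc ?x1" using dist_step[OF s(1) Suc.prems(1) base] s x1 by (auto simp: desc_def)
  have lex: "le x ?x1" using le_step[OF sd] x1 by simp
  show ?case
  proof (cases "bottom ?x1 y")
    case True
    then consider "le ?x1 y" | w s' t' m k where "polygon w s' t' m" "1 \<le> k" "k + 2 \<le> m"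
      "?x1 = alt act s' t' k w" "Suc (d (act t' w) y) = d w y" "d ?x1 y = k + d w y"
      using Suc.hyps(1)[of ?x1] Suc.hyps(2) s x1 Suc.prems by fastforce
    thus ?thesis
    proof cases
      case 1
      then show ?thesis using lex le_trans by blast
    next
      case 2
      have "s = alt_letter s' t' k" using polygon_side[OF 2(1,2,3)] sd 2(4) by simp
      hence xk: "x = alt act s' t' (Suc k) w" using x1 2(4) by (simp add: alt_Suc_last del: alt.simps)
      have dk: "d x y = Suc k + d w y" using s 2 by simp
      (* otherwise the arc over the top is no shorter than the arc through the bottom vertex, which
         starts downwards *)
      have "Suc k + 2 \<le> m"
      proof (rule ccontr)
        assume "\<not> ?thesis"
        hence m: "m = Suc (Suc k)" using 2(3) by simp
        define p where "p = alt_letter s' t' (Suc k)"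
        have p: "p \<in> desc x" using polygon_desc[OF 2(1), of "Suc k"] m xk p_def by simp
        have px: "act p x = alt act s' t' m w" using xk m p_def by (simp add: alt_Suc_last del: alt.simps)
        have "d (act p x) (alt act t' s' 1 w) \<le> m - 1"
          using polygon_dist_other[OF 2(1), of m 1] px m by simp
        moreover have "w \<in> V" "t' \<in> X" using 2(1) by (auto simp: polygon_def)
        ultimately have "d (act p x) y \<le> (m - 1) + d (act t' w) y"
          using dist_triangle[of "act p x" "act t' w" y] Suc.prems act_closed p desc_mem
          by fastforce
        hence "d (act p x) y < d x y" using 2(5) dk m by linarith
        thus False using Suc.prems(3) p unfolding bottom_def by fastforce
      qed
      thus ?thesis using 2 xk dk by (metis le_SucI One_nat_def)
    qed
  next
    case False
    then obtain t where t: "t \<in> desc ?x1" "Suc (d (act t ?x1) y) = d ?x1 y"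
      using dist_step x1 Suc.prems desc_mem unfolding bottom_def by meson
    have st: "s \<noteq> t" using t s x1 by auto
    then obtain m where P: "polygon ?x1 s t m" using polygon_exists x1 sd t by metis
    hence "4 \<le> m" by (simp add: polygon_def)
    moreover have "x = alt act s t 1 ?x1" using x1 by simp
    moreover have "d x y = 1 + d ?x1 y" using s by simp
    ultimately show ?thesis using P t
      by (intro disjI2 exI[of _ ?x1] exI[of _ s] exI[of _ t] exI[of _ m] exI[of _ 1]) simp
  qed
qed

text \<open>
  The descent from the top stays on the other side of the polygon for the same reason, and it stops
  before the two arcs make up half of the polygon.
\<close>

lemma down_run:
  assumes P: "polygon w s t m" and k: "1 \<le> k" and y: "y \<in> V"
    and x: "x = alt act s t k w" "bottom x y" "d x y = k + d w y"
    and l: "1 \<le> l" "k + l + 1 \<le> m" "d w y = l + d (alt act t s l w) y"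
  shows "\<exists>l. 1 \<le> l \<and> k + l + 1 \<le> m \<and> bottom (alt act t s l w) y \<and> d w y = l + d (alt act t s l w) y"
  using l
proof (induction "m - l" arbitrary: l)
  case 0
  then show ?case using k by simp
next
  case (Suc n)
  let ?c = "alt act t s l w"
  have P': "polygon w t s m" using P polygon_swap by blast
  have c: "?c \<in> V" using P' polygon_closed by blast
  show ?case
  proof (cases "bottom ?c y")
    case True
    then show ?thesis using Suc.prems by blast
  next
    case False
    then obtain u where u: "u \<in> desc ?c" "Suc (d (act u ?c) y) = d ?c y"
      using dist_step c y desc_mem unfolding bottom_def by meson
    have "u = alt_letter t s l" using polygon_side[OF P' Suc.prems(1) _ u(1)] Suc.prems k by simp
    hence c1: "act u ?c = alt act t s (Suc l) w" by (simp add: alt_Suc_last del: alt.simps)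
    hence dc: "d w y = Suc l + d (alt act t s (Suc l) w) y" using u Suc.prems by simp
    (* otherwise the arc over the top is no shorter than the arc through the bottom vertex *)
    have "k + Suc l + 1 \<le> m"
    proof (rule ccontr)
      assume "\<not> ?thesis"
      hence m: "m = Suc (k + l)" using Suc.prems by simp
      define p where "p = alt_letter s t k"
      have p: "p \<in> desc x" using polygon_desc[OF P, of k] m x l p_def by simp
      have px: "act p x = alt act s t (Suc k) w" using x p_def by (simp add: alt_Suc_last del: alt.simps)
      have "d (act p x) (alt act t s (Suc l) w) \<le> (m - Suc k) + (m - Suc l)"
        using polygon_dist_other[OF P, of "Suc k" "Suc l"] px m Suc.prems k by simp
      moreover have "act p x \<in> V" "alt act t s (Suc l) w \<in> V"
        using px polygon_closed[OF P] polygon_closed[OF P'] by metis+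
      ultimately have "d (act p x) y \<le> (m - Suc k) + (m - Suc l) + d (alt act t s (Suc l) w) y"
        using dist_triangle[OF _ _ y] by fastforce
      hence "d (act p x) y < d x y" using x dc m by simp
      thus False using x(2) p unfolding bottom_def by fastforce
    qed
    moreover have "n = m - Suc l" "1 \<le> Suc l" using Suc.hyps(2) by simp_all
    ultimately show ?thesis using Suc.hyps(1)[of "Suc l"] dc by blast
  qed
qed

text \<open>
  A detour over a polygon: up \<open>k\<close> steps from \<open>x\<close> to the top \<open>w\<close>, then down \<open>l\<close> steps to \<open>c\<close>, where no
  further descent leads towards \<open>y\<close>.
\<close>

definition hump :: "'v \<Rightarrow> 'v \<Rightarrow> 'v \<Rightarrow> nat \<Rightarrow> nat \<Rightarrow> nat \<Rightarrow> 'v \<Rightarrow> 's \<Rightarrow> 's \<Rightarrow> bool" where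
  "hump y x c m k l w s t \<longleftrightarrow> polygon w s t m \<and> 1 \<le> k \<and> 1 \<le> l \<and> k + l + 1 \<le> m \<and>
     x = alt act s t k w \<and> c = alt act t s l w \<and> bottom c y \<and>
     d x y = k + d w y \<and> d w y = l + d c y"

lemma hump_dist_up: "hump y x c m k l w s t \<Longrightarrow> d x y = k + d w y"
  unfolding hump_def by (elim conjE)

lemma hump_dist_down: "hump y x c m k l w s t \<Longrightarrow> d w y = l + d c y"
  unfolding hump_def by (elim conjE)

lemma hump_bottom: "hump y x c m k l w s t \<Longrightarrow> bottom c y"
  unfolding hump_def by (elim conjE)

lemma bottom_hump:
  assumes "x \<in> V" "y \<in> V" "bottom x y"
  shows "le x y \<or> (\<exists>c m k l w s t. hump y x c m k l w s t)"
proof (cases "le x y")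
  case False
  then obtain w s t m k where h: "polygon w s t m" "1 \<le> k" "k + 2 \<le> m" "x = alt act s t k w"
            "Suc (d (act t w) y) = d w y" "d x y = k + d w y"
    using bottom_up_run[OF assms] by blast
  have "\<exists>l. 1 \<le> l \<and> k + l + 1 \<le> m \<and> bottom (alt act t s l w) y \<and> d w y = l + d (alt act t s l w) y"
    using down_run[OF h(1,2) assms(2) h(4) assms(3) h(6), of 1] h by simp
  thus ?thesis using h unfolding hump_def by blast
qed simp

text \<open>
  In the valley \<open>c\<close> between two humps both polygons descend along the same edge. If one of them
  continued that edge by a further vertex in the middle of its side, this vertex would have two
  descents, one for each polygon. So the valley is as low as possible in both polygons.
\<close>

lemma consecutive_humps:
  assumes h1: "hump y x c m k l w s t" and h2: "hump y c c' m' k' l' w' s' t'" and y: "y \<in> V"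
  shows "l + 2 = m \<and> k' + 2 = m'"
proof -
  have P1: "polygon w t s m" and P2: "polygon w' s' t' m'"
    using h1 h2 polygon_swap unfolding hump_def by blast+
  have c: "c = alt act t s l w" "c = alt act s' t' k' w'" using h1 h2 by (simp_all add: hump_def)
  have ineq: "1 \<le> l" "l + 2 \<le> m" "1 \<le> k'" "k' + 2 \<le> m'" using h1 h2 unfolding hump_def by linarith+
  have dw: "d w y = l + d c y" "d c y = k' + d w' y" using hump_dist_down[OF h1] hump_dist_up[OF h2] .
  have V: "w \<in> V" "w' \<in> V" "c \<in> V" using P1 P2 polygon_closed c by (auto simp: polygon_def)
  obtain i where i: "l = Suc i" using ineq by (cases l) auto
  obtain i' where i': "k' = Suc i'" using ineq by (cases k') auto
  let ?b1 = "alt_letter t s i" and ?b2 = "alt_letter s' t' i'"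
  have up1: "act ?b1 c = alt act t s i w" using polygon_back[OF P1, of i] c i by (simp del: alt.simps)
  have up2: "act ?b2 c = alt act s' t' i' w'" using polygon_back[OF P2, of i'] c(2) i' by (simp del: alt.simps)
  have "d w (act ?b1 c) \<le> i" using polygon_dist(1)[OF P1, of 0 i] up1 i ineq by simp
  moreover have "d w y \<le> d w (act ?b1 c) + d (act ?b1 c) y"
    using dist_triangle V y up1 polygon_closed[OF P1] by metis
  ultimately have n1: "d c y < d (act ?b1 c) y" using dw i by linarith
  have "d (act ?b2 c) w' \<le> i'" using polygon_dist(2)[OF P2, of 0 i'] up2 i' ineq by simp
  moreover have "d (act ?b2 c) y \<le> d (act ?b2 c) w' + d w' y"
    using dist_triangle V y up2 polygon_closed[OF P2] by metis
  ultimately have n2: "d (act ?b2 c) y < d c y" using dw i' by linarith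
  (* the upward edges of the two polygons at c differ: one leads away from y, the other towards y *)
  have b: "?b1 \<noteq> ?b2" using n1 n2 by auto
  have a: "alt_letter s' t' k' \<in> desc c" using polygon_desc[OF P2, of k'] ineq c by simp
  hence aa: "alt_letter s' t' k' = alt_letter t s l" using polygon_side[OF P1 ineq(1,2)] c by metis
  let ?a = "alt_letter t s l"
  have ca: "act ?a c = alt act t s (Suc l) w" by (simp only: alt_Suc_last c(1))
  have ca': "act ?a c = alt act s' t' (Suc k') w'" by (simp only: alt_Suc_last aa c(2))
  have b1: "?b1 \<in> desc (act ?a c)" using polygon_desc[OF P1, of "Suc l"] ineq i ca by (simp add: alt_letter_def del: alt.simps)
  have b2: "?b2 \<in> desc (act ?a c)" using polygon_desc[OF P2, of "Suc k'"] ineq i' ca' by (simp add: alt_letter_def del: alt.simps)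
  have "l + 2 = m"
  proof (rule ccontr)
    assume "l + 2 \<noteq> m"
    hence "?b2 = alt_letter t s (Suc l)" using polygon_side[OF P1, of "Suc l"] b2 ca ineq by auto
    thus False using b i by (simp add: alt_letter_def)
  qed
  moreover have "k' + 2 = m'"
  proof (rule ccontr)
    assume "k' + 2 \<noteq> m'"
    hence "?b1 = alt_letter s' t' (Suc k')" using polygon_side[OF P2, of "Suc k'"] b1 ca' ineq by auto
    thus False using b i' by (simp add: alt_letter_def)
  qed
  ultimately show ?thesis by simp
qed

lemma hump_below:
  assumes h: "hump y x c m k l w s t"
  obtains z where "le z x" "le z c" "len x \<le> len z + M" "len c \<le> len z + M" "c \<in> V" "x \<in> V"
proof -
  have P: "polygon w s t m" and P': "polygon w t s m" using h polygon_swap unfolding hump_def by blast+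
  have m: "m \<le> M" and zz: "alt act s t m w = alt act t s m w" using P by (auto simp: polygon_def)
  have kl: "k \<le> m" "l \<le> m" using h unfolding hump_def by linarith+
  show thesis
  proof (rule that[of "alt act s t m w"])
    show "le (alt act s t m w) x" using polygon_le[OF P kl(1)] h by (simp add: hump_def)
    show "le (alt act s t m w) c" using polygon_le[OF P' kl(2)] h zz by (simp add: hump_def)
    show "len x \<le> len (alt act s t m w) + M" "len c \<le> len (alt act s t m w) + M"
      using polygon_len[OF P kl(1)] polygon_len[OF P' kl(2)] polygon_len[OF P, of m] m h
      by (simp_all add: hump_def)
    show "c \<in> V" "x \<in> V" using h polygon_closed[OF P] polygon_closed[OF P'] by (simp_all add: hump_def)
  qed
qed

lemma common_below_levels:
  assumes "y \<in> V" "le u y" "le v y"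
  shows "\<exists>z. le z u \<and> le z v \<and> min (len u) (len v) \<le> len z + M"
proof -
  let ?n = "min (len u) (len v)"
  have uv: "u \<in> V" "v \<in> V" using assms le_mem by blast+
  obtain u' where u': "le u' u" "len u' = ?n" using le_truncate[OF uv(1), of ?n] by auto
  obtain v' where v': "le v' v" "len v' = ?n" using le_truncate[OF uv(2), of ?n] by auto
  have "len u' = len v'" using u'(2) v'(2) by simp
  then obtain z where z: "le z u'" "le z v'" "len u' \<le> len z + M"
    using common_below[OF assms(1) le_trans[OF u'(1) assms(2)] le_trans[OF v'(1) assms(3)]] by blast
  have "le z u" "le z v" using le_trans[OF z(1) u'(1)] le_trans[OF z(2) v'(1)] .
  thus ?thesis using z(3) unfolding u'(2) by blast
qed

text \<open>
  There are at most two humps: the middle one of three would have \<open>k = l = m - 2\<close> by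
  \<open>consecutive_humps\<close>, but \<open>k + l < m\<close> and \<open>m \<ge> 4\<close>. Each hump leads to a common lower bound of its two
  ends, and for two humps the two bounds are compared below the valley.
\<close>

lemma bottom_meets:
  assumes "x \<in> V" "y \<in> V" "bottom x y"
  shows "\<exists>z. le z x \<and> le z y \<and> len x \<le> len z + 3 * M"
proof (cases "le x y")
  case True
  then show ?thesis by (intro exI[of _ x]) simp
next
  case False
  then obtain c m k l w s t where h1: "hump y x c m k l w s t" using bottom_hump[OF assms] by blast
  obtain z1 where z1: "le z1 x" "le z1 c" "len x \<le> len z1 + M" "len c \<le> len z1 + M" "c \<in> V"
    by (rule hump_below[OF h1])
  show ?thesis
  proof (cases "le c y")
    case True
    hence "le z1 y" using le_trans[OF z1(2)] by blast
    moreover have "len x \<le> len z1 + 3 * M" using z1(3) by simp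
    ultimately show ?thesis using z1(1) by blast
  next
    case False
    have "bottom c y" using hump_bottom[OF h1] .
    then obtain c2 m2 k2 l2 w2 s2 t2 where h2: "hump y c c2 m2 k2 l2 w2 s2 t2"
      using bottom_hump[OF z1(5) assms(2)] False by blast
    obtain z2 where z2: "le z2 c" "le z2 c2" "len c \<le> len z2 + M" "len c2 \<le> len z2 + M" "c2 \<in> V"
      by (rule hump_below[OF h2])
    have k2: "k2 + 2 = m2" using consecutive_humps[OF h1 h2 assms(2)] by simp
    have "le c2 y"
    proof (rule ccontr)
      assume "\<not> le c2 y"
      moreover have "bottom c2 y" using hump_bottom[OF h2] .
      ultimately obtain c3 m3 k3 l3 w3 s3 t3 where h3: "hump y c2 c3 m3 k3 l3 w3 s3 t3"
        using bottom_hump[OF z2(5) assms(2)] by blast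
      have "l2 + 2 = m2" using consecutive_humps[OF h2 h3 assms(2)] by simp
      moreover have "k2 + l2 + 1 \<le> m2" "4 \<le> m2" using h2 by (auto simp: hump_def polygon_def)
      ultimately show False using k2 by linarith
    qed
    hence "le z2 y" using le_trans[OF z2(2)] by blast
    obtain z where z: "le z z1" "le z z2" "min (len z1) (len z2) \<le> len z + M"
      using common_below_levels[OF z1(5) z1(2) z2(1)] by blast
    have "len z1 \<le> len c" using le_len z1 by blast
    hence "len x \<le> len z + 3 * M" using z z1 z2 by linarith
    moreover have "le z x" "le z y" using le_trans[OF z(1) z1(1)] le_trans[OF z(2) \<open>le z2 y\<close>] .
    ultimately show ?thesis by blast
  qed
qed

text \<open>
  Up to a constant, the Gromov product of \<open>x\<close> and \<open>y\<close> is at most the length of a common lower bound. So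
  the Gromov inequality follows by applying \<open>common_below\<close> to two lower bounds of the middle point.
\<close>

lemma meet_estimate:
  assumes "x \<in> V" "y \<in> V"
  shows "\<exists>z. le z x \<and> le z y \<and> len x + len y \<le> d x y + 2 * len z + 6 * M"
proof -
  obtain x0 where x0: "le x0 x" "bottom x0 y" "d x y + len x0 = len x + d x0 y"
    using reach_bottom[OF assms] by blast
  have V: "x0 \<in> V" using x0 assms le_mem by blast
  obtain z where z: "le z x0" "le z y" "len x0 \<le> len z + 3 * M" using bottom_meets[OF V assms(2) x0(2)] by blast
  have "len y \<le> d x0 y + len x0" using dist_triangle[OF assms(2) V base] dist_sym[OF assms(2) V] by simp
  hence "len x + len y \<le> d x y + 2 * len z + 6 * M" using z x0(3) by linarith
  thus ?thesis using le_trans[OF z(1) x0(1)] z(2) by blast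
qed

theorem gromov_inequality:
  assumes "x \<in> V" "y \<in> V" "z \<in> V"
  shows "(real (len x) + len z - d x z) / 2 \<ge>
    min ((real (len x) + len y - d x y) / 2) ((real (len y) + len z - d y z) / 2) - 4 * M"
proof -
  obtain u where u: "le u x" "le u y" "len x + len y \<le> d x y + 2 * len u + 6 * M"
    using meet_estimate[OF assms(1,2)] by blast
  obtain v where v: "le v y" "le v z" "len y + len z \<le> d y z + 2 * len v + 6 * M"
    using meet_estimate[OF assms(2,3)] by blast
  obtain w where w: "le w u" "le w v" "min (len u) (len v) \<le> len w + M"
    using common_below_levels[OF assms(2) u(2) v(1)] by blast
  have wx: "le w x" "le w z" using le_trans[OF w(1) u(1)] le_trans[OF w(2) v(2)] .
  have "w \<in> V" using le_mem wx assms by blast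
  hence "d x z \<le> d w x + d w z" using dist_triangle[of x w z] dist_sym assms by metis
  hence "d x z + 2 * len w \<le> len x + len z" using le_dist[OF wx(1)] le_dist[OF wx(2)] assms by linarith
  thus ?thesis using w(3) u(3) v(3) by (simp add: min_def field_simps split: if_splits)
qed

end

section \<open>The action of a group on signed reflections\<close>

context group begin

text \<open>
  One letter of Tits' action on reflections with a sign. The parameter \<open>c\<close> tells whether the letter
  is counted; the remaining letters only conjugate.
\<close>

definition flip :: "'a \<Rightarrow> bool \<Rightarrow> 'a \<times> bool \<Rightarrow> 'a \<times> bool" where
  "flip s c = (\<lambda>(r, b). if r \<in> carrier G then (s \<otimes> r \<otimes> s, b \<noteq> (c \<and> r = s)) else (r, b))"

lemma inv_cancel_left [simp]:
  assumes "g \<in> carrier G" "h \<in> carrier G"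
  shows "inv g \<otimes> (g \<otimes> h) = h" "g \<otimes> (inv g \<otimes> h) = h"
  using assms by (simp_all add: m_assoc [symmetric])

lemma conj_self_iff:
  assumes "s \<in> carrier G" "s \<otimes> s = \<one>" "r \<in> carrier G"
  shows "s \<otimes> r \<otimes> s = s \<longleftrightarrow> r = s"
proof
  assume "s \<otimes> r \<otimes> s = s"
  hence "s \<otimes> r \<otimes> s = \<one> \<otimes> s" using assms by simp
  hence "s \<otimes> r = \<one>" using right_cancel[of s "s \<otimes> r" \<one>] assms by simp
  hence "s \<otimes> (s \<otimes> r) = s" using assms by simp
  moreover have "s \<otimes> (s \<otimes> r) = r" using assms by (simp add: m_assoc[symmetric])
  ultimately show "r = s" by simp
qed (use assms in \<open>simp add: m_assoc\<close>)

lemma flip_flip: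
  assumes "s \<in> carrier G" "s \<otimes> s = \<one>"
  shows "flip s c \<circ> flip s c = id"
proof
  fix x :: "'a \<times> bool"
  obtain r b where x: "x = (r, b)" by force
  have "s \<otimes> (s \<otimes> r \<otimes> s) \<otimes> s = r" if "r \<in> carrier G"
  proof -
    have "s \<otimes> (s \<otimes> r \<otimes> s) \<otimes> s = (s \<otimes> s) \<otimes> r \<otimes> (s \<otimes> s)" using assms(1) that by (simp add: m_assoc)
    thus ?thesis using assms(2) that by simp
  qed
  thus "(flip s c \<circ> flip s c) x = id x"
    using x assms conj_self_iff[OF assms] by (auto simp: flip_def)
qed

lemma pow_conj_involution:
  assumes "s \<in> carrier G" "s \<otimes> s = \<one>" "p \<in> carrier G" "s \<otimes> p \<otimes> s = inv p"
  shows "s \<otimes> (p [^] (n::nat)) \<otimes> s = inv (p [^] n)"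
proof (induction n)
  case (Suc n)
  have "s \<otimes> (p [^] Suc n) \<otimes> s = (s \<otimes> p [^] n \<otimes> s) \<otimes> (s \<otimes> p \<otimes> s)"
  proof -
    have "(s \<otimes> p [^] n \<otimes> s) \<otimes> (s \<otimes> p \<otimes> s) = s \<otimes> p [^] n \<otimes> (s \<otimes> s) \<otimes> p \<otimes> s"
      using assms(1,3) by (simp add: m_assoc)
    thus ?thesis using assms by (simp add: m_assoc)
  qed
  also have "\<dots> = inv (p [^] n) \<otimes> inv p" using Suc assms by simp
  also have "\<dots> = inv (p \<otimes> p [^] n)" using assms by (simp add: inv_mult_group)
  also have "p \<otimes> p [^] n = p [^] Suc n" using assms(3) nat_pow_Suc2 by simp
  finally show ?case .
qed (use assms in simp)

text \<open>
  The half \<open>c = (s t)\<^sup>h\<close> of the relator is an involution that commutes with \<open>s\<close> and \<open>t\<close>. Hence the first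
  and the second half of the relator change the sign in the same cases, and the two changes cancel.
  This holds for every choice of counted letters, which is what even labels are used for.
\<close>

lemma flip_braid:
  fixes h :: nat
  assumes s: "s \<in> carrier G" "s \<otimes> s = \<one>" and t: "t \<in> carrier G" "t \<otimes> t = \<one>"
    and st: "(s \<otimes> t) [^] (2 * h) = \<one>"
  shows "(flip t b' \<circ> flip s b) ^^ (2 * h) = id"
proof -
  define p where "p = s \<otimes> t"
  define c where "c = p [^] h"
  define F where "F = flip t b' \<circ> flip s b"
  have p: "p \<in> carrier G" and c: "c \<in> carrier G" using s t by (auto simp: p_def c_def)
  have "c \<otimes> c = p [^] (2 * h)" unfolding c_def using p by (simp add: nat_pow_mult mult_2)
  hence cc: "c \<otimes> c = \<one>" using st p_def by simp
  hence ic: "inv c = c" using c inv_equality by simp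
  have ip: "inv p = t \<otimes> s" unfolding p_def using s t by (simp add: inv_mult_group inv_equality)
  have "s \<otimes> p \<otimes> s = (s \<otimes> s) \<otimes> t \<otimes> s" unfolding p_def using s(1) t(1) by (simp add: m_assoc)
  hence "s \<otimes> p \<otimes> s = inv p" using ip s t by simp
  hence scs: "s \<otimes> c \<otimes> s = c" unfolding c_def using pow_conj_involution[OF s p] ic c_def by simp
  have "t \<otimes> p \<otimes> t = t \<otimes> s \<otimes> (t \<otimes> t)" unfolding p_def using s(1) t(1) by (simp add: m_assoc)
  hence "t \<otimes> p \<otimes> t = inv p" using ip s t by simp
  hence tct: "t \<otimes> c \<otimes> t = c" unfolding c_def using pow_conj_involution[OF t p] ic c_def by simp
  have comm: "x \<otimes> c = c \<otimes> x" if "x \<in> carrier G" "x \<otimes> x = \<one>" "x \<otimes> c \<otimes> x = c" for x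
  proof -
    have "(x \<otimes> c \<otimes> x) \<otimes> x = x \<otimes> c \<otimes> (x \<otimes> x)" using that(1) c by (simp add: m_assoc)
    thus ?thesis using that c by simp
  qed
  have sc: "s \<otimes> c = c \<otimes> s" and tc: "t \<otimes> c = c \<otimes> t" using comm s t scs tct by auto
  (* conjugation by c and reversal of the sign both commute with every letter *)
  define \<gamma> where "\<gamma> = (\<lambda>(r, b :: bool). (if r \<in> carrier G then c \<otimes> r \<otimes> c else r, b))"
  define \<tau> where "\<tau> = (\<lambda>(r :: 'a, b). (r, \<not> b))"
  have g: "\<gamma> (flip x b x') = flip x b (\<gamma> x')" if x: "x \<in> carrier G" "x \<otimes> x = \<one>" "x \<otimes> c = c \<otimes> x" for x b x'
  proof -
    obtain r e where r: "x' = (r, e)" by force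
    have "c \<otimes> (x \<otimes> r \<otimes> x) \<otimes> c = x \<otimes> (c \<otimes> r \<otimes> c) \<otimes> x" if "r \<in> carrier G"
    proof -
      have "c \<otimes> (x \<otimes> r \<otimes> x) \<otimes> c = (c \<otimes> x) \<otimes> r \<otimes> (x \<otimes> c)"
        using that c x(1) by (simp add: m_assoc)
      also have "\<dots> = (x \<otimes> c) \<otimes> r \<otimes> (c \<otimes> x)" unfolding x(3) ..
      finally show ?thesis using that c x(1) by (simp add: m_assoc)
    qed
    moreover have "c \<otimes> r \<otimes> c = x \<longleftrightarrow> r = x" if rc: "r \<in> carrier G"
    proof
      have cxc: "c \<otimes> x \<otimes> c = x" using x(3)[symmetric] x(1) c cc by (simp add: m_assoc)
      show "c \<otimes> r \<otimes> c = x" if "r = x" using that cxc by simp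
      assume "c \<otimes> r \<otimes> c = x"
      hence "c \<otimes> r \<otimes> c = c \<otimes> x \<otimes> c" using cxc by simp
      thus "r = x" using c x rc by simp
    qed
    ultimately show ?thesis using r x c by (auto simp: \<gamma>_def flip_def)
  qed
  have gF: "\<gamma> (F x) = F (\<gamma> x)" for x unfolding F_def using g s t sc tc by simp
  have gFn: "\<gamma> ((F ^^ n) x) = (F ^^ n) (\<gamma> x)" for n x by (induction n) (auto simp: gF)
  have tF: "\<tau> (F x) = F (\<tau> x)" for x by (cases x) (auto simp: F_def \<tau>_def flip_def)
  have tFn: "\<tau> ((F ^^ n) x) = (F ^^ n) (\<tau> x)" for n x by (induction n) (auto simp: tF)
  have fstF: "fst ((F ^^ n) (r, e)) = inv (p [^] n) \<otimes> r \<otimes> p [^] n" if r: "r \<in> carrier G" for n r e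
  proof (induction n)
    case (Suc n)
    obtain e' where e': "(F ^^ n) (r, e) = (inv (p [^] n) \<otimes> r \<otimes> p [^] n, e')"
      using Suc by (metis prod.collapse)
    have "fst (F (inv (p [^] n) \<otimes> r \<otimes> p [^] n, e')) = t \<otimes> (s \<otimes> (inv (p [^] n) \<otimes> r \<otimes> p [^] n) \<otimes> s) \<otimes> t"
      using r p s t by (simp add: F_def flip_def)
    also have "\<dots> = inv p \<otimes> (inv (p [^] n) \<otimes> r \<otimes> p [^] n) \<otimes> p"
      unfolding ip using r p s t by (simp add: p_def m_assoc)
    also have "\<dots> = inv (p [^] Suc n) \<otimes> r \<otimes> p [^] Suc n"
      using r p by (simp add: m_assoc inv_mult_group)
    finally show ?case using e' by simp
  qed (use r in simp)
  have gg: "\<gamma> (\<gamma> x) = x" for x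
  proof -
    have "c \<otimes> (c \<otimes> r \<otimes> c) \<otimes> c = r" if "r \<in> carrier G" for r
    proof -
      have "c \<otimes> (c \<otimes> r \<otimes> c) \<otimes> c = (c \<otimes> c) \<otimes> r \<otimes> (c \<otimes> c)" using c that by (simp add: m_assoc)
      thus ?thesis using cc that by simp
    qed
    thus ?thesis using c by (cases x) (auto simp: \<gamma>_def)
  qed
  show ?thesis
  proof
    fix x :: "'a \<times> bool"
    obtain r e where x: "x = (r, e)" by force
    show "((flip t b' \<circ> flip s b) ^^ (2 * h)) x = id x"
    proof (cases "r \<in> carrier G")
      case False
      have "(F ^^ n) x = x" for n using x False by (induction n) (auto simp: F_def flip_def)
      thus ?thesis unfolding F_def by simp
    next
      case True
      have FF: "(F ^^ (2 * h)) x = (F ^^ h) ((F ^^ h) x)" by (simp add: mult_2 funpow_add)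
      have "fst ((F ^^ h) x) = c \<otimes> r \<otimes> c" using fstF[OF True] x ic c_def by simp
      hence "(F ^^ h) x = \<gamma> x \<or> (F ^^ h) x = \<gamma> (\<tau> x)"
        using True x by (cases "(F ^^ h) x") (auto simp: \<gamma>_def \<tau>_def)
      thus ?thesis
      proof
        assume 1: "(F ^^ h) x = \<gamma> x"
        thus ?thesis using FF gFn[of h x] gg unfolding F_def by simp
      next
        assume 2: "(F ^^ h) x = \<gamma> (\<tau> x)"
        have "\<tau> (\<gamma> (\<tau> x)) = \<gamma> x" by (cases x) (auto simp: \<tau>_def \<gamma>_def)
        have "(F ^^ (2 * h)) x = (F ^^ h) (\<gamma> (\<tau> x))" using FF 2 by simp
        also have "\<dots> = \<gamma> (\<tau> ((F ^^ h) x))" using gFn[of h "\<tau> x"] tFn[of h x] by simp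
        also have "\<dots> = x" using 2 \<open>\<tau> (\<gamma> (\<tau> x)) = \<gamma> x\<close> gg by simp
        finally show ?thesis unfolding F_def by simp
      qed
    qed
  qed
qed

end

section \<open>Groups with a reflection cocycle\<close>

fun alt_word :: "'a \<Rightarrow> 'a \<Rightarrow> nat \<Rightarrow> 'a list" where
  "alt_word s t 0 = []"
| "alt_word s t (Suc n) = s # alt_word t s n"

lemma length_alt_word [simp]: "length (alt_word s t n) = n"
  by (induction n arbitrary: s t) auto

lemma set_alt_word: "set (alt_word s t n) \<subseteq> {s, t}"
  by (induction n arbitrary: s t) auto

lemma alt_word_append:
  "alt_word s t (m + n) = alt_word s t m @ (if even m then alt_word s t n else alt_word t s n)"
  by (induction m arbitrary: s t) auto

text \<open>
  \<open>N g r\<close> means that the wall of the reflection \<open>r\<close> separates 1 and \<open>g\<close>. The existence of such a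
  function makes the subgroup generated by \<open>X\<close> a reflection group, without a presentation. The last
  two assumptions exclude polygons with four or six sides.
\<close>

locale reflection_cocycle = group G for G (structure) +
  fixes X :: "'a set" and N :: "'a \<Rightarrow> 'a \<Rightarrow> bool"
  assumes finite_X: "finite X"
    and X_carrier: "X \<subseteq> carrier G"
    and X_involution: "x \<in> X \<Longrightarrow> x \<otimes> x = \<one>"
    and N_one: "r \<in> carrier G \<Longrightarrow> \<not> N \<one> r"
    and N_mult: "x \<in> X \<Longrightarrow> g \<in> carrier G \<Longrightarrow> r \<in> carrier G \<Longrightarrow>
        N (x \<otimes> g) r \<longleftrightarrow> (r = x) \<noteq> N g (x \<otimes> r \<otimes> x)"
    and no_commute: "s \<in> X \<Longrightarrow> t \<in> X \<Longrightarrow> s \<noteq> t \<Longrightarrow> s \<otimes> t \<noteq> t \<otimes> s"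
    and no_braid: "s \<in> X \<Longrightarrow> t \<in> X \<Longrightarrow> s \<noteq> t \<Longrightarrow> s \<otimes> (t \<otimes> s) \<noteq> t \<otimes> (s \<otimes> t)"
begin

fun wprod :: "'a list \<Rightarrow> 'a" where
  "wprod [] = \<one>"
| "wprod (x # ws) = x \<otimes> wprod ws"

definition K :: "'a set" where "K = wprod ` lists X"

definition len :: "'a \<Rightarrow> nat" where
  "len g = (LEAST n. \<exists>ws\<in>lists X. length ws = n \<and> wprod ws = g)"

lemma X_closed [simp]: "x \<in> X \<Longrightarrow> x \<in> carrier G"
  using X_carrier by blast

lemma wprod_closed [simp]: "set ws \<subseteq> X \<Longrightarrow> wprod ws \<in> carrier G"
  by (induction ws) auto

lemma X_cancel [simp]: "x \<in> X \<Longrightarrow> g \<in> carrier G \<Longrightarrow> x \<otimes> (x \<otimes> g) = g"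
  by (simp add: m_assoc [symmetric] X_involution)

lemma wprod_append: "set us \<subseteq> X \<Longrightarrow> set vs \<subseteq> X \<Longrightarrow> wprod (us @ vs) = wprod us \<otimes> wprod vs"
  by (induction us) (auto simp: m_assoc)

lemma inv_X [simp]: "x \<in> X \<Longrightarrow> inv x = x"
  using X_involution inv_equality by simp

lemma wprod_rev: "set us \<subseteq> X \<Longrightarrow> wprod (rev us) = inv (wprod us)"
  by (induction us) (auto simp: wprod_append inv_mult_group)

lemma K_carrier [simp]: "g \<in> K \<Longrightarrow> g \<in> carrier G"
  by (auto simp: K_def lists_eq_set)

lemma KI: "set ws \<subseteq> X \<Longrightarrow> wprod ws \<in> K"
  by (auto simp: K_def lists_eq_set)

lemma KE: assumes "g \<in> K" obtains ws where "set ws \<subseteq> X" "g = wprod ws"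
  using assms by (auto simp: K_def lists_eq_set)

lemma K_one: "\<one> \<in> K" using KI[of "[]"] by simp

lemma K_mult: "g \<in> K \<Longrightarrow> h \<in> K \<Longrightarrow> g \<otimes> h \<in> K"
  by (elim KE) (metis KI wprod_append set_append Un_least)

lemma K_inv: "g \<in> K \<Longrightarrow> inv g \<in> K"
  by (elim KE) (metis KI wprod_rev set_rev)

lemma X_K: "x \<in> X \<Longrightarrow> x \<in> K" using KI[of "[x]"] by simp

lemma len_le: "set ws \<subseteq> X \<Longrightarrow> len (wprod ws) \<le> length ws"
  unfolding len_def by (rule Least_le) (auto simp: lists_eq_set)

lemma len_word:
  assumes "g \<in> K" obtains ws where "set ws \<subseteq> X" "wprod ws = g" "length ws = len g"
proof -
  obtain ws where "set ws \<subseteq> X" "g = wprod ws" using assms by (rule KE)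
  hence "\<exists>n. \<exists>ws\<in>lists X. length ws = n \<and> wprod ws = g" by (auto simp: lists_eq_set)
  from LeastI_ex[OF this] show thesis using that unfolding len_def by (auto simp: lists_eq_set)
qed

lemma len_one [simp]: "len \<one> = 0" using len_le[of "[]"] by simp

lemma len_zero: "g \<in> K \<Longrightarrow> len g = 0 \<longleftrightarrow> g = \<one>"
  by (auto elim: len_word)

lemma len_mult: assumes "g \<in> K" "h \<in> K" shows "len (g \<otimes> h) \<le> len g + len h"
proof -
  obtain us where us: "set us \<subseteq> X" "wprod us = g" "length us = len g" using assms len_word by metis
  obtain vs where vs: "set vs \<subseteq> X" "wprod vs = h" "length vs = len h" using assms len_word by metis
  show ?thesis using len_le[of "us @ vs"] us vs by (simp add: wprod_append)
qed

lemma len_inv_le: assumes "g \<in> K" shows "len (inv g) \<le> len g"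
proof -
  obtain us where us: "set us \<subseteq> X" "wprod us = g" "length us = len g" using assms len_word by metis
  show ?thesis using len_le[of "rev us"] us by (simp add: wprod_rev)
qed

lemma len_inv: "g \<in> K \<Longrightarrow> len (inv g) = len g"
  using len_inv_le[of g] len_inv_le[of "inv g"] K_inv[of g] by simp

lemma len_X_le: "x \<in> X \<Longrightarrow> len x \<le> 1" using len_le[of "[x]"] by simp

text \<open>
  Walls crossed by a word are crossed at one of its letters, and this letter can be deleted.
\<close>

lemma exchange:
  assumes "set ws \<subseteq> X" "r \<in> carrier G" "N (wprod ws) r"
  shows "\<exists>us x vs. ws = us @ x # vs \<and> r \<otimes> wprod ws = wprod (us @ vs)"
  using assms
proof (induction ws arbitrary: r)
  case Nil
  then show ?case using N_one by simp
next
  case (Cons x ws)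
  hence x: "x \<in> X" and ws: "set ws \<subseteq> X" by auto
  show ?case
  proof (cases "r = x")
    case True
    then show ?thesis using x ws by (intro exI[of _ "[]"]) auto
  next
    case False
    hence "N (wprod ws) (x \<otimes> r \<otimes> x)" using Cons.prems x ws N_mult by simp
    then obtain us y vs where u: "ws = us @ y # vs" "(x \<otimes> r \<otimes> x) \<otimes> wprod ws = wprod (us @ vs)"
      using Cons.IH[of "x \<otimes> r \<otimes> x"] ws x Cons.prems by auto
    have "r \<otimes> wprod (x # ws) = x \<otimes> ((x \<otimes> r \<otimes> x) \<otimes> wprod ws)"
      using x ws Cons.prems by (simp add: m_assoc)
    thus ?thesis using u by (intro exI[of _ "x # us"]) auto
  qed
qed

lemma N_prod:
  assumes "set ws \<subseteq> X" "g \<in> carrier G" "r \<in> carrier G"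
  shows "N (wprod ws \<otimes> g) r \<longleftrightarrow> N (wprod ws) r \<noteq> N g (inv (wprod ws) \<otimes> r \<otimes> wprod ws)"
  using assms
proof (induction ws arbitrary: r)
  case Nil
  then show ?case using N_one by simp
next
  case (Cons x ws)
  hence x: "x \<in> X" and ws: "set ws \<subseteq> X" by auto
  have "inv (wprod (x # ws)) \<otimes> r \<otimes> wprod (x # ws) = inv (wprod ws) \<otimes> (x \<otimes> r \<otimes> x) \<otimes> wprod ws"
    using x ws Cons.prems by (simp add: m_assoc inv_mult_group)
  moreover have "N (wprod (x # ws) \<otimes> g) r \<longleftrightarrow> (r = x) \<noteq> N (wprod ws \<otimes> g) (x \<otimes> r \<otimes> x)"
    using N_mult[OF x, of "wprod ws \<otimes> g" r] x ws Cons.prems by (simp add: m_assoc)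
  moreover have "N (wprod (x # ws)) r \<longleftrightarrow> (r = x) \<noteq> N (wprod ws) (x \<otimes> r \<otimes> x)"
    using N_mult[OF x, of "wprod ws" r] ws Cons.prems by simp
  ultimately show ?case using Cons.IH[of "x \<otimes> r \<otimes> x"] ws x Cons.prems by auto
qed

lemma N_K:
  assumes "h \<in> K" "g \<in> carrier G" "r \<in> carrier G"
  shows "N (h \<otimes> g) r \<longleftrightarrow> N h r \<noteq> N g (inv h \<otimes> r \<otimes> h)"
  using assms N_prod by (elim KE) simp

definition is_reflection :: "'a \<Rightarrow> bool" where
  "is_reflection r \<longleftrightarrow> (\<exists>h\<in>K. \<exists>x\<in>X. r = h \<otimes> x \<otimes> inv h)"

lemma is_reflectionI: "h \<in> K \<Longrightarrow> x \<in> X \<Longrightarrow> is_reflection (h \<otimes> x \<otimes> inv h)"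
  by (auto simp: is_reflection_def)

lemma X_reflection: "x \<in> X \<Longrightarrow> is_reflection x"
  using is_reflectionI[OF K_one, of x] by simp

lemma reflection_K: "is_reflection r \<Longrightarrow> r \<in> K"
  unfolding is_reflection_def using K_mult K_inv X_K by blast

lemma reflection_square: "is_reflection r \<Longrightarrow> r \<otimes> r = \<one>"
  by (auto simp: is_reflection_def m_assoc)

lemma reflection_cancel: "is_reflection r \<Longrightarrow> g \<in> carrier G \<Longrightarrow> r \<otimes> (r \<otimes> g) = g"
  using reflection_square reflection_K by (simp add: m_assoc [symmetric])

text \<open>
  For \<open>r\<close> the conjugate of a letter \<open>x\<close> by \<open>h\<close>, this letter crosses the wall of \<open>r\<close>, and the crossings
  on the way along \<open>h\<close> and back cancel.
\<close>

lemma N_reflection: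
  assumes "is_reflection r" "g \<in> carrier G"
  shows "N (r \<otimes> g) r \<longleftrightarrow> \<not> N g r"
proof -
  obtain h x where hx: "h \<in> K" "x \<in> X" "r = h \<otimes> x \<otimes> inv h"
    using assms by (auto simp: is_reflection_def)
  hence h: "h \<in> carrier G" by simp
  have r: "r \<in> carrier G" "inv h \<otimes> r \<otimes> h = x" using hx by (simp_all add: m_assoc)
  have rg: "r \<otimes> g = h \<otimes> (x \<otimes> (inv h \<otimes> g))" "h \<otimes> (inv h \<otimes> g) = g"
    using hx assms h by (simp_all add: m_assoc)
  have "N (r \<otimes> g) r \<longleftrightarrow> N h r \<noteq> N (x \<otimes> (inv h \<otimes> g)) x"
    unfolding rg(1) using N_K[OF hx(1), of "x \<otimes> (inv h \<otimes> g)" r] r hx h assms by simp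
  moreover have "N (x \<otimes> (inv h \<otimes> g)) x \<longleftrightarrow> \<not> N (inv h \<otimes> g) x"
    using N_mult[OF hx(2), of "inv h \<otimes> g" x] hx h assms X_involution by simp
  moreover have "N g r \<longleftrightarrow> N h r \<noteq> N (inv h \<otimes> g) x"
    using N_K[OF hx(1), of "inv h \<otimes> g" r] rg(2) r hx h assms by simp
  ultimately show ?thesis by blast
qed

lemma N_len_less:
  assumes "is_reflection r" "g \<in> K" "N g r"
  shows "len (r \<otimes> g) < len g"
proof -
  obtain ws where ws: "set ws \<subseteq> X" "wprod ws = g" "length ws = len g" using assms len_word by metis
  then obtain us x vs where "ws = us @ x # vs" "r \<otimes> g = wprod (us @ vs)"
    using exchange[OF ws(1), of r] reflection_K[OF assms(1)] assms(3) by auto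
  thus ?thesis using len_le[of "us @ vs"] ws by auto
qed

text \<open>
  The strong exchange condition.
\<close>

lemma N_len:
  assumes "is_reflection r" "g \<in> K"
  shows "N g r \<longleftrightarrow> len (r \<otimes> g) < len g"
proof
  assume l: "len (r \<otimes> g) < len g"
  show "N g r"
  proof (rule ccontr)
    assume "\<not> N g r"
    hence "N (r \<otimes> g) r" using N_reflection assms by simp
    hence "len (r \<otimes> (r \<otimes> g)) < len (r \<otimes> g)"
      using N_len_less assms K_mult reflection_K by blast
    thus False using l reflection_cancel assms by simp
  qed
qed (use N_len_less assms in blast)

lemma len_step:
  assumes "x \<in> X" "g \<in> K"
  shows "len (x \<otimes> g) = Suc (len g) \<or> Suc (len (x \<otimes> g)) = len g"
proof -
  have xg: "x \<otimes> g \<in> K" using assms K_mult X_K by blast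
  have "len (x \<otimes> g) \<le> Suc (len g)" using len_mult[OF X_K[OF assms(1)] assms(2)] len_X_le[OF assms(1)] by simp
  moreover have "len (x \<otimes> (x \<otimes> g)) \<le> Suc (len (x \<otimes> g))"
    using len_mult[OF X_K[OF assms(1)] xg] len_X_le[OF assms(1)] by simp
  hence "len g \<le> Suc (len (x \<otimes> g))" using assms by simp
  moreover have "len (x \<otimes> g) \<noteq> len g"
    using N_len[OF X_reflection[OF assms(1)]] N_reflection[OF X_reflection[OF assms(1)]] assms xg
    by (metis K_carrier X_cancel less_irrefl)
  ultimately show ?thesis by linarith
qed

definition shortest :: "'a \<Rightarrow> 'a \<Rightarrow> 'a list \<Rightarrow> bool" where
  "shortest s t ws \<longleftrightarrow> set ws \<subseteq> {s, t} \<and>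
     (\<forall>us. set us \<subseteq> {s, t} \<longrightarrow> wprod us = wprod ws \<longrightarrow> length ws \<le> length us)"

lemma shortest_exists:
  assumes "set ws \<subseteq> {s, t}"
  obtains us where "shortest s t us" "wprod us = wprod ws"
proof -
  let ?P = "\<lambda>us. set us \<subseteq> {s, t} \<and> wprod us = wprod ws"
  have "?P ws" using assms by simp
  hence "?P (arg_min length ?P) \<and> (\<forall>us. ?P us \<longrightarrow> length (arg_min length ?P) \<le> length us)"
    by (rule arg_min_nat_lemma)
  thus thesis by (intro that[of "arg_min length ?P"]) (simp_all add: shortest_def)
qed

lemma shortest_tl: "shortest s t (x # ws) \<Longrightarrow> shortest s t ws"
  unfolding shortest_def
proof (intro conjI allI impI)
  fix us assume a: "set (x # ws) \<subseteq> {s, t} \<and>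
       (\<forall>us. set us \<subseteq> {s, t} \<longrightarrow> wprod us = wprod (x # ws) \<longrightarrow> length (x # ws) \<le> length us)"
    and us: "set us \<subseteq> {s, t}" "wprod us = wprod ws"
  have "length (x # ws) \<le> length (x # us)" using a us by (metis insert_subset list.set(2) wprod.simps(2))
  thus "length ws \<le> length us" by simp
qed auto

lemma shortest_swap: "shortest s t ws \<longleftrightarrow> shortest t s ws"
  by (simp add: shortest_def insert_commute)

lemma shortest_alternates:
  assumes "s \<in> X" "t \<in> X" "shortest s t (x # ws)" "{x, y} = {s, t}"
  shows "x # ws = alt_word x y (Suc (length ws))"
  using assms(3,4)
proof (induction ws arbitrary: x y)
  case Nil
  then show ?case by simp
next
  case (Cons z ws)
  have z: "z \<in> {s, t}" "x \<in> {s, t}" "set ws \<subseteq> {s, t}" using Cons.prems by (auto simp: shortest_def)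
  have "z \<noteq> x"
  proof
    assume "z = x"
    moreover have "set ws \<subseteq> X" using z assms by auto
    ultimately have "wprod ws = wprod (x # z # ws)" using z assms by auto
    hence "length (x # z # ws) \<le> length ws" using Cons.prems(1) z unfolding shortest_def by blast
    thus False by simp
  qed
  hence zy: "z = y" using z Cons.prems by auto
  have "shortest s t (z # ws)" using Cons.prems shortest_tl by blast
  moreover have "{z, x} = {s, t}" using Cons.prems zy by auto
  ultimately show ?case using Cons.IH[of z x] zy by simp
qed

definition coset_minimal :: "'a \<Rightarrow> 'a \<Rightarrow> 'a \<Rightarrow> bool" where
  "coset_minimal s t w \<longleftrightarrow> w \<in> K \<and> (\<forall>us. set us \<subseteq> {s, t} \<longrightarrow> len w \<le> len (wprod us \<otimes> w))"

text \<open>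
  A wall of the dihedral group does not separate 1 from the minimal element \<open>w\<close> of the coset, so the
  walls crossed by the dihedral word and those crossed by \<open>w\<close> do not interfere.
\<close>

lemma gate_len:
  assumes st: "s \<in> X" "t \<in> X" and w: "coset_minimal s t w" and us: "shortest s t us"
  shows "len (wprod us \<otimes> w) = length us + len w"
  using us
proof (induction us)
  case Nil
  then show ?case using w by (simp add: coset_minimal_def)
next
  case (Cons x vs)
  have wK: "w \<in> K" using w by (simp add: coset_minimal_def)
  have vs: "shortest s t vs" using Cons.prems shortest_tl by blast
  have sub: "set vs \<subseteq> {s, t}" "x \<in> {s, t}" using Cons.prems by (auto simp: shortest_def)
  have x: "x \<in> X" and vX: "set vs \<subseteq> X" using sub st by auto
  let ?v = "wprod vs"
  have v: "?v \<in> K" using KI vX by simp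
  have IH: "len (?v \<otimes> w) = length vs + len w" using Cons.IH vs by simp
  have "\<not> N ?v x"
  proof
    assume "N ?v x"
    then obtain us y ws where u: "vs = us @ y # ws" "x \<otimes> ?v = wprod (us @ ws)"
      using exchange[OF vX, of x] x by auto
    have "length (x # vs) \<le> length (us @ ws)"
      using Cons.prems u sub unfolding shortest_def by (metis Un_subset_iff insert_subset list.set(2) set_append wprod.simps(2))
    thus False using u by simp
  qed
  moreover have "\<not> N w (inv ?v \<otimes> x \<otimes> ?v)"
  proof
    assume n: "N w (inv ?v \<otimes> x \<otimes> ?v)"
    have r: "is_reflection (inv ?v \<otimes> x \<otimes> ?v)" using is_reflectionI[OF K_inv[OF v] x] v by simp
    have "inv ?v \<otimes> x \<otimes> ?v = wprod (rev vs @ x # vs)"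
      using vX x by (simp add: wprod_append wprod_rev m_assoc)
    moreover have "set (rev vs @ x # vs) \<subseteq> {s, t}" using sub by auto
    ultimately have "len w \<le> len ((inv ?v \<otimes> x \<otimes> ?v) \<otimes> w)"
      using w unfolding coset_minimal_def by metis
    thus False using N_len_less[OF r wK n] by simp
  qed
  ultimately have "\<not> N (?v \<otimes> w) x" using N_K[OF v, of w x] wK x by simp
  moreover have vw: "?v \<otimes> w \<in> K" using v wK K_mult by blast
  ultimately have "\<not> len (x \<otimes> (?v \<otimes> w)) < len (?v \<otimes> w)" using N_len X_reflection x by blast
  hence "len (x \<otimes> (?v \<otimes> w)) = Suc (len (?v \<otimes> w))" using len_step[OF x vw] by auto
  thus ?case using IH x v wK by (simp add: m_assoc)
qed

lemma alt_strip:
  assumes "s \<in> X" "t \<in> X" "w \<in> carrier G" "j \<le> n"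
  shows "alt (\<otimes>) s t j (wprod (alt_word s t n) \<otimes> w) =
    wprod (if even j then alt_word s t (n - j) else alt_word t s (n - j)) \<otimes> w"
  using assms
proof (induction j arbitrary: s t n)
  case (Suc j)
  then obtain n' where n: "n = Suc n'" by (cases n) auto
  have "set (alt_word t s n') \<subseteq> X" using set_alt_word Suc.prems by fastforce
  hence "s \<otimes> (wprod (alt_word s t n) \<otimes> w) = wprod (alt_word t s n') \<otimes> w"
    using Suc.prems n by (simp add: m_assoc)
  thus ?case using Suc.IH[of t s n'] Suc.prems n by simp
qed simp

lemma alt_act: "s \<in> X \<Longrightarrow> t \<in> X \<Longrightarrow> v \<in> carrier G \<Longrightarrow>
    alt (\<otimes>) s t j v = wprod (rev (alt_word s t j)) \<otimes> v"
proof (induction j arbitrary: s t v)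
  case (Suc j)
  have "set (rev (alt_word t s j)) \<subseteq> X" using set_alt_word[of t s j] Suc.prems by auto
  thus ?case using Suc by (simp add: wprod_append m_assoc)
qed simp

lemma alt_carrier: "s \<in> X \<Longrightarrow> t \<in> X \<Longrightarrow> v \<in> carrier G \<Longrightarrow> alt (\<otimes>) s t j v \<in> carrier G"
  by (induction j arbitrary: s t v) auto

lemma shortest_alt_len:
  assumes st: "s \<in> X" "t \<in> X" and w: "coset_minimal s t w"
    and sh: "shortest s t (alt_word s t n)" and j: "j \<le> n"
  shows "len (alt (\<otimes>) s t j (wprod (alt_word s t n) \<otimes> w)) + j = n + len w"
proof -
  let ?us = "if even j then alt_word s t (n - j) else alt_word t s (n - j)"
  have wK: "w \<in> carrier G" using w by (simp add: coset_minimal_def)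
  have "alt_word s t n = alt_word s t j @ ?us" using alt_word_append[of s t j "n - j"] j by simp
  hence "shortest s t (alt_word s t j @ ?us)" using sh by simp
  moreover have "shortest s t (us @ vs) \<Longrightarrow> shortest s t vs" for us vs
    by (induction us) (auto dest: shortest_tl)
  ultimately have "shortest s t ?us" by blast
  from gate_len[OF st w this] show ?thesis using alt_strip[OF st wK j] j by simp
qed

definition braid_length :: "'a \<Rightarrow> 'a \<Rightarrow> nat" where
  "braid_length s t = (LEAST n. 1 \<le> n \<and> wprod (alt_word s t n) = wprod (alt_word t s n))"

text \<open>
  A longer alternating word can be shortened by the braid relation. So for each pair there is only
  one possible length, and a finite generating set has bounded polygons.
\<close>

lemma shortest_le_braid:
  assumes st: "s \<in> X" "t \<in> X" and sh: "shortest s t (alt_word s t n)"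
    and b: "1 \<le> b" "wprod (alt_word s t b) = wprod (alt_word t s b)"
  shows "n \<le> b"
proof (rule ccontr)
  assume "\<not> n \<le> b"
  then obtain c where c: "n = Suc b + c" using less_eqE by (metis not_less_eq_eq)
  obtain b' where b': "b = Suc b'" using b by (cases b) auto
  define rest where "rest = (if even (Suc b) then alt_word s t c else alt_word t s c)"
  have X: "set (alt_word s t i) \<subseteq> X" "set (alt_word t s i) \<subseteq> X" "set rest \<subseteq> X" for i
    using set_alt_word[of s t i] set_alt_word[of t s i] set_alt_word[of s t c] set_alt_word[of t s c] st
    unfolding rest_def by auto
  have "alt_word s t n = s # alt_word t s b @ rest"
    using alt_word_append[of s t "Suc b" c] c rest_def by simp
  hence "wprod (alt_word s t n) = s \<otimes> (wprod (alt_word s t b) \<otimes> wprod rest)"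
    using X b(2) by (simp add: wprod_append)
  also have "\<dots> = wprod (alt_word t s b' @ rest)"
    using X st b' by (simp add: wprod_append m_assoc)
  finally have "wprod (alt_word t s b' @ rest) = wprod (alt_word s t n)" by simp
  moreover have "set (alt_word t s b' @ rest) \<subseteq> {s, t}"
    using set_alt_word[of t s b'] set_alt_word[of s t c] set_alt_word[of t s c] by (auto simp: rest_def)
  ultimately have "length (alt_word s t n) \<le> length (alt_word t s b' @ rest)"
    using sh unfolding shortest_def by blast
  moreover have "length rest = c" by (simp add: rest_def)
  ultimately show False using c b' by simp
qed

definition max_braid :: nat where
  "max_braid = Max ((\<lambda>(s, t). braid_length s t) ` (X \<times> X) \<union> {0})"

text \<open>
  Write \<open>w\<close> as a dihedral element times the minimal element of the coset. Both \<open>s\<close> and \<open>t\<close> shorten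
  the dihedral part, so it has alternating expressions starting with \<open>s\<close> and with \<open>t\<close>. Equality of the
  two is a relation of the dihedral group and cannot have length 1, 2 or 3.
\<close>

lemma two_left_descents:
  assumes w: "w \<in> K" and st: "s \<in> X" "t \<in> X" "s \<noteq> t"
    and desc: "Suc (len (s \<otimes> w)) = len w" "Suc (len (t \<otimes> w)) = len w"
  shows "\<exists>n. 4 \<le> n \<and> n \<le> max_braid \<and>
    (\<forall>j\<le>n. len (alt (\<otimes>) s t j w) + j = len w \<and> len (alt (\<otimes>) t s j w) + j = len w) \<and>
    (\<forall>v\<in>K. alt (\<otimes>) s t n v = alt (\<otimes>) t s n v)"
proof -
  let ?P = "\<lambda>us. set us \<subseteq> {s, t}"
  define u0 where "u0 = arg_min (\<lambda>us. len (wprod us \<otimes> w)) ?P"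
  have u0: "?P u0 \<and> (\<forall>us. ?P us \<longrightarrow> len (wprod u0 \<otimes> w) \<le> len (wprod us \<otimes> w))"
    unfolding u0_def by (rule arg_min_nat_lemma[of ?P "[]"]) simp
  define w' where "w' = wprod u0 \<otimes> w"
  have u0X: "set u0 \<subseteq> X" using u0 st by auto
  have w'K: "w' \<in> K" unfolding w'_def using K_mult KI u0X w by blast
  have cm: "coset_minimal s t w'"
    unfolding coset_minimal_def
  proof (intro conjI allI impI w'K)
    fix us assume us: "set us \<subseteq> {s, t}"
    have usX: "set us \<subseteq> X" using us st by auto
    have "wprod us \<otimes> w' = wprod (us @ u0) \<otimes> w"
      unfolding w'_def using usX u0X w by (simp add: wprod_append m_assoc)
    moreover have "?P (us @ u0)" using us u0 by simp
    ultimately show "len w' \<le> len (wprod us \<otimes> w')" using u0 unfolding w'_def by metis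
  qed
  have cm': "coset_minimal t s w'" using cm by (simp add: coset_minimal_def insert_commute)
  have ww: "w = wprod (rev u0) \<otimes> w'"
    unfolding w'_def using u0X w by (simp add: wprod_rev)
  obtain us where us: "shortest s t us" "wprod us = wprod (rev u0)"
    using shortest_exists[of "rev u0" s t] u0 by auto
  have usX: "set us \<subseteq> X" and us_st: "set us \<subseteq> {s, t}" using us st by (auto simp: shortest_def)
  have lw: "len w = length us + len w'" using gate_len[OF st(1,2) cm us(1)] us ww by simp
  (* a descent of w shortens the dihedral part *)
  have first: "\<exists>vs. shortest s t (x # vs) \<and> wprod (x # vs) = wprod us \<and> Suc (length vs) = length us"
    if x: "x \<in> {s, t}" "Suc (len (x \<otimes> w)) = len w" for x
  proof -
    have xX: "x \<in> X" using x st by auto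
    obtain vs where vs: "shortest s t vs" "wprod vs = wprod (x # us)"
      using shortest_exists[of "x # us" s t] us_st x by auto
    have vsX: "set vs \<subseteq> X" and vs_st: "set vs \<subseteq> {s, t}" using vs st by (auto simp: shortest_def)
    have "x \<otimes> w = wprod vs \<otimes> w'" using ww us vs xX usX w'K u0X by (simp add: m_assoc)
    hence "len (x \<otimes> w) = length vs + len w'" using gate_len[OF st(1,2) cm vs(1)] by simp
    hence l: "Suc (length vs) = length us" using x lw by simp
    have p: "wprod (x # vs) = wprod us" using vs xX usX by simp
    have "shortest s t (x # vs)"
      using us(1) p l x vs_st unfolding shortest_def by auto
    thus ?thesis using p l by blast
  qed
  obtain vs where vs: "shortest s t (s # vs)" "wprod (s # vs) = wprod us" "Suc (length vs) = length us"
    using first[of s] desc by blast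
  obtain vt where vt: "shortest s t (t # vt)" "wprod (t # vt) = wprod us" "Suc (length vt) = length us"
    using first[of t] desc by blast
  let ?n = "length us"
  have as: "s # vs = alt_word s t ?n" using shortest_alternates[OF st(1,2) vs(1), of t] vs(3) by simp
  have at: "t # vt = alt_word t s ?n" using shortest_alternates[OF st(1,2) vt(1), of s] vt(3) by auto
  have n1: "1 \<le> ?n" using vs(3) by simp
  have sh: "shortest s t (alt_word s t ?n)" "shortest t s (alt_word t s ?n)"
    using vs(1) vt(1) as at shortest_swap by auto
  have wst: "w = wprod (alt_word s t ?n) \<otimes> w'" "w = wprod (alt_word t s ?n) \<otimes> w'"
    using ww us(2) vs(2) vt(2) as at by metis+
  have eq: "wprod (alt_word s t ?n) = wprod (alt_word t s ?n)" using vs(2) vt(2) as at by simp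
  have lens: "len (alt (\<otimes>) s t j w) + j = len w \<and> len (alt (\<otimes>) t s j w) + j = len w" if "j \<le> ?n" for j
    using shortest_alt_len[OF st(1,2) cm sh(1) that] shortest_alt_len[OF st(2,1) cm' sh(2) that] lw wst by simp
  have four: "4 \<le> ?n"
  proof (rule ccontr)
    assume "\<not> 4 \<le> ?n"
    then consider "?n = 1" | "?n = 2" | "?n = 3" using n1 by linarith
    thus False
    proof cases
      case 1
      then show False using eq st by simp
    next
      case 2
      then show False using eq st no_commute[OF st] by (simp add: numeral_2_eq_2)
    next
      case 3
      then show False using eq st no_braid[OF st] by (simp add: numeral_3_eq_3)
    qed
  qed
  have "1 \<le> braid_length s t \<and> wprod (alt_word s t (braid_length s t)) = wprod (alt_word t s (braid_length s t))"
    unfolding braid_length_def by (rule LeastI[of _ ?n]) (use n1 eq in simp)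
  hence "?n \<le> braid_length s t" using shortest_le_braid[OF st(1,2) sh(1)] by blast
  also have "braid_length s t \<le> max_braid"
    unfolding max_braid_def by (rule Max_ge) (use finite_X st in auto)
  finally have bound: "?n \<le> max_braid" .
  have rX: "set (rev (alt_word s t ?n)) \<subseteq> X" "set (rev (alt_word t s ?n)) \<subseteq> X"
    using set_alt_word[of s t ?n] set_alt_word[of t s ?n] st by auto
  have "alt (\<otimes>) s t ?n w = alt (\<otimes>) t s ?n w"
    using alt_strip[OF st(1,2), of w' ?n ?n] alt_strip[OF st(2,1), of w' ?n ?n] wst w'K by simp
  hence "wprod (rev (alt_word s t ?n)) = wprod (rev (alt_word t s ?n))"
    using alt_act[OF st(1,2), of w ?n] alt_act[OF st(2,1), of w ?n] w rX by simp
  hence "\<forall>v\<in>K. alt (\<otimes>) s t ?n v = alt (\<otimes>) t s ?n v"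
    using alt_act[OF st(1,2)] alt_act[OF st(2,1)] by simp
  thus ?thesis using four bound lens by blast
qed

lemma chamber_graph: "chamber_graph K X (\<otimes>) (\<lambda>x y. len (x \<otimes> inv y)) \<one> max_braid"
proof unfold_locales
  show "s \<otimes> v \<in> K" if "s \<in> X" "v \<in> K" for s v using that K_mult X_K by blast
  show "s \<otimes> (s \<otimes> v) = v" if "s \<in> X" "v \<in> K" for s v using that by simp
  show "\<one> \<in> K" by (rule K_one)
  show "len (x \<otimes> inv y) = 0 \<longleftrightarrow> x = y" if "x \<in> K" "y \<in> K" for x y
    using that len_zero[OF K_mult[OF that(1) K_inv[OF that(2)]]]
    by (metis K_carrier inv_equality inv_inv r_inv inv_closed)
  show "len (x \<otimes> inv y) = len (y \<otimes> inv x)" if "x \<in> K" "y \<in> K" for x y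
    using that len_inv[OF K_mult[OF that(1) K_inv[OF that(2)]]] by (simp add: inv_mult_group)
  show "len (x \<otimes> inv z) \<le> len (x \<otimes> inv y) + len (y \<otimes> inv z)" if "x \<in> K" "y \<in> K" "z \<in> K" for x y z
  proof -
    have "x \<otimes> inv z = (x \<otimes> inv y) \<otimes> (y \<otimes> inv z)"
      using that by (simp add: m_assoc)
    thus ?thesis using len_mult that K_mult K_inv by metis
  qed
  have step: "(s \<otimes> x) \<otimes> inv y = s \<otimes> (x \<otimes> inv y)" if "s \<in> X" "x \<in> K" "y \<in> K" for s x y
    using that by (simp add: m_assoc)
  show "len (s \<otimes> x \<otimes> inv y) = Suc (len (x \<otimes> inv y)) \<or> Suc (len (s \<otimes> x \<otimes> inv y)) = len (x \<otimes> inv y)"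
    if "s \<in> X" "x \<in> K" "y \<in> K" for s x y
    using len_step[OF that(1) K_mult[OF that(2) K_inv[OF that(3)]]] step[OF that] by simp
  show "\<exists>s\<in>X. Suc (len (s \<otimes> x \<otimes> inv y)) = len (x \<otimes> inv y)" if "x \<in> K" "y \<in> K" "x \<noteq> y" for x y
  proof -
    let ?g = "x \<otimes> inv y"
    have g: "?g \<in> K" using that K_mult K_inv by blast
    obtain ws where ws: "set ws \<subseteq> X" "wprod ws = ?g" "length ws = len ?g" using g len_word by metis
    have "?g \<noteq> \<one>" using that by (metis K_carrier inv_equality inv_inv inv_closed)
    then obtain s us where s: "ws = s # us" using ws by (cases ws) auto
    have sX: "s \<in> X" "set us \<subseteq> X" using s ws by auto
    have "s \<otimes> ?g = wprod us" using ws(2) s sX by (metis X_cancel wprod.simps(2) wprod_closed)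
    hence "len (s \<otimes> ?g) \<le> length us" using len_le sX by metis
    hence "Suc (len (s \<otimes> ?g)) = len ?g" using len_step[OF sX(1) g] ws(3) s by auto
    thus ?thesis using step sX that by metis
  qed
  show "\<exists>m\<ge>4. m \<le> max_braid \<and>
      (\<forall>j\<le>m. len (alt (\<otimes>) s t j w \<otimes> inv \<one>) + j = len (w \<otimes> inv \<one>) \<and>
        len (alt (\<otimes>) t s j w \<otimes> inv \<one>) + j = len (w \<otimes> inv \<one>)) \<and>
      (\<forall>v\<in>K. alt (\<otimes>) s t m v = alt (\<otimes>) t s m v)"
    if "w \<in> K" "s \<in> X" "t \<in> X" "s \<noteq> t" "Suc (len (s \<otimes> w \<otimes> inv \<one>)) = len (w \<otimes> inv \<one>)"
      "Suc (len (t \<otimes> w \<otimes> inv \<one>)) = len (w \<otimes> inv \<one>)" for w s t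
  proof -
    have "alt (\<otimes>) s t j w \<in> carrier G" "alt (\<otimes>) t s j w \<in> carrier G" for j
      using alt_carrier that by auto
    thus ?thesis using two_left_descents[OF that(1-4)] that by simp
  qed
qed

lemma gromov_inequality_len:
  assumes "x \<in> K" "y \<in> K" "z \<in> K"
  shows "(real (len x) + len z - len (inv x \<otimes> z)) / 2 \<ge>
    min ((real (len x) + len y - len (inv x \<otimes> y)) / 2) ((real (len y) + len z - len (inv y \<otimes> z)) / 2) - 4 * max_braid"
  using chamber_graph.gromov_inequality[OF chamber_graph, of "inv x" "inv y" "inv z"] assms K_inv len_inv by simp

end

section \<open>The Coxeter group of a matrix with even labels\<close>

text \<open>
  Words are taken over the natural numbers, and \<open>[i, i]\<close> is a relator, so formal inverses do not
  occur; they are reintroduced in the comparison with the presentation.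
\<close>

locale even_coxeter_matrix =
  fixes I :: "nat set" and m :: "nat \<Rightarrow> nat \<Rightarrow> nat"
  assumes finite_I: "finite I"
    and m_sym: "i \<in> I \<Longrightarrow> j \<in> I \<Longrightarrow> m i j = m j i"
    and m_even: "i \<in> I \<Longrightarrow> j \<in> I \<Longrightarrow> i \<noteq> j \<Longrightarrow> even (m i j)"
    and m_pos: "i \<in> I \<Longrightarrow> j \<in> I \<Longrightarrow> i \<noteq> j \<Longrightarrow> 2 \<le> m i j"
begin

inductive ins :: "nat list \<Rightarrow> nat list \<Rightarrow> bool" where
  ins_square: "i \<in> I \<Longrightarrow> ins (u @ v) (u @ [i, i] @ v)"
| ins_braid: "i \<in> I \<Longrightarrow> j \<in> I \<Longrightarrow> i \<noteq> j \<Longrightarrow>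
    ins (u @ v) (u @ concat (replicate (m i j) [i, j]) @ v)"

abbreviation eqv :: "nat list \<Rightarrow> nat list \<Rightarrow> bool" where "eqv \<equiv> equivclp ins"

lemma eqv_refl [simp]: "eqv u u" by (rule equivclp_refl)
lemma eqv_sym: "eqv u v \<Longrightarrow> eqv v u" by (rule equivclp_sym)
lemma eqv_trans: "eqv u v \<Longrightarrow> eqv v w \<Longrightarrow> eqv u w" by (rule equivclp_trans)

lemma eqv_ins: "ins u v \<Longrightarrow> eqv u v" by (rule r_into_equivclp)

lemma ins_context: assumes "ins u v" shows "ins (p @ u @ q) (p @ v @ q)"
  using assms
proof cases
  case (ins_square i u' v')
  then show ?thesis using ins.ins_square[of i "p @ u'" "v' @ q"] by simp
next
  case (ins_braid i j u' v')
  then show ?thesis using ins.ins_braid[of i j "p @ u'" "v' @ q"] by simp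
qed

lemma eqv_context: assumes "eqv u v" shows "eqv (p @ u @ q) (p @ v @ q)"
  using assms
proof (induction rule: equivclp_induct)
  case (step y z)
  have "eqv (p @ y @ q) (p @ z @ q)"
    using step(2) ins_context[of y z p q] ins_context[of z y p q] eqv_ins eqv_sym by blast
  thus ?case using step eqv_trans by blast
qed simp

lemma eqv_append: assumes "eqv u u'" "eqv v v'" shows "eqv (u @ v) (u' @ v')"
proof -
  have "eqv (u @ v) (u' @ v)" using eqv_context[OF assms(1), of "[]" v] by simp
  also have "eqv (u' @ v) (u' @ v')" using eqv_context[OF assms(2), of u' "[]"] by simp
  finally (equivclp_trans) show ?thesis .
qed

lemma eqv_square: "i \<in> I \<Longrightarrow> eqv [i, i] []"
  using eqv_sym[OF eqv_ins[OF ins_square[of i "[]" "[]"]]] by simp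

lemma eqv_rev: "u \<in> lists I \<Longrightarrow> eqv (u @ rev u) []"
proof (induction u)
  case (Cons i u)
  have "eqv ([i] @ (u @ rev u) @ [i]) ([i] @ [] @ [i])"
    using Cons by (intro eqv_context) auto
  thus ?case using Cons eqv_square[of i] eqv_trans by fastforce
qed simp

text \<open>
  Permutations satisfying the relations, that is, an action of the Coxeter group from the right: the
  letters of a word act from left to right, as in \<open>fold\<close>.
\<close>

definition action :: "(nat \<Rightarrow> 'b \<Rightarrow> 'b) \<Rightarrow> bool" where
  "action f \<longleftrightarrow> (\<forall>i\<in>I. f i \<circ> f i = id) \<and> (\<forall>i\<in>I. \<forall>j\<in>I. i \<noteq> j \<longrightarrow> (f j \<circ> f i) ^^ m i j = id)"

lemma fold_concat_replicate: "fold f (concat (replicate n [i, j])) = (f j \<circ> f i) ^^ n"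
  by (induction n) (simp_all add: funpow_Suc_right fun_eq_iff del: funpow.simps(2))

text \<open>
  The way to show that two elements of the group differ: let them act on something concrete.
\<close>

lemma action_eqv: assumes f: "action f" and "eqv u v" shows "fold f u = fold f v"
proof -
  have ins: "fold f u = fold f v" if "ins u v" for u v
    using that
  proof cases
    case (ins_square i u' v')
    hence "f i \<circ> f i = id" using f by (auto simp: action_def)
    thus ?thesis using ins_square by (simp add: fun_eq_iff)
  next
    case (ins_braid i j u' v')
    hence "fold f (concat (replicate (m i j) [i, j])) = id"
      using f by (auto simp: action_def fold_concat_replicate)
    thus ?thesis using ins_braid by (simp add: fun_eq_iff)
  qed
  from assms(2) show ?thesis
    by (induction rule: equivclp_induct) (use ins in auto)
qed

lemma funpow_even: fixes f :: "'b \<Rightarrow> 'b" assumes "f \<circ> f = id" "even n" shows "f ^^ n = id"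
proof -
  obtain k where n: "n = 2 * k" using assms(2) by (rule evenE)
  have "f ^^ n = (f ^^ 2) ^^ k" by (simp only: n funpow_mult)
  also have "f ^^ 2 = id" using assms(1) by (simp add: numeral_2_eq_2)
  finally have "f ^^ n = (id :: 'b \<Rightarrow> 'b) ^^ k" .
  also have "(id :: 'b \<Rightarrow> 'b) ^^ k = id" by (induction k) simp_all
  finally show ?thesis .
qed

text \<open>
  Because the labels are even, one generator may act by any involution while the others act
  trivially. Negation of truth values gives the parity homomorphism of the generator.
\<close>

lemma action_single:
  assumes "h \<circ> h = id"
  shows "action (\<lambda>k. if k = i then h else id)"
  unfolding action_def
proof (intro conjI ballI impI)
  fix k l assume "k \<in> I" "l \<in> I" "k \<noteq> l"
  thus "((if l = i then h else id) \<circ> (if k = i then h else id)) ^^ m k l = id"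
    using funpow_even[OF assms m_even] by auto
qed (use assms in auto)

text \<open>
  For the same reason the group retracts onto each of its dihedral special subgroups.
\<close>

lemma action_pair:
  assumes "h \<circ> h = id" "h' \<circ> h' = id" "i \<in> I" "j \<in> I" "i \<noteq> j"
    "(h' \<circ> h) ^^ m i j = id" "(h \<circ> h') ^^ m i j = id"
  shows "action (\<lambda>k. if k = i then h else if k = j then h' else id)"
  unfolding action_def
proof (intro conjI ballI impI)
  fix k l assume kl: "k \<in> I" "l \<in> I" "k \<noteq> l"
  show "((if l = i then h else if l = j then h' else id) \<circ> (if k = i then h else if k = j then h' else id)) ^^ m k l = id"
    using funpow_even[OF assms(1) m_even[OF kl]] funpow_even[OF assms(2) m_even[OF kl]] kl assms m_sym[of i j]
    by auto
qed (use assms in auto)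

definition cls :: "nat list \<Rightarrow> nat list set" where "cls u = {v. eqv u v}"

lemma cls_eq: "cls u = cls v \<longleftrightarrow> eqv u v"
proof
  assume "cls u = cls v"
  moreover have "v \<in> cls v" by (simp add: cls_def)
  ultimately have "v \<in> cls u" by blast
  thus "eqv u v" by (simp add: cls_def)
next
  assume e: "eqv u v"
  show "cls u = cls v"
    unfolding cls_def using eqv_trans[OF e] eqv_trans[OF eqv_sym[OF e]] by blast
qed

definition W :: "nat list set monoid" where
  "W = \<lparr>carrier = cls ` lists I, monoid.mult = (\<lambda>P Q. \<Union>u\<in>P. \<Union>v\<in>Q. cls (u @ v)), monoid.one = cls []\<rparr>"

lemma W_carrier: "carrier W = cls ` lists I" by (simp add: W_def)
lemma W_one: "\<one>\<^bsub>W\<^esub> = cls []" by (simp add: W_def)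

lemma cls_closed [simp]: "u \<in> lists I \<Longrightarrow> cls u \<in> carrier W" by (auto simp: W_carrier)

abbreviation W_times :: "nat list set \<Rightarrow> nat list set \<Rightarrow> nat list set" (infixl "\<star>" 70) where
  "g \<star> h \<equiv> g \<otimes>\<^bsub>W\<^esub> h"

lemma W_mult: "cls u \<star> cls v = cls (u @ v)"
proof -
  have "cls (u' @ v') = cls (u @ v)" if "u' \<in> cls u" "v' \<in> cls v" for u' v'
    using that eqv_sym[OF eqv_append[of u u' v v']] unfolding cls_eq by (simp add: cls_def)
  moreover have "u \<in> cls u" "v \<in> cls v" by (simp_all add: cls_def)
  ultimately have "(\<Union>u'\<in>cls u. \<Union>v'\<in>cls v. cls (u' @ v')) = cls (u @ v)" by blast
  thus ?thesis by (simp add: W_def)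
qed

lemma group_W: "group W"
proof (rule groupI)
  fix x assume "x \<in> carrier W"
  then obtain u where u: "u \<in> lists I" "x = cls u" by (auto simp: W_carrier)
  have "cls (rev u) \<star> x = \<one>\<^bsub>W\<^esub>"
    using eqv_rev[of "rev u"] u by (simp add: W_mult W_one cls_eq in_lists_conv_set)
  moreover have "cls (rev u) \<in> carrier W" using u by (simp add: in_lists_conv_set)
  ultimately show "\<exists>y\<in>carrier W. y \<star> x = \<one>\<^bsub>W\<^esub>" by blast
next
  fix x y assume "x \<in> carrier W" "y \<in> carrier W"
  then obtain u v where "u \<in> lists I" "x = cls u" "v \<in> lists I" "y = cls v" by (auto simp: W_carrier)
  thus "x \<star> y \<in> carrier W" using cls_closed[of "u @ v"] by (simp add: W_mult)
qed (auto simp: W_carrier W_mult W_one)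

sublocale W: group W by (rule group_W)

lemma inv_cls: "u \<in> lists I \<Longrightarrow> inv\<^bsub>W\<^esub> (cls u) = cls (rev u)"
  using eqv_rev[of "rev u"] by (intro W.inv_equality) (simp_all add: W_mult W_one cls_eq in_lists_conv_set)

definition gen :: "nat \<Rightarrow> nat list set" where "gen i = cls [i]"

lemma gen_closed [simp]: "i \<in> I \<Longrightarrow> gen i \<in> carrier W" by (simp add: gen_def)

lemma cls_Cons: "cls (i # u) = gen i \<star> cls u" by (simp add: gen_def W_mult)

lemma gen_square: "i \<in> I \<Longrightarrow> gen i \<star> gen i = \<one>\<^bsub>W\<^esub>"
  using eqv_square by (simp add: gen_def W_mult W_one cls_eq)

lemma inv_gen: "i \<in> I \<Longrightarrow> inv\<^bsub>W\<^esub> (gen i) = gen i"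
  using gen_square by (simp add: W.inv_equality)

lemma eqv_parity: "eqv u v \<Longrightarrow> even (count_list u i) \<longleftrightarrow> even (count_list v i)"
proof -
  assume e: "eqv u v"
  have fold: "fold (\<lambda>k. if k = i then Not else id) u b = (even (count_list u i) = b)" for u b
    by (induction u arbitrary: b) auto
  have "fold (\<lambda>k. if k = i then Not else id) u = fold (\<lambda>k. if k = i then Not else id) v"
    by (rule action_eqv[OF action_single e]) auto
  thus ?thesis using fold by metis
qed

lemma gen_inj: "gen i = gen j \<Longrightarrow> i = j"
  using eqv_parity[of "[i]" "[j]" i] by (auto simp: gen_def cls_eq split: if_splits)

definition S :: "nat list set set" where "S = gen ` I"
definition idx :: "nat list set \<Rightarrow> nat" where "idx s = (THE i. s = gen i)"

lemma idx_gen [simp]: "idx (gen i) = i"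
  unfolding idx_def using gen_inj by (intro the_equality) auto

definition coxeter_label :: "nat list set \<Rightarrow> nat list set \<Rightarrow> enat" where "coxeter_label s t = enat (m (idx s) (idx t))"

lemma concat_replicate_map: "map f (concat (replicate n [x, y])) = concat (replicate n [f x, f y])"
  by (induction n) auto

abbreviation grp_ins where "grp_ins \<equiv> insertion S (coxeter_relators S coxeter_label)"

lemma grp_eqv_ins: "grp_ins x y \<Longrightarrow> equivclp grp_ins x y" by (rule r_into_equivclp)

lemma grp_ins_context: assumes "grp_ins x y" shows "grp_ins (p @ x @ q) (p @ y @ q)"
  using assms
proof cases
  case (cancelling_pair s u v b)
  then show ?thesis using insertion.cancelling_pair[of s S _ "p @ u" "v @ q" b] by simp
next
  case (relator r u v)
  then show ?thesis using insertion.relator[of r _ S "p @ u" "v @ q"] by simp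
qed

lemma grp_eqv_context:
  assumes "equivclp grp_ins x y" shows "equivclp grp_ins (p @ x @ q) (p @ y @ q)"
  using assms
proof (induction rule: equivclp_induct)
  case (step y z)
  have "equivclp grp_ins (p @ y @ q) (p @ z @ q)"
    using step(2) grp_ins_context[of y z p q] grp_ins_context[of z y p q] grp_eqv_ins equivclp_sym by metis
  thus ?case using step equivclp_trans by metis
qed simp

definition lift :: "nat list \<Rightarrow> (nat list set \<times> bool) list" where "lift u = map (\<lambda>i. (gen i, True)) u"

lemma ins_lift: assumes "ins u v" shows "grp_ins (lift u) (lift v)"
  using assms
proof cases
  case (ins_square i u' v')
  have "[(gen i, True), (gen i, True)] \<in> coxeter_relators S coxeter_label"
    using ins_square by (auto simp: coxeter_relators_def S_def)
  from insertion.relator[OF this, of S "lift u'" "lift v'"] show ?thesis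
    using ins_square by (simp add: lift_def)
next
  case (ins_braid i j u' v')
  have "concat (replicate (m i j) [(gen i, True), (gen j, True)]) \<in> coxeter_relators S coxeter_label"
    unfolding coxeter_relators_def using ins_braid gen_inj
    by (intro UnI2 CollectI exI[of _ "gen i"] exI[of _ "gen j"] exI[of _ "m i j"]) (auto simp: S_def coxeter_label_def)
  from insertion.relator[OF this, of S "lift u'" "lift v'"] show ?thesis
    using ins_braid by (simp add: lift_def concat_replicate_map)
qed

lemma eqv_lift: "eqv u v \<Longrightarrow> equivclp grp_ins (lift u) (lift v)"
proof (induction rule: equivclp_induct)
  case (step y z)
  have "equivclp grp_ins (lift y) (lift z)"
    using step(2) ins_lift grp_eqv_ins equivclp_sym by metis
  thus ?case using step equivclp_trans by metis
qed simp

definition drop_signs :: "(nat list set \<times> bool) list \<Rightarrow> nat list" where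
  "drop_signs w = map (idx \<circ> fst) w"

text \<open>
  A formal inverse equals its generator, by a cancelling pair followed by the relator of the square.
\<close>

lemma lift_drop_signs:
  assumes "w \<in> words_over S" shows "equivclp grp_ins w (lift (drop_signs w))"
  using assms
proof (induction w)
  case Nil
  then show ?case by (simp add: lift_def drop_signs_def)
next
  case (Cons x w)
  obtain s b where x: "x = (s, b)" by force
  have s: "s \<in> S" and w: "w \<in> words_over S" using Cons.prems x by (auto simp: words_over_def)
  then obtain i where i: "i \<in> I" "s = gen i" by (auto simp: S_def)
  have "equivclp grp_ins [(s, b)] [(s, True)]"
  proof (cases b)
    case False
    have "[(s, True), (s, True)] \<in> coxeter_relators S coxeter_label" using s by (auto simp: coxeter_relators_def)
    hence "grp_ins [(s, False)] ([(s, False)] @ [(s, True), (s, True)])"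
      using insertion.relator[of _ "coxeter_relators S coxeter_label" S "[(s, False)]" "[]"] by simp
    moreover have "grp_ins [(s, True)] ([(s, False), (s, True)] @ [(s, True)])"
      using insertion.cancelling_pair[of s S "coxeter_relators S coxeter_label" "[]" "[(s, True)]" False] s by simp
    ultimately show ?thesis using False equivclp_trans[OF grp_eqv_ins equivclp_sym[OF grp_eqv_ins]] by auto
  qed simp
  from grp_eqv_context[OF this, of "[]" w]
  have "equivclp grp_ins (x # w) ((s, True) # w)" using x by simp
  moreover from grp_eqv_context[OF Cons.IH[OF w], of "[(s, True)]" "[]"]
  have "equivclp grp_ins ((s, True) # w) ((s, True) # lift (drop_signs w))" by simp
  moreover have "(s, True) # lift (drop_signs w) = lift (drop_signs (x # w))"
    using x i by (simp add: lift_def drop_signs_def)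
  ultimately show ?case using equivclp_trans by metis
qed

lemma grp_ins_drop: assumes "grp_ins x y" shows "eqv (drop_signs x) (drop_signs y)"
  using assms
proof cases
  case (cancelling_pair s u v b)
  then obtain i where i: "i \<in> I" "s = gen i" by (auto simp: S_def)
  have "ins (drop_signs u @ drop_signs v) (drop_signs u @ [i, i] @ drop_signs v)"
    using i by (intro ins_square)
  thus ?thesis using cancelling_pair i by (auto simp: drop_signs_def)
next
  case (relator r u v)
  then consider i where "i \<in> I" "r = [(gen i, True), (gen i, True)]"
    | i j where "i \<in> I" "j \<in> I" "i \<noteq> j" "r = concat (replicate (m i j) [(gen i, True), (gen j, True)])"
  proof -
    from relator(3) consider s where "s \<in> S" "r = [(s, True), (s, True)]"
      | s t n where "s \<in> S" "t \<in> S" "s \<noteq> t" "coxeter_label s t = enat n" "r = concat (replicate n [(s, True), (t, True)])"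
      unfolding coxeter_relators_def by blast
    thus thesis
    proof cases
      case 1
      then show thesis using that(1) by (auto simp: S_def)
    next
      case 2
      then obtain i j where "i \<in> I" "j \<in> I" "s = gen i" "t = gen j" by (auto simp: S_def)
      thus thesis using 2 that(2)[of i j] by (auto simp: coxeter_label_def)
    qed
  qed
  thus ?thesis
  proof cases
    case 1
    have "ins (drop_signs u @ drop_signs v) (drop_signs u @ [i, i] @ drop_signs v)"
      using 1 by (intro ins_square)
    thus ?thesis using relator 1 by (auto simp: drop_signs_def)
  next
    case 2
    have "ins (drop_signs u @ drop_signs v) (drop_signs u @ concat (replicate (m i j) [i, j]) @ drop_signs v)"
      using 2 by (intro ins_braid)
    thus ?thesis using relator 2 by (auto simp: drop_signs_def concat_replicate_map)
  qed
qed

lemma grp_eqv_drop: "equivclp grp_ins x y \<Longrightarrow> eqv (drop_signs x) (drop_signs y)"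
proof (induction rule: equivclp_induct)
  case (step y z)
  have "eqv (drop_signs y) (drop_signs z)" using step(2) grp_ins_drop[of y z] grp_ins_drop[of z y] eqv_sym by blast
  thus ?case using step eqv_trans by blast
qed simp

lemma eval_word_cls: "w \<in> words_over S \<Longrightarrow> eval_word W w = cls (drop_signs w)"
proof (induction w)
  case Nil
  then show ?case by (simp add: drop_signs_def W_one)
next
  case (Cons x w)
  obtain s b where x: "x = (s, b)" by force
  have s: "s \<in> S" and w: "w \<in> words_over S" using Cons.prems x by (auto simp: words_over_def)
  then obtain i where i: "i \<in> I" "s = gen i" by (auto simp: S_def)
  show ?case using Cons.IH[OF w] x i by (simp add: inv_gen drop_signs_def cls_Cons)
qed

lemma cls_generate: "u \<in> lists I \<Longrightarrow> cls u \<in> generate W S"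
proof (induction u)
  case Nil
  then show ?case using generate.one[of W S] by (simp add: W_one)
next
  case (Cons i u)
  hence "gen i \<in> generate W S" by (auto intro!: generate.incl simp: S_def)
  thus ?case using Cons by (auto simp: cls_Cons intro: generate.eng)
qed

theorem coxeter_system_W: "coxeter_system W S"
proof -
  have S: "S \<subseteq> carrier W" by (auto simp: S_def)
  have R: "coxeter_relators S coxeter_label \<subseteq> words_over S"
    by (auto simp: coxeter_relators_def words_over_def in_lists_conv_set split: if_splits)
  have gen: "generate W S = carrier W"
    using W.generate_incl[OF S] cls_generate by (auto simp: W_carrier)
  have "eval_word W w = \<one>\<^bsub>W\<^esub> \<longleftrightarrow> equivclp grp_ins w []" if w: "w \<in> words_over S" for w
  proof
    assume "eval_word W w = \<one>\<^bsub>W\<^esub>"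
    hence "eqv (drop_signs w) []" using eval_word_cls w by (simp add: W_one cls_eq)
    from eqv_lift[OF this] show "equivclp grp_ins w []"
      using equivclp_trans[OF lift_drop_signs[OF w]] by (simp add: lift_def)
  next
    assume "equivclp grp_ins w []"
    from grp_eqv_drop[OF this] show "eval_word W w = \<one>\<^bsub>W\<^esub>"
      using eval_word_cls w by (simp add: W_one cls_eq drop_signs_def)
  qed
  hence "presented_by W S (coxeter_relators S coxeter_label)"
    unfolding presented_by_def using S R gen group_W by blast
  moreover have "2 \<le> coxeter_label s t \<and> coxeter_label t s = coxeter_label s t" if "s \<in> S" "t \<in> S" "s \<noteq> t" for s t
  proof -
    from that obtain i j where "i \<in> I" "j \<in> I" "s = gen i" "t = gen j" by (auto simp: S_def)
    thus ?thesis using that m_pos[of i j] m_sym[of i j] by (auto simp: coxeter_label_def numeral_eq_enat)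
  qed
  ultimately show ?thesis unfolding coxeter_system_def by blast
qed

end

section \<open>Roots of unity\<close>

lemma cis_not_one:
  fixes m n :: nat assumes "0 < n" "n < m"
  shows "cis (2 * pi / m) ^ n \<noteq> 1"
proof
  assume "cis (2 * pi / m) ^ n = 1"
  hence "cis (n * (2 * pi / m)) = 1" by (simp add: DeMoivre)
  hence "cos (n * (2 * pi / m)) = 1" by (simp add: complex_eq_iff)
  then obtain k :: int where k: "n * (2 * pi / m) = k * 2 * pi" using cos_one_2pi_int by auto
  have "n * (2 * pi / m) = (real n / real m) * (2 * pi)" by simp
  hence "(real n / real m) * (2 * pi) = real_of_int k * (2 * pi)" using k by simp
  hence "real n / real m = real_of_int k" by (simp only: mult_cancel_right) simp
  hence "real_of_int k * real m = real n" using assms by (simp add: field_simps)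
  hence "k * int m = int n" by (metis of_int_eq_iff of_int_mult of_int_of_nat_eq)
  moreover have "k * int m \<le> 0" if "k \<le> 0" using that by (simp add: mult_nonpos_nonneg)
  moreover have "int m \<le> k * int m" if "1 \<le> k" using mult_right_mono[OF that, of "int m"] by simp
  ultimately show False using assms by (cases "k \<le> 0") auto
qed

lemma cis_pow_one: "0 < m \<Longrightarrow> cis (2 * pi / real m) ^ m = 1"
  by (simp add: DeMoivre)

section \<open>Commuting generators A and a large remainder B\<close>

text \<open>
  The generator \<open>b\<close> and its conjugate by \<open>a\<close> generate a dihedral group with half the label of \<open>a\<close> and \<open>b\<close>;
  the bound 8 makes this half at least 4.
\<close>

locale bipartite_coxeter = even_coxeter_matrix I m for I m +
  fixes A B :: "nat set"
  assumes I_eq: "I = A \<union> B" and AB_disjoint: "A \<inter> B = {}"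
    and m_AA: "a \<in> A \<Longrightarrow> a' \<in> A \<Longrightarrow> a \<noteq> a' \<Longrightarrow> m a a' = 2"
    and m_AB: "a \<in> A \<Longrightarrow> b \<in> B \<Longrightarrow> 8 \<le> m a b"
    and m_BB: "b \<in> B \<Longrightarrow> b' \<in> B \<Longrightarrow> b \<noteq> b' \<Longrightarrow> 8 \<le> m b b'"
begin

lemma A_sub: "A \<subseteq> I" and B_sub: "B \<subseteq> I" using I_eq by auto

lemma cls_replicate: "i \<in> I \<Longrightarrow> j \<in> I \<Longrightarrow> cls (concat (replicate n [i, j])) = (gen i \<star> gen j) [^]\<^bsub>W\<^esub> n"
proof (induction n)
  case (Suc n)
  have "cls (concat (replicate (Suc n) [i, j])) = (gen i \<star> gen j) \<star> cls (concat (replicate n [i, j]))"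
    by (simp add: gen_def W_mult)
  also have "\<dots> = (gen i \<star> gen j) [^]\<^bsub>W\<^esub> Suc n"
    using Suc W.nat_pow_Suc2[of "gen i \<star> gen j" n] by simp
  finally show ?case .
qed (simp add: W_one)

lemma gen_order: "i \<in> I \<Longrightarrow> j \<in> I \<Longrightarrow> i \<noteq> j \<Longrightarrow> (gen i \<star> gen j) [^]\<^bsub>W\<^esub> m i j = \<one>\<^bsub>W\<^esub>"
  using eqv_sym[OF eqv_ins[OF ins_braid[of i j "[]" "[]"]]]
  by (simp add: cls_replicate[symmetric] W_one cls_eq)

definition tits :: "nat \<Rightarrow> nat list set \<times> bool \<Rightarrow> nat list set \<times> bool" where
  "tits i = W.flip (gen i) (i \<in> B)"

lemma action_tits: "action tits"
  unfolding action_def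
proof (intro conjI ballI impI)
  fix i assume "i \<in> I"
  thus "tits i \<circ> tits i = id" unfolding tits_def using gen_square by (intro W.flip_flip) auto
next
  fix i j assume ij: "i \<in> I" "j \<in> I" "i \<noteq> j"
  obtain h where h: "m i j = 2 * h" using m_even[OF ij] by (rule evenE)
  show "(tits j \<circ> tits i) ^^ m i j = id"
    unfolding tits_def h using ij gen_square gen_order[OF ij] h by (intro W.flip_braid) auto
qed

lemma fold_tits: "u \<in> lists I \<Longrightarrow> r \<in> carrier W \<Longrightarrow>
    snd (fold tits u (r, b)) = (b \<noteq> snd (fold tits u (r, False)))"
proof (induction u arbitrary: r b)
  case (Cons i u)
  let ?r = "gen i \<star> r \<star> gen i"
  have r: "?r \<in> carrier W" using Cons.prems by simp
  have "tits i (r, b) = (?r, b \<noteq> (i \<in> B \<and> r = gen i))" for b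
    using Cons.prems by (simp add: tits_def W.flip_def)
  thus ?case using Cons.prems Cons.IH[OF _ r, of "b \<noteq> (i \<in> B \<and> r = gen i)"] Cons.IH[OF _ r, of "i \<in> B \<and> r = gen i"] by auto
qed simp

definition rep :: "nat list set \<Rightarrow> nat list" where "rep g = (SOME u. u \<in> lists I \<and> g = cls u)"

lemma rep: "g \<in> carrier W \<Longrightarrow> rep g \<in> lists I \<and> g = cls (rep g)"
  unfolding rep_def by (rule someI_ex) (auto simp: W_carrier)

text \<open>
  Only walls of conjugates of elements of \<open>B\<close> are recorded, so the elements of \<open>Q\<close> cross no wall.
\<close>

definition N :: "nat list set \<Rightarrow> nat list set \<Rightarrow> bool" where
  "N g r \<longleftrightarrow> snd (fold tits (rep g) (r, False))"

lemma N_cls: "u \<in> lists I \<Longrightarrow> N (cls u) r \<longleftrightarrow> snd (fold tits u (r, False))"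
proof -
  assume "u \<in> lists I"
  hence "cls u = cls (rep (cls u))" using rep[of "cls u"] by simp
  hence "fold tits u = fold tits (rep (cls u))" using action_eqv[OF action_tits] by (simp add: cls_eq)
  thus ?thesis by (simp add: N_def)
qed

lemma N_one: "\<not> N \<one>\<^bsub>W\<^esub> r" using N_cls[of "[]" r] by (simp add: W_one)

lemma N_gen:
  assumes i: "i \<in> I" and g: "g \<in> carrier W" and r: "r \<in> carrier W"
  shows "N (gen i \<star> g) r \<longleftrightarrow> (i \<in> B \<and> r = gen i) \<noteq> N g (gen i \<star> r \<star> gen i)"
proof -
  let ?r = "gen i \<star> r \<star> gen i"
  obtain u where u: "u \<in> lists I" "g = cls u" using g by (auto simp: W_carrier)
  have "N (gen i \<star> g) r \<longleftrightarrow> snd (fold tits (i # u) (r, False))"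
    using N_cls[of "i # u" r] u i by (simp add: cls_Cons)
  also have "fold tits (i # u) (r, False) = fold tits u (?r, i \<in> B \<and> r = gen i)"
    using r by (simp add: tits_def W.flip_def)
  also have "snd \<dots> = ((i \<in> B \<and> r = gen i) \<noteq> snd (fold tits u (?r, False)))"
    using i r by (intro fold_tits u(1)) simp
  also have "snd (fold tits u (?r, False)) = N g ?r" using N_cls[OF u(1)] u(2) by simp
  finally show ?thesis .
qed

definition Q :: "nat list set set" where "Q = cls ` lists A"

lemma QE: assumes "q \<in> Q" obtains u where "u \<in> lists A" "u \<in> lists I" "q = cls u"
  using assms A_sub lists_mono[OF A_sub] by (auto simp: Q_def)

lemma Q_carrier [simp]: "q \<in> Q \<Longrightarrow> q \<in> carrier W"
  by (erule QE) (simp only: cls_closed)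

lemma Q_one: "\<one>\<^bsub>W\<^esub> \<in> Q" by (auto simp: Q_def W_one)

lemma Q_mult: "q \<in> Q \<Longrightarrow> q' \<in> Q \<Longrightarrow> q \<star> q' \<in> Q"
  by (auto simp: Q_def W_mult intro!: imageI)

lemma Q_inv: assumes "q \<in> Q" shows "inv\<^bsub>W\<^esub> q \<in> Q"
proof -
  obtain u where u: "u \<in> lists A" "u \<in> lists I" "q = cls u" using assms by (rule QE)
  hence "rev u \<in> lists A" by (simp add: in_lists_conv_set)
  thus ?thesis using inv_cls u by (auto simp: Q_def)
qed

lemma A_commute:
  assumes "a \<in> A" "a' \<in> A"
  shows "gen a \<star> gen a' = gen a' \<star> gen a"
proof (cases "a = a'")
  case False
  have a: "a \<in> I" "a' \<in> I" using assms A_sub by auto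
  have "(gen a \<star> gen a') [^]\<^bsub>W\<^esub> (2::nat) = \<one>\<^bsub>W\<^esub>"
    using gen_order[OF a False] m_AA[OF assms False] by simp
  hence "(gen a \<star> gen a') \<star> (gen a \<star> gen a') = \<one>\<^bsub>W\<^esub>"
    using a by (simp add: numeral_2_eq_2)
  hence "inv\<^bsub>W\<^esub> (gen a \<star> gen a') = gen a \<star> gen a'" using a by (intro W.inv_equality) auto
  thus ?thesis using a by (simp add: W.inv_mult_group inv_gen)
qed simp

lemma A_commute_word:
  assumes "a \<in> A" "u \<in> lists A"
  shows "gen a \<star> cls u = cls u \<star> gen a"
  using assms(2)
proof (induction u)
  case Nil
  then show ?case using assms A_sub by (auto simp: W_one[symmetric])
next
  case (Cons x u)
  hence x: "x \<in> A" "u \<in> lists A" by auto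
  have c: "gen a \<in> carrier W" "gen x \<in> carrier W" "cls u \<in> carrier W"
    using x assms A_sub lists_mono[OF A_sub] by (auto intro!: gen_closed cls_closed)
  have "gen a \<star> cls (x # u) = gen x \<star> (gen a \<star> cls u)"
    unfolding cls_Cons using c A_commute[OF assms(1) x(1)] by (simp add: W.m_assoc[symmetric])
  also have "\<dots> = cls (x # u) \<star> gen a"
    unfolding cls_Cons using c Cons.IH x by (simp add: W.m_assoc)
  finally show ?case .
qed

lemma A_cancel:
  assumes "a \<in> A" "p \<in> lists A" "q \<in> lists A"
  shows "cls (a # p @ a # q) = cls (p @ q)"
proof -
  have c: "gen a \<in> carrier W" "cls p \<in> carrier W" "cls q \<in> carrier W" "a \<in> I"
    using assms A_sub lists_mono[OF A_sub] by (auto intro!: gen_closed cls_closed)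
  have "cls (a # p @ a # q) = (gen a \<star> cls p) \<star> (gen a \<star> cls q)"
    using c by (simp add: cls_Cons[symmetric] W_mult)
  also have "\<dots> = cls p \<star> ((gen a \<star> gen a) \<star> cls q)"
    unfolding A_commute_word[OF assms(1,2)] using c by (simp add: W.m_assoc)
  also have "\<dots> = cls (p @ q)" using gen_square c by (simp add: W_mult)
  finally show ?thesis .
qed

lemma A_distinct: "u \<in> lists A \<Longrightarrow> \<exists>v. set v \<subseteq> A \<and> distinct v \<and> cls u = cls v"
proof (induction "length u" arbitrary: u rule: less_induct)
  case less
  show ?case
  proof (cases "distinct u")
    case True
    then show ?thesis using less by (intro exI[of _ u]) (auto simp: in_lists_conv_set)
  next
    case False
    then obtain xs ys zs a where u: "u = xs @ [a] @ ys @ [a] @ zs" using not_distinct_decomp by blast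
    hence p: "a \<in> A" "ys \<in> lists A" "zs \<in> lists A" "xs @ ys @ zs \<in> lists A" using less.prems by auto
    have "cls u = cls xs \<star> cls (a # ys @ a # zs)" using u by (simp add: W_mult)
    also have "\<dots> = cls (xs @ ys @ zs)" unfolding A_cancel[OF p(1-3)] by (simp add: W_mult)
    finally show ?thesis using less.hyps[of "xs @ ys @ zs"] u p by auto
  qed
qed

lemma finite_Q: "finite Q"
proof -
  have "Q \<subseteq> cls ` {v. set v \<subseteq> A \<and> distinct v}" unfolding Q_def using A_distinct by blast
  moreover have "finite A" using finite_I A_sub finite_subset by blast
  ultimately show ?thesis using finite_subset_distinct finite_subset finite_imageI by metis
qed

text \<open>
  The generators in \<open>A\<close> commute and are involutions, so equal letters can be cancelled in pairs.
\<close>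

lemma A_even_trivial: "u \<in> lists A \<Longrightarrow> (\<And>a. even (count_list u a)) \<Longrightarrow> cls u = \<one>\<^bsub>W\<^esub>"
proof (induction "length u" arbitrary: u rule: less_induct)
  case less
  show ?case
  proof (cases u)
    case Nil
    then show ?thesis by (simp add: W_one)
  next
    case (Cons a v)
    have "odd (count_list v a)" using less.prems(2)[of a] Cons by simp
    hence "a \<in> set v" by (metis count_list_0_iff even_zero)
    then obtain p q where v: "v = p @ a # q" by (meson split_list)
    hence p: "a \<in> A" "p \<in> lists A" "q \<in> lists A" using Cons less.prems by auto
    have "even (count_list (p @ q) x)" for x using less.prems(2)[of x] Cons v by (auto split: if_splits)
    hence "cls (p @ q) = \<one>\<^bsub>W\<^esub>" using less.hyps[of "p @ q"] p Cons v by auto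
    thus ?thesis using A_cancel[OF p] Cons v by simp
  qed
qed

definition X :: "nat list set set" where
  "X = {q \<star> gen b \<star> inv\<^bsub>W\<^esub> q | q b. q \<in> Q \<and> b \<in> B}"

lemma XE:
  assumes "x \<in> X"
  obtains u b where "u \<in> lists A" "u \<in> lists I" "b \<in> B" "b \<in> I" "x = cls (u @ [b] @ rev u)"
    "x = cls u \<star> gen b \<star> inv\<^bsub>W\<^esub> (cls u)"
proof -
  obtain q b where q: "q \<in> Q" "b \<in> B" "x = q \<star> gen b \<star> inv\<^bsub>W\<^esub> q"
    using assms by (auto simp: X_def)
  obtain u where u: "u \<in> lists A" "u \<in> lists I" "q = cls u" using q(1) by (rule QE)
  thus thesis using that[of u b] q B_sub inv_cls[of u] by (auto simp: gen_def W_mult)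
qed

lemma X_sub: "X \<subseteq> carrier W" using B_sub by (auto simp: X_def)

lemma finite_X: "finite X"
proof -
  have "X = (\<lambda>(q, b). q \<star> gen b \<star> inv\<^bsub>W\<^esub> q) ` (Q \<times> B)" by (auto simp: X_def)
  moreover have "finite B" using finite_I B_sub finite_subset by blast
  ultimately show ?thesis using finite_Q by simp
qed

lemma X_involution: assumes "x \<in> X" shows "x \<star> x = \<one>\<^bsub>W\<^esub>"
proof -
  obtain q b where q: "q \<in> Q" "b \<in> B" "x = q \<star> gen b \<star> inv\<^bsub>W\<^esub> q"
    using assms by (auto simp: X_def)
  have c: "q \<in> carrier W" "gen b \<in> carrier W" "b \<in> I" using q B_sub by auto
  have "x \<star> x = q \<star> (gen b \<star> (inv\<^bsub>W\<^esub> q \<star> q) \<star> gen b) \<star> inv\<^bsub>W\<^esub> q"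
    using q(3) c(1,2) by (simp add: W.m_assoc del: W.l_inv)
  thus ?thesis using c gen_square by simp
qed

lemma N_Q:
  assumes "q \<in> Q" "g \<in> carrier W" "r \<in> carrier W"
  shows "N (q \<star> g) r \<longleftrightarrow> N g (inv\<^bsub>W\<^esub> q \<star> r \<star> q)"
proof -
  obtain u where u: "u \<in> lists A" "q = cls u" using assms(1) by (auto simp: Q_def)
  have "N (cls u \<star> g) r \<longleftrightarrow> N g (inv\<^bsub>W\<^esub> (cls u) \<star> r \<star> cls u)"
    using u(1) assms(3)
  proof (induction u arbitrary: r)
    case Nil
    then show ?case using assms(2) by (simp add: W_one[symmetric])
  next
    case (Cons a u)
    hence a: "a \<in> I" "a \<notin> B" "u \<in> lists A" using A_sub AB_disjoint by auto
    have c: "gen a \<in> carrier W" "cls u \<in> carrier W"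
      using a lists_mono[OF A_sub] by (auto intro!: cls_closed)
    have "N (cls (a # u) \<star> g) r \<longleftrightarrow> N (cls u \<star> g) (gen a \<star> r \<star> gen a)"
      using N_gen[of a "cls u \<star> g" r] a c assms(2) Cons.prems by (simp add: cls_Cons W.m_assoc)
    also have "\<dots> \<longleftrightarrow> N g (inv\<^bsub>W\<^esub> (cls u) \<star> (gen a \<star> r \<star> gen a) \<star> cls u)"
      using Cons.IH[of "gen a \<star> r \<star> gen a"] c Cons.prems by simp
    also have "inv\<^bsub>W\<^esub> (cls u) \<star> (gen a \<star> r \<star> gen a) \<star> cls u =
        inv\<^bsub>W\<^esub> (cls (a # u)) \<star> r \<star> cls (a # u)"
      using c Cons.prems a by (simp add: cls_Cons W.inv_mult_group inv_gen W.m_assoc)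
    finally show ?case .
  qed
  thus ?thesis using u by simp
qed

text \<open>
  Conjugation by \<open>q\<close> carries the crossing rule of the generator \<open>b\<close> to that of its conjugate.
\<close>

lemma N_X:
  assumes x: "x \<in> X" and g: "g \<in> carrier W" and r: "r \<in> carrier W"
  shows "N (x \<star> g) r \<longleftrightarrow> (r = x) \<noteq> N g (x \<star> r \<star> x)"
proof -
  obtain q b where q: "q \<in> Q" "b \<in> B" "x = q \<star> gen b \<star> inv\<^bsub>W\<^esub> q"
    using assms by (auto simp: X_def)
  have c: "q \<in> carrier W" "gen b \<in> carrier W" "b \<in> I" using q B_sub by auto
  define r' where "r' = inv\<^bsub>W\<^esub> q \<star> r \<star> q"
  have r': "r' \<in> carrier W" using r c by (simp add: r'_def)
  have eq: "r' = gen b \<longleftrightarrow> r = x"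
  proof
    assume "r' = gen b"
    hence "q \<star> r' \<star> inv\<^bsub>W\<^esub> q = x" using q by simp
    moreover have "q \<star> r' \<star> inv\<^bsub>W\<^esub> q = (q \<star> inv\<^bsub>W\<^esub> q) \<star> r \<star> (q \<star> inv\<^bsub>W\<^esub> q)"
      unfolding r'_def using c(1) r by (simp add: W.m_assoc del: W.r_inv)
    ultimately show "r = x" using c r by simp
  next
    assume "r = x"
    hence "r' = (inv\<^bsub>W\<^esub> q \<star> q) \<star> gen b \<star> (inv\<^bsub>W\<^esub> q \<star> q)"
      unfolding r'_def q(3) using c(1,2) by (simp add: W.m_assoc del: W.l_inv)
    thus "r' = gen b" using c by simp
  qed
  have "x \<star> g = q \<star> (gen b \<star> (inv\<^bsub>W\<^esub> q \<star> g))" using q(3) c g by (simp add: W.m_assoc)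
  hence "N (x \<star> g) r \<longleftrightarrow> N (gen b \<star> (inv\<^bsub>W\<^esub> q \<star> g)) r'"
    using N_Q[OF q(1), of "gen b \<star> (inv\<^bsub>W\<^esub> q \<star> g)" r] c g r by (simp add: r'_def)
  also have "\<dots> \<longleftrightarrow> (r = x) \<noteq> N (inv\<^bsub>W\<^esub> q \<star> g) (gen b \<star> r' \<star> gen b)"
    using N_gen[OF c(3), of "inv\<^bsub>W\<^esub> q \<star> g" r'] q(2) c g r' eq by simp
  also have "N (inv\<^bsub>W\<^esub> q \<star> g) (gen b \<star> r' \<star> gen b) \<longleftrightarrow>
      N g (q \<star> (gen b \<star> r' \<star> gen b) \<star> inv\<^bsub>W\<^esub> q)"
    using N_Q[OF Q_inv[OF q(1)] g, of "gen b \<star> r' \<star> gen b"] c r' by simp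
  also have "q \<star> (gen b \<star> r' \<star> gen b) \<star> inv\<^bsub>W\<^esub> q = x \<star> r \<star> x"
    unfolding r'_def q(3) using c r by (simp add: W.m_assoc)
  finally show ?thesis .
qed

text \<open>
  Reflections of the plane in two lines at angle \<open>\<pi>/m\<close>.
\<close>

definition dihedral :: "nat \<Rightarrow> nat \<Rightarrow> nat \<Rightarrow> complex \<Rightarrow> complex" where
  "dihedral i j = (\<lambda>k. if k = i then cnj else if k = j then (\<lambda>z. cis (2 * pi / m i j) * cnj z) else id)"

lemma action_dihedral:
  assumes "i \<in> I" "j \<in> I" "i \<noteq> j"
  shows "action (dihedral i j)"
  unfolding dihedral_def
proof (rule action_pair)
  let ?w = "cis (2 * pi / m i j)"
  have m: "0 < m i j" using m_pos[OF assms] by simp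
  have w: "?w * cnj ?w = 1" by (simp add: cis_cnj cis_mult)
  show "cnj \<circ> cnj = id" by auto
  show "(\<lambda>z. ?w * cnj z) \<circ> (\<lambda>z. ?w * cnj z) = id" using w by (auto simp: fun_eq_iff mult.assoc[symmetric])
  have "((\<lambda>z. v * z) ^^ n) z = v ^ n * z" for v z :: complex and n
    by (induction n) auto
  moreover have "?w ^ m i j = 1" "cnj ?w ^ m i j = 1"
    using cis_pow_one[OF m] by (simp_all add: complex_cnj_power[symmetric])
  ultimately have pow: "((\<lambda>z. ?w * z) ^^ m i j) = id" "((\<lambda>z. cnj ?w * z) ^^ m i j) = id"
    by (simp_all add: fun_eq_iff)
  have "(\<lambda>z. ?w * cnj z) \<circ> cnj = (\<lambda>z. ?w * z)" "cnj \<circ> (\<lambda>z. ?w * cnj z) = (\<lambda>z. cnj ?w * z)" by auto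
  thus "((\<lambda>z. ?w * cnj z) \<circ> cnj) ^^ m i j = id" "(cnj \<circ> (\<lambda>z. ?w * cnj z)) ^^ m i j = id"
    using pow by simp_all
qed (use assms in auto)

text \<open>
  If \<open>\<rho>\<close> is the rotation by which two reflections differ, commuting means \<open>\<rho>\<^sup>2 = 1\<close>, and the braid
  relation of length 3 means \<open>\<rho>\<^sup>3 = 1\<close>.
\<close>

lemma plane_reflections:
  assumes f: "action f" and us: "us \<in> lists I" "fold f us = (\<lambda>z. \<alpha> * cnj z)"
    and ut: "ut \<in> lists I" "fold f ut = (\<lambda>z. \<beta> * cnj z)"
    and norm: "\<alpha> * cnj \<alpha> = 1" "\<beta> * cnj \<beta> = 1"
    and \<rho>: "(\<beta> * cnj \<alpha>)^2 \<noteq> 1" "(\<beta> * cnj \<alpha>)^3 \<noteq> 1"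
  shows "cls us \<star> cls ut \<noteq> cls ut \<star> cls us"
    "cls us \<star> (cls ut \<star> cls us) \<noteq> cls ut \<star> (cls us \<star> cls ut)"
proof -
  have "(\<beta> * cnj \<alpha>) * (\<alpha> * cnj \<beta>) = (\<alpha> * cnj \<alpha>) * (\<beta> * cnj \<beta>)" by (simp add: mult_ac)
  hence inv: "(\<beta> * cnj \<alpha>) * (\<alpha> * cnj \<beta>) = 1" using norm by simp
  show "cls us \<star> cls ut \<noteq> cls ut \<star> cls us"
  proof
    assume "cls us \<star> cls ut = cls ut \<star> cls us"
    hence "eqv (us @ ut) (ut @ us)" by (simp add: W_mult cls_eq)
    hence "fold f (us @ ut) = fold f (ut @ us)" by (rule action_eqv[OF f])
    hence "fold f (us @ ut) 1 = fold f (ut @ us) 1" by simp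
    hence "\<beta> * cnj \<alpha> = \<alpha> * cnj \<beta>" using us ut by simp
    hence "(\<beta> * cnj \<alpha>)^2 = (\<beta> * cnj \<alpha>) * (\<alpha> * cnj \<beta>)" by (simp add: power2_eq_square)
    thus False using inv \<rho> by simp
  qed
  show "cls us \<star> (cls ut \<star> cls us) \<noteq> cls ut \<star> (cls us \<star> cls ut)"
  proof
    assume "cls us \<star> (cls ut \<star> cls us) = cls ut \<star> (cls us \<star> cls ut)"
    hence "eqv (us @ ut @ us) (ut @ us @ ut)" by (simp add: W_mult cls_eq)
    hence "fold f (us @ ut @ us) = fold f (ut @ us @ ut)" by (rule action_eqv[OF f])
    hence "fold f (us @ ut @ us) 1 = fold f (ut @ us @ ut) 1" by simp
    hence e: "\<alpha> * cnj \<beta> * \<alpha> = \<beta> * cnj \<alpha> * \<beta>" using us ut by (simp add: algebra_simps)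
    have "(\<beta> * cnj \<alpha>)^3 = (\<beta> * cnj \<alpha> * \<beta>) * cnj \<alpha> * (\<beta> * cnj \<alpha>)"
      by (simp add: power3_eq_cube algebra_simps)
    also have "\<dots> = (\<alpha> * cnj \<alpha>) * ((\<beta> * cnj \<alpha>) * (\<alpha> * cnj \<beta>))" unfolding e[symmetric] by (simp add: algebra_simps)
    finally show False using inv norm \<rho> by simp
  qed
qed

text \<open>
  Two distinct elements of \<open>X\<close> come from distinct elements of \<open>B\<close>, or from the same \<open>b\<close> and elements of
  \<open>Q\<close> that differ in the parity of some \<open>a\<close>. The retraction to the dihedral group of the two elements
  of \<open>B\<close>, respectively of \<open>a\<close> and \<open>b\<close>, separates the two sides of either relation. In the second case
  the rotation is twice that of \<open>a\<close> and \<open>b\<close>.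
\<close>

lemma X_no_relation:
  assumes "s \<in> X" "t \<in> X" "s \<noteq> t"
  shows "s \<star> t \<noteq> t \<star> s \<and> s \<star> (t \<star> s) \<noteq> t \<star> (s \<star> t)"
proof -
  obtain u b where u: "u \<in> lists A" "u \<in> lists I" "b \<in> B" "b \<in> I" "s = cls (u @ [b] @ rev u)"
    "s = cls u \<star> gen b \<star> inv\<^bsub>W\<^esub> (cls u)" using assms(1) by (rule XE)
  obtain u' b' where u': "u' \<in> lists A" "u' \<in> lists I" "b' \<in> B" "b' \<in> I" "t = cls (u' @ [b'] @ rev u')"
    "t = cls u' \<star> gen b' \<star> inv\<^bsub>W\<^esub> (cls u')" using assms(2) by (rule XE)
  have lists: "u @ [b] @ rev u \<in> lists I" "u' @ [b'] @ rev u' \<in> lists I"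
    using u u' by (auto simp: in_lists_conv_set)
  show ?thesis
  proof (cases "b = b'")
    case False
    define w where "w = cis (2 * pi / m b b')"
    have w: "w * cnj w = 1" by (simp add: w_def cis_cnj cis_mult)
    have w23: "w ^ 2 \<noteq> 1" "w ^ 3 \<noteq> 1"
      using cis_not_one[of 2 "m b b'"] cis_not_one[of 3 "m b b'"] m_BB[OF u(3) u'(3) False] by (simp_all add: w_def)
    have id: "fold (dihedral b b') v = id" if "set v \<subseteq> A" for v
      using that u(3) u'(3) AB_disjoint
    proof (induction v)
      case (Cons a v)
      hence "dihedral b b' a = id" by (auto simp: dihedral_def)
      thus ?case using Cons by simp
    qed simp
    have "set u \<subseteq> A" "set (rev u) \<subseteq> A" "set u' \<subseteq> A" "set (rev u') \<subseteq> A"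
      using u u' by (auto simp: in_lists_conv_set)
    note ids = this[THEN id]
    have "fold (dihedral b b') (u @ [b] @ rev u) = (\<lambda>z. 1 * cnj z)"
      "fold (dihedral b b') (u' @ [b'] @ rev u') = (\<lambda>z. w * cnj z)"
      using ids False by (auto simp: dihedral_def w_def fun_eq_iff)
    from plane_reflections[OF action_dihedral[OF u(4) u'(4) False] lists(1) this(1) lists(2) this(2)]
    show ?thesis using w w23 u(5) u'(5) by simp
  next
    case True
    obtain a where a: "even (count_list u a) \<noteq> even (count_list u' a)"
    proof (rule ccontr)
      assume n: "\<not> thesis"
      hence "even (count_list (u @ rev u') a)" for a using that by auto
      moreover have "u @ rev u' \<in> lists A" using u u' by (auto simp: in_lists_conv_set)
      ultimately have "cls (u @ rev u') = \<one>\<^bsub>W\<^esub>" using A_even_trivial by blast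
      hence "cls u \<star> inv\<^bsub>W\<^esub> (cls u') = \<one>\<^bsub>W\<^esub>" using inv_cls u' by (simp add: W_mult)
      hence "cls u = cls u'" using u(2) u'(2)
        by (metis W.inv_equality W.inv_inv W.inv_closed cls_closed)
      thus False using u(6) u'(6) True assms(3) by simp
    qed
    have "a \<in> set u \<or> a \<in> set u'" using a by (metis count_list_0_iff)
    hence aA: "a \<in> A" using u u' by (auto simp: in_lists_conv_set)
    hence aI: "a \<in> I" "a \<noteq> b" using A_sub AB_disjoint u(3) by auto
    define w where "w = cis (2 * pi / m a b)"
    have w: "w * cnj w = 1" "cnj w * w = 1" by (simp_all add: w_def cis_cnj cis_mult)
    have w46: "w ^ 4 \<noteq> 1" "w ^ 6 \<noteq> 1"
      using cis_not_one[of 4 "m a b"] cis_not_one[of 6 "m a b"] m_AB[OF aA u(3)] by (simp_all add: w_def)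
    have fd: "fold (dihedral a b) v = (if even (count_list v a) then id else cnj)" if "set v \<subseteq> A" for v
      using that
    proof (induction v)
      case (Cons x v)
      hence x: "x \<noteq> b" using u(3) AB_disjoint by auto
      show ?case
      proof (cases "x = a")
        case True
        then show ?thesis using Cons by (auto simp: dihedral_def fun_eq_iff)
      next
        case False
        then show ?thesis using Cons x by (auto simp: dihedral_def fun_eq_iff)
      qed
    qed simp
    have fold_refl: "fold (dihedral a b) (v @ [b] @ rev v) = (\<lambda>z. (if even (count_list v a) then w else cnj w) * cnj z)"
      if "set v \<subseteq> A" for v
    proof -
      have "fold (dihedral a b) (rev v) = (if even (count_list v a) then id else cnj)"
        using fd[of "rev v"] that by simp
      moreover have "dihedral a b b = (\<lambda>z. w * cnj z)" using aI by (auto simp: dihedral_def w_def)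
      ultimately show ?thesis using fd[OF that] by (auto simp: fun_eq_iff)
    qed
    have sets: "set u \<subseteq> A" "set u' \<subseteq> A" using u u' by (auto simp: in_lists_conv_set)
    define \<alpha> where "\<alpha> = (if even (count_list u a) then w else cnj w)"
    define \<beta> where "\<beta> = (if even (count_list u' a) then w else cnj w)"
    have n: "\<alpha> * cnj \<alpha> = 1" "\<beta> * cnj \<beta> = 1" using w by (auto simp: \<alpha>_def \<beta>_def)
    have "\<beta> * cnj \<alpha> = w * w \<or> \<beta> * cnj \<alpha> = cnj (w * w)" using a by (auto simp: \<alpha>_def \<beta>_def)
    moreover have "(w * w)^2 = w^4" "(w * w)^3 = w^6" by (simp_all add: power_mult_distrib power_add[symmetric])
    ultimately have "(\<beta> * cnj \<alpha>)^2 \<noteq> 1" "(\<beta> * cnj \<alpha>)^3 \<noteq> 1"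
      using w46 by (auto simp: complex_cnj_power[symmetric] simp del: complex_cnj_mult complex_cnj_power)
    from plane_reflections[OF action_dihedral[OF aI(1) u(4) aI(2)] lists(1) fold_refl[OF sets(1), folded \<alpha>_def]
        lists(2)[folded True] fold_refl[OF sets(2), folded \<beta>_def] n this]
    show ?thesis using u(5) u'(5) True by simp
  qed
qed

lemma reflection_cocycle: "reflection_cocycle W X N"
proof (intro reflection_cocycle.intro reflection_cocycle_axioms.intro)
  show "group W" by (rule group_W)
qed (use finite_X X_sub X_involution N_one N_X X_no_relation in auto)

end

section \<open>Word-hyperbolicity\<close>

context bipartite_coxeter begin

interpretation rc: reflection_cocycle W X N by (rule reflection_cocycle)

lemma X_conj: assumes "x \<in> X" "q \<in> Q" shows "q \<star> x \<star> inv\<^bsub>W\<^esub> q \<in> X"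
proof -
  obtain q' b where q: "q' \<in> Q" "b \<in> B" "x = q' \<star> gen b \<star> inv\<^bsub>W\<^esub> q'"
    using assms(1) unfolding X_def by blast
  have c: "q \<in> carrier W" "q' \<in> carrier W" "gen b \<in> carrier W"
    using Q_carrier[OF q(1)] Q_carrier[OF assms(2)] gen_closed[of b] q(2) B_sub by blast+
  have "q \<star> x \<star> inv\<^bsub>W\<^esub> q = (q \<star> q') \<star> gen b \<star> inv\<^bsub>W\<^esub> (q \<star> q')"
    unfolding q(3) using c by (simp add: W.m_assoc W.inv_mult_group)
  thus ?thesis using Q_mult[OF assms(2) q(1)] q(2) unfolding X_def by blast
qed

lemma gen_B_X: "b \<in> B \<Longrightarrow> gen b \<in> X"
  using Q_one B_sub unfolding X_def by (intro CollectI exI[of _ "\<one>\<^bsub>W\<^esub>"] exI[of _ b]) auto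

lemma K_conj: assumes "\<kappa> \<in> rc.K" "q \<in> Q" shows "q \<star> \<kappa> \<star> inv\<^bsub>W\<^esub> q \<in> rc.K"
proof -
  have q: "q \<in> carrier W" using assms by simp
  obtain ws where ws: "set ws \<subseteq> X" "\<kappa> = rc.wprod ws" using assms(1) by (rule rc.KE)
  have "q \<star> rc.wprod ws \<star> inv\<^bsub>W\<^esub> q \<in> rc.K" using ws(1)
  proof (induction ws)
    case Nil
    then show ?case using rc.K_one q by simp
  next
    case (Cons x ws)
    have c: "x \<in> carrier W" "rc.wprod ws \<in> carrier W" "x \<in> X" using Cons.prems X_sub by auto
    have "q \<star> rc.wprod (x # ws) \<star> inv\<^bsub>W\<^esub> q =
        (q \<star> x \<star> inv\<^bsub>W\<^esub> q) \<star> (q \<star> rc.wprod ws \<star> inv\<^bsub>W\<^esub> q)"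
      using c q by (simp add: W.m_assoc)
    thus ?case using rc.K_mult[OF rc.X_K[OF X_conj[OF c(3) assms(2)]]] Cons by simp
  qed
  thus ?thesis using ws by simp
qed

lemma decompose: assumes "g \<in> carrier W" shows "\<exists>\<kappa>\<in>rc.K. \<exists>q\<in>Q. g = \<kappa> \<star> q"
proof -
  obtain u where u: "u \<in> lists I" "g = cls u" using assms by (auto simp: W_carrier)
  have "\<exists>\<kappa>\<in>rc.K. \<exists>q\<in>Q. cls u = \<kappa> \<star> q" using u(1)
  proof (induction u)
    case Nil
    then show ?case using rc.K_one Q_one by (intro bexI[of _ "\<one>\<^bsub>W\<^esub>"]) (auto simp: W_one[symmetric])
  next
    case (Cons i u)
    then obtain \<kappa> q where k: "\<kappa> \<in> rc.K" "q \<in> Q" "cls u = \<kappa> \<star> q" by auto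
    have c: "\<kappa> \<in> carrier W" "q \<in> carrier W" "gen i \<in> carrier W" using k Cons by auto
    show ?case
    proof (cases "i \<in> B")
      case True
      have "cls (i # u) = (gen i \<star> \<kappa>) \<star> q" using c k by (simp add: cls_Cons W.m_assoc)
      thus ?thesis using rc.K_mult[OF rc.X_K[OF gen_B_X[OF True]] k(1)] k(2) by blast
    next
      case False
      hence "i \<in> A" using Cons I_eq by auto
      hence a: "gen i \<in> Q" by (auto simp: Q_def gen_def)
      have "cls (i # u) = (gen i \<star> \<kappa> \<star> inv\<^bsub>W\<^esub> (gen i)) \<star> (gen i \<star> q)"
        using c k by (simp add: cls_Cons W.m_assoc)
      thus ?thesis using K_conj[OF k(1) a] Q_mult[OF a k(2)] by blast
    qed
  qed
  thus ?thesis using u by simp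
qed

text \<open>
  Elements of \<open>Q\<close> cross no wall, nontrivial elements of \<open>K\<close> cross one. So the \<open>K\<close>-component of an
  element is unique.
\<close>

lemma K_inter_Q: assumes "\<kappa> \<in> rc.K" "\<kappa> \<in> Q" shows "\<kappa> = \<one>\<^bsub>W\<^esub>"
proof (rule ccontr)
  assume n: "\<kappa> \<noteq> \<one>\<^bsub>W\<^esub>"
  obtain ws where ws: "set ws \<subseteq> X" "rc.wprod ws = \<kappa>" "length ws = rc.len \<kappa>" using assms(1) by (rule rc.len_word)
  then obtain x us where x: "ws = x # us" using n by (cases ws) auto
  have xX: "x \<in> X" "set us \<subseteq> X" using ws x by auto
  have "x \<star> \<kappa> = rc.wprod us" using ws(2) x xX by auto
  hence "rc.len (x \<star> \<kappa>) < rc.len \<kappa>" using rc.len_le[OF xX(2)] ws(3) x by simp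
  hence "N \<kappa> x" using rc.N_len[OF rc.X_reflection[OF xX(1)] assms(1)] by simp
  moreover have "N \<kappa> x \<longleftrightarrow> N \<one>\<^bsub>W\<^esub> (inv\<^bsub>W\<^esub> \<kappa> \<star> x \<star> \<kappa>)"
    using N_Q[OF assms(2), of "\<one>\<^bsub>W\<^esub>" x] xX assms by simp
  ultimately show False using N_one by simp
qed

abbreviation E where "E \<equiv> cayley_graph W (Q \<union> X)"

text \<open>
  A generator in \<open>Q\<close> leaves the component in \<open>K\<close> unchanged, and one in \<open>X\<close> moves it by a conjugate in
  \<open>X\<close>. So the component is a contraction.
\<close>

lemma edge_bound:
  assumes e: "(g, h) \<in> E" and k: "\<kappa> \<in> rc.K" "q \<in> Q" "g = \<kappa> \<star> q"
  shows "\<exists>\<kappa>'\<in>rc.K. \<exists>q'\<in>Q. h = \<kappa>' \<star> q' \<and> rc.len (inv\<^bsub>W\<^esub> \<kappa> \<star> \<kappa>') \<le> 1"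
proof -
  obtain a where a: "a \<in> Q \<union> X" "h = g \<star> a \<or> g = h \<star> a" and gh: "g \<in> carrier W" "h \<in> carrier W"
    using e by (auto simp: cayley_graph_def)
  have ac: "a \<in> carrier W" using a X_sub by auto
  have "\<exists>a'\<in>Q \<union> X. h = g \<star> a'"
  proof (cases "h = g \<star> a")
    case False
    hence "h = g \<star> inv\<^bsub>W\<^esub> a" using a gh ac by (simp add: W.m_assoc)
    moreover have "inv\<^bsub>W\<^esub> a \<in> Q \<union> X" using a(1) Q_inv rc.inv_X by auto
    ultimately show ?thesis by blast
  qed (use a in blast)
  then obtain a' where a': "a' \<in> Q \<union> X" "h = g \<star> a'" by blast
  have c: "\<kappa> \<in> carrier W" "q \<in> carrier W" "a' \<in> carrier W" using k a' X_sub by auto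
  show ?thesis
  proof (cases "a' \<in> Q")
    case True
    have "h = \<kappa> \<star> (q \<star> a')" using a' k c by (simp add: W.m_assoc)
    moreover have "rc.len (inv\<^bsub>W\<^esub> \<kappa> \<star> \<kappa>) \<le> 1" using c by simp
    ultimately show ?thesis using k(1) Q_mult[OF k(2) True] by blast
  next
    case False
    define x where "x = q \<star> a' \<star> inv\<^bsub>W\<^esub> q"
    have x: "x \<in> X" using False a' X_conj k x_def by simp
    have "h = (\<kappa> \<star> x) \<star> q" unfolding x_def using a' k c by (simp add: W.m_assoc)
    moreover have "rc.len (inv\<^bsub>W\<^esub> \<kappa> \<star> (\<kappa> \<star> x)) \<le> 1" using rc.len_X_le[OF x] c x by simp
    ultimately show ?thesis using rc.K_mult[OF k(1) rc.X_K[OF x]] k(2) by blast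
  qed
qed

lemma path_bound:
  assumes "(g, h) \<in> E ^^ n" and "\<kappa> \<in> rc.K" "q \<in> Q" "g = \<kappa> \<star> q"
  shows "\<exists>\<kappa>'\<in>rc.K. \<exists>q'\<in>Q. h = \<kappa>' \<star> q' \<and> rc.len (inv\<^bsub>W\<^esub> \<kappa> \<star> \<kappa>') \<le> n"
  using assms(1)
proof (induction n arbitrary: h)
  case 0
  have "\<kappa> \<in> carrier W" using assms by simp
  then show ?case using 0 assms by (intro bexI[of _ \<kappa>] bexI[of _ q]) auto
next
  case (Suc n)
  then obtain h' where h': "(g, h') \<in> E ^^ n" "(h', h) \<in> E" by auto
  obtain \<kappa>' q' where k': "\<kappa>' \<in> rc.K" "q' \<in> Q" "h' = \<kappa>' \<star> q'" "rc.len (inv\<^bsub>W\<^esub> \<kappa> \<star> \<kappa>') \<le> n"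
    using Suc.IH[OF h'(1)] by blast
  obtain \<kappa>'' q'' where k'': "\<kappa>'' \<in> rc.K" "q'' \<in> Q" "h = \<kappa>'' \<star> q''" "rc.len (inv\<^bsub>W\<^esub> \<kappa>' \<star> \<kappa>'') \<le> 1"
    using edge_bound[OF h'(2) k'(1-3)] by blast
  have c: "\<kappa> \<in> carrier W" "\<kappa>' \<in> carrier W" "\<kappa>'' \<in> carrier W" using assms k' k'' by auto
  have "inv\<^bsub>W\<^esub> \<kappa> \<star> \<kappa>'' = (inv\<^bsub>W\<^esub> \<kappa> \<star> \<kappa>') \<star> (inv\<^bsub>W\<^esub> \<kappa>' \<star> \<kappa>'')"
    using c by (simp add: W.m_assoc)
  moreover have "inv\<^bsub>W\<^esub> \<kappa> \<star> \<kappa>' \<in> rc.K" "inv\<^bsub>W\<^esub> \<kappa>' \<star> \<kappa>'' \<in> rc.K"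
    using rc.K_mult rc.K_inv assms k' k'' by blast+
  ultimately have "rc.len (inv\<^bsub>W\<^esub> \<kappa> \<star> \<kappa>'') \<le> Suc n" using rc.len_mult k' k'' by fastforce
  thus ?case using k'' by blast
qed

lemma edgeI: "g \<in> carrier W \<Longrightarrow> a \<in> Q \<union> X \<Longrightarrow> (g, g \<star> a) \<in> E"
  using X_sub by (auto simp: cayley_graph_def)

lemma path_exists:
  assumes k: "\<kappa> \<in> rc.K" "q \<in> Q" "\<kappa>' \<in> rc.K" "q' \<in> Q"
  shows "(\<kappa> \<star> q, \<kappa>' \<star> q') \<in> E ^^ (rc.len (inv\<^bsub>W\<^esub> \<kappa> \<star> \<kappa>') + 2)"
proof -
  have c: "\<kappa> \<in> carrier W" "q \<in> carrier W" "\<kappa>' \<in> carrier W" "q' \<in> carrier W" using k by auto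
  let ?g = "inv\<^bsub>W\<^esub> \<kappa> \<star> \<kappa>'"
  have "?g \<in> rc.K" using k rc.K_mult rc.K_inv by blast
  then obtain ws where ws: "set ws \<subseteq> X" "rc.wprod ws = ?g" "length ws = rc.len ?g" by (rule rc.len_word)
  have path: "(g, g \<star> rc.wprod ws) \<in> E ^^ length ws" if "g \<in> carrier W" "set ws \<subseteq> X" for g ws
    using that
  proof (induction ws arbitrary: g)
    case (Cons x ws)
    hence "(g, g \<star> x) \<in> E" "(g \<star> x, (g \<star> x) \<star> rc.wprod ws) \<in> E ^^ length ws"
      using edgeI[of g x] by auto
    moreover have "(g \<star> x) \<star> rc.wprod ws = g \<star> rc.wprod (x # ws)"
      using Cons.prems by (simp add: W.m_assoc)
    ultimately show ?case by (metis length_Cons relpow_Suc_I2)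
  qed simp
  have "(\<kappa> \<star> q, (\<kappa> \<star> q) \<star> inv\<^bsub>W\<^esub> q) \<in> E" using edgeI c Q_inv[OF k(2)] by simp
  hence 1: "(\<kappa> \<star> q, \<kappa>) \<in> E" using c by (simp add: W.m_assoc)
  have 2: "(\<kappa>, \<kappa>') \<in> E ^^ rc.len ?g" using path[OF c(1) ws(1)] ws c by simp
  have 3: "(\<kappa>', \<kappa>' \<star> q') \<in> E" using edgeI c k by simp
  have "(\<kappa> \<star> q, \<kappa>' \<star> q') \<in> E ^^ Suc (Suc (rc.len ?g))"
    using relpow_Suc_I2[OF 1 relpow_Suc_I[OF 2 3]] .
  thus ?thesis by simp
qed

lemma graph_dist_bounds:
  assumes k: "\<kappa> \<in> rc.K" "q \<in> Q" "\<kappa>' \<in> rc.K" "q' \<in> Q"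
  shows "rc.len (inv\<^bsub>W\<^esub> \<kappa> \<star> \<kappa>') \<le> graph_dist E (\<kappa> \<star> q) (\<kappa>' \<star> q')"
    and "graph_dist E (\<kappa> \<star> q) (\<kappa>' \<star> q') \<le> rc.len (inv\<^bsub>W\<^esub> \<kappa> \<star> \<kappa>') + 2"
proof -
  let ?g = "\<kappa> \<star> q" and ?h = "\<kappa>' \<star> q'"
  show "graph_dist E ?g ?h \<le> rc.len (inv\<^bsub>W\<^esub> \<kappa> \<star> \<kappa>') + 2"
    unfolding graph_dist_def by (rule Least_le) (rule path_exists[OF k])
  have "(?g, ?h) \<in> E ^^ graph_dist E ?g ?h"
    unfolding graph_dist_def by (rule LeastI) (rule path_exists[OF k])
  then obtain \<kappa>'' q'' where k'': "\<kappa>'' \<in> rc.K" "q'' \<in> Q" "?h = \<kappa>'' \<star> q''"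
      "rc.len (inv\<^bsub>W\<^esub> \<kappa> \<star> \<kappa>'') \<le> graph_dist E ?g ?h"
    using path_bound k by blast
  have c: "\<kappa>' \<in> carrier W" "q' \<in> carrier W" "\<kappa>'' \<in> carrier W" "q'' \<in> carrier W" using k k'' by auto
  have "inv\<^bsub>W\<^esub> \<kappa>' \<star> (?h \<star> inv\<^bsub>W\<^esub> q'') = q' \<star> inv\<^bsub>W\<^esub> q''" using c by (simp add: W.m_assoc)
  moreover have "?h \<star> inv\<^bsub>W\<^esub> q'' = \<kappa>''" unfolding k''(3) using c by (simp add: W.m_assoc)
  ultimately have "inv\<^bsub>W\<^esub> \<kappa>' \<star> \<kappa>'' \<in> Q" using Q_mult[OF k(4) Q_inv[OF k''(2)]] by simp
  moreover have "inv\<^bsub>W\<^esub> \<kappa>' \<star> \<kappa>'' \<in> rc.K" using k k'' rc.K_mult rc.K_inv by blast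
  ultimately have "inv\<^bsub>W\<^esub> \<kappa>' \<star> \<kappa>'' = \<one>\<^bsub>W\<^esub>" using K_inter_Q by blast
  hence "\<kappa>' \<star> (inv\<^bsub>W\<^esub> \<kappa>' \<star> \<kappa>'') = \<kappa>'" using c by simp
  hence "\<kappa>'' = \<kappa>'" using c by simp
  thus "rc.len (inv\<^bsub>W\<^esub> \<kappa> \<star> \<kappa>') \<le> graph_dist E ?g ?h" using k'' by simp
qed

lemma gromov_perturb:
  fixes l1 l2 l3 l4 l5 d1 d2 d3 d4 d5 c :: real
  assumes "(l1 + l3 - l4) / 2 \<ge> min ((l1 + l2 - l5) / 2) ((l2 + l3 - l6) / 2) - c"
    and "l1 \<le> d1 \<and> d1 \<le> l1 + 2" "l2 \<le> d2 \<and> d2 \<le> l2 + 2" "l3 \<le> d3 \<and> d3 \<le> l3 + 2"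
      "l4 \<le> d4 \<and> d4 \<le> l4 + 2" "l5 \<le> d5 \<and> d5 \<le> l5 + 2" "l6 \<le> d6 \<and> d6 \<le> l6 + 2"
  shows "(d1 + d3 - d4) / 2 \<ge> min ((d1 + d2 - d5) / 2) ((d2 + d3 - d6) / 2) - (c + 4)"
proof -
  have "(d1 + d2 - d5) / 2 \<le> (l1 + l2 - l5) / 2 + 2" "(d2 + d3 - d6) / 2 \<le> (l2 + l3 - l6) / 2 + 2"
    using assms by (simp_all add: field_simps)
  hence "min ((d1 + d2 - d5) / 2) ((d2 + d3 - d6) / 2) \<le> min ((l1 + l2 - l5) / 2) ((l2 + l3 - l6) / 2) + 2"
    unfolding min_def by auto
  moreover have "(l1 + l3 - l4) / 2 - 1 \<le> (d1 + d3 - d4) / 2" using assms by (simp add: field_simps)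
  ultimately show ?thesis using assms(1) by linarith
qed

theorem word_hyperbolic_W: "word_hyperbolic W"
proof -
  have sub: "Q \<union> X \<subseteq> carrier W" using X_sub by auto
  have "cls u \<in> generate W (Q \<union> X)" if "u \<in> lists I" for u
    using that
  proof (induction u)
    case Nil
    then show ?case using generate.one[of W] by (simp add: W_one)
  next
    case (Cons i u)
    have "i \<in> A \<or> i \<in> B" using Cons.hyps I_eq by blast
    moreover have "gen i \<in> Q" if "i \<in> A" using that by (auto simp: Q_def gen_def)
    ultimately have "gen i \<in> Q \<union> X" using gen_B_X by blast
    thus ?case using Cons.IH unfolding cls_Cons by (blast intro: generate.eng generate.incl)
  qed
  hence gen: "generate W (Q \<union> X) = carrier W" using W.generate_incl[OF sub] by (auto simp: W_carrier)
  have "\<forall>g\<in>carrier W. \<exists>\<kappa>. \<kappa> \<in> rc.K \<and> (\<exists>q\<in>Q. g = \<kappa> \<star> q)" using decompose by blast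
  from bchoice[OF this] obtain p
    where "\<forall>g\<in>carrier W. p g \<in> rc.K \<and> (\<exists>q\<in>Q. g = p g \<star> q)" by blast
  hence p: "\<And>g. g \<in> carrier W \<Longrightarrow> p g \<in> rc.K \<and> (\<exists>q\<in>Q. g = p g \<star> q)" by blast
  let ?d = "\<lambda>x y. real (graph_dist E x y)"
  let ?l = "\<lambda>x y. real (rc.len (inv\<^bsub>W\<^esub> (p x) \<star> p y))"
  have dl: "?l x y \<le> ?d x y \<and> ?d x y \<le> ?l x y + 2" if xy: "x \<in> carrier W" "y \<in> carrier W" for x y
  proof -
    from p[OF xy(1)] obtain q where q: "p x \<in> rc.K" "q \<in> Q" "p x \<star> q = x" by metis
    from p[OF xy(2)] obtain q' where q': "p y \<in> rc.K" "q' \<in> Q" "p y \<star> q' = y" by metis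
    from graph_dist_bounds[OF q(1,2) q'(1,2)] show ?thesis unfolding q(3) q'(3) by simp
  qed
  let ?\<delta> = "real (4 * rc.max_braid) + 4"
  have "gromov_product ?d w x z \<ge> min (gromov_product ?d w x y) (gromov_product ?d w y z) - ?\<delta>"
    if c: "w \<in> carrier W" "x \<in> carrier W" "y \<in> carrier W" "z \<in> carrier W" for w x y z
  proof -
    have K: "p w \<in> rc.K" "p x \<in> rc.K" "p y \<in> rc.K" "p z \<in> rc.K" using p c by blast+
    have t: "inv\<^bsub>W\<^esub> (inv\<^bsub>W\<^esub> (p w) \<star> p u) \<star> (inv\<^bsub>W\<^esub> (p w) \<star> p v) = inv\<^bsub>W\<^esub> (p u) \<star> p v"
      if "p u \<in> rc.K" "p v \<in> rc.K" for u v
      using that K(1) by (simp add: W.m_assoc W.inv_mult_group)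
    have m: "inv\<^bsub>W\<^esub> (p w) \<star> p u \<in> rc.K" if "p u \<in> rc.K" for u
      using that K(1) rc.K_mult rc.K_inv by blast
    have "(?l w x + ?l w z - ?l x z) / 2 \<ge>
        min ((?l w x + ?l w y - ?l x y) / 2) ((?l w y + ?l w z - ?l y z) / 2) - real (4 * rc.max_braid)"
      using rc.gromov_inequality_len[OF m[OF K(2)] m[OF K(3)] m[OF K(4)]] t K by simp
    from gromov_perturb[OF this dl[OF c(1,2)] dl[OF c(1,3)] dl[OF c(1,4)] dl[OF c(2,4)] dl[OF c(2,3)] dl[OF c(3,4)]]
    show ?thesis unfolding gromov_product_def .
  qed
  hence "gromov_hyperbolic (carrier W) ?d"
    unfolding gromov_hyperbolic_def by (intro exI[of _ ?\<delta>]) auto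
  moreover have "finite (Q \<union> X)" using finite_Q finite_X by simp
  ultimately show ?thesis unfolding word_hyperbolic_def using sub gen by blast
qed

end

section \<open>Pairs of linear reflections whose product has finite order\<close>

text \<open>
  The values \<open>cos\<^sup>2 \<theta>\<close> for which the rotation by \<open>2\<theta>\<close>, with eigenvalue \<open>\<zeta>\<close>, has order dividing \<open>\<mu>\<close>.
\<close>

definition angle_set :: "nat \<Rightarrow> real set" where
  "angle_set \<mu> = {\<kappa>. \<exists>\<zeta>::complex. \<zeta> ^ \<mu> = 1 \<and> \<zeta>\<^sup>2 + 1 = (4 * \<kappa> - 2) * \<zeta>}"

locale nondegenerate_form =
  fixes n :: nat and F :: "real mat"
  assumes form_carrier: "F \<in> carrier_mat n n"
    and form_sym: "transpose_mat F = F"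
    and nondegenerate: "x \<in> carrier_vec n \<Longrightarrow> (\<And>y. y \<in> carrier_vec n \<Longrightarrow> bform F x y = 0) \<Longrightarrow> x = 0\<^sub>v n"
begin

abbreviation \<beta> :: "real vec \<Rightarrow> real vec \<Rightarrow> real" where "\<beta> \<equiv> bform F"
abbreviation V :: "real vec set" where "V \<equiv> carrier_vec n"

lemma \<beta>_sym: "x \<in> V \<Longrightarrow> y \<in> V \<Longrightarrow> \<beta> x y = \<beta> y x"
  using transpose_vec_mult_scalar[OF form_carrier, of y x] form_carrier form_sym
  by (simp add: bform_def comm_scalar_prod[of _ n])

lemma \<beta>_diff: "x \<in> V \<Longrightarrow> e \<in> V \<Longrightarrow> y \<in> V \<Longrightarrow> \<beta> (x - c \<cdot>\<^sub>v e) y = \<beta> x y - c * \<beta> e y"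
  using form_carrier by (simp add: bform_def minus_scalar_prod_distrib[of _ n])

lemma \<beta>_smult: "x \<in> V \<Longrightarrow> y \<in> V \<Longrightarrow> \<beta> (c \<cdot>\<^sub>v x) y = c * \<beta> x y"
  using form_carrier by (simp add: bform_def)

lemma \<beta>_smult_right: "x \<in> V \<Longrightarrow> y \<in> V \<Longrightarrow> \<beta> x (c \<cdot>\<^sub>v y) = c * \<beta> x y"
  using \<beta>_smult[of y x c] \<beta>_sym[of x "c \<cdot>\<^sub>v y"] \<beta>_sym[of x y] by simp

definition refl :: "real vec \<Rightarrow> real vec \<Rightarrow> real vec" where
  "refl e x = x - (2 * (\<beta> x e / \<beta> e e)) \<cdot>\<^sub>v e"

lemma refl_closed [simp]: "e \<in> V \<Longrightarrow> x \<in> V \<Longrightarrow> refl e x \<in> V"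
  by (simp add: refl_def)

lemma \<beta>_refl: "e \<in> V \<Longrightarrow> x \<in> V \<Longrightarrow> y \<in> V \<Longrightarrow> \<beta> (refl e x) y = \<beta> x y - 2 * (\<beta> x e / \<beta> e e) * \<beta> e y"
  by (simp add: refl_def \<beta>_diff)

lemma \<beta>_refl_self: "e \<in> V \<Longrightarrow> x \<in> V \<Longrightarrow> \<beta> e e \<noteq> 0 \<Longrightarrow> \<beta> (refl e x) e = - \<beta> x e"
  by (simp add: \<beta>_refl)

lemma refl_scale:
  assumes "e \<in> V" "x \<in> V" "c \<noteq> 0"
  shows "refl (c \<cdot>\<^sub>v e) x = refl e x"
proof -
  have "2 * (\<beta> x (c \<cdot>\<^sub>v e) / \<beta> (c \<cdot>\<^sub>v e) (c \<cdot>\<^sub>v e)) * c = 2 * (\<beta> x e / \<beta> e e)"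
    using assms by (simp add: \<beta>_smult \<beta>_smult_right field_simps)
  thus ?thesis by (simp add: refl_def smult_smult_assoc)
qed

text \<open>
  Vectors of distinct reflections are not proportional, so by nondegeneracy their orthogonal
  hyperplanes are distinct. The vector found here is the test vector for all relations between the
  two reflections.
\<close>

lemma separating_vector:
  assumes a: "a \<in> V" and b: "b \<in> V" "\<beta> b b \<noteq> 0" and aa: "\<beta> a a \<noteq> 0"
    and ne: "\<exists>x\<in>V. refl a x \<noteq> refl b x"
  shows "\<exists>x\<in>V. \<beta> x b = 0 \<and> \<beta> x a \<noteq> 0"
proof -
  define p where "p = \<beta> a b / \<beta> b b"
  have "a - p \<cdot>\<^sub>v b \<noteq> 0\<^sub>v n"
  proof
    assume z: "a - p \<cdot>\<^sub>v b = 0\<^sub>v n"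
    have "a = p \<cdot>\<^sub>v b"
    proof (rule eq_vecI)
      fix i assume i: "i < dim_vec (p \<cdot>\<^sub>v b)"
      hence "(a - p \<cdot>\<^sub>v b) $ i = 0" using z b by simp
      thus "a $ i = (p \<cdot>\<^sub>v b) $ i" using i a b by simp
    qed (use a b in simp)
    moreover from this have "p \<noteq> 0" using aa b by (auto simp: \<beta>_smult)
    ultimately show False using ne refl_scale b by auto
  qed
  then obtain y where y: "y \<in> V" "\<beta> (a - p \<cdot>\<^sub>v b) y \<noteq> 0"
    using nondegenerate[of "a - p \<cdot>\<^sub>v b"] a b by auto
  define x where "x = y - (\<beta> y b / \<beta> b b) \<cdot>\<^sub>v b"
  have x: "x \<in> V" using y b by (simp add: x_def)
  have "\<beta> x b = 0" using y b by (simp add: x_def \<beta>_diff)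
  moreover have "\<beta> x a = \<beta> (a - p \<cdot>\<^sub>v b) y"
    using y a b \<beta>_sym[of y a] \<beta>_sym[of y b] \<beta>_sym[of b a] by (simp add: x_def \<beta>_diff p_def)
  ultimately show ?thesis using x y by auto
qed

lemma commuting_reflections:
  assumes a: "a \<in> V" "\<beta> a a \<noteq> 0" and b: "b \<in> V" "\<beta> b b \<noteq> 0"
    and ne: "\<exists>x\<in>V. refl a x \<noteq> refl b x"
    and comm: "\<And>x. x \<in> V \<Longrightarrow> refl a (refl b x) = refl b (refl a x)"
  shows "\<beta> a b = 0"
proof -
  obtain x where x: "x \<in> V" "\<beta> x b = 0" "\<beta> x a \<noteq> 0" using separating_vector[OF a(1) b a(2) ne] by blast
  have "\<beta> (refl a (refl b x)) b = \<beta> (refl b (refl a x)) b" using comm x by simp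
  hence "\<beta> (refl b x) b - 2 * (\<beta> (refl b x) a / \<beta> a a) * \<beta> a b = - (\<beta> x b - 2 * (\<beta> x a / \<beta> a a) * \<beta> a b)"
    using a b x by (simp add: \<beta>_refl_self) (simp add: \<beta>_refl)
  moreover have "\<beta> (refl b x) b = 0" "\<beta> (refl b x) a = \<beta> x a" using a b x by (simp_all add: \<beta>_refl)
  ultimately show ?thesis using x a by (simp add: field_simps)
qed

lemma orthogonal_reflections_commute:
  assumes a: "a \<in> V" and b: "b \<in> V" and ab: "\<beta> a b = 0" and x: "x \<in> V"
  shows "refl a (refl b x) = refl b (refl a x)"
proof -
  have ba: "\<beta> b a = 0" using \<beta>_sym a b ab by simp
  have "\<beta> (refl b x) a = \<beta> x a" "\<beta> (refl a x) b = \<beta> x b" using a b x ab ba by (simp_all add: \<beta>_refl)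
  hence "refl a (refl b x) = refl b x - (2 * (\<beta> x a / \<beta> a a)) \<cdot>\<^sub>v a"
    "refl b (refl a x) = refl a x - (2 * (\<beta> x b / \<beta> b b)) \<cdot>\<^sub>v b" by (simp_all add: refl_def)
  thus ?thesis using a b x by (intro eq_vecI) (auto simp: refl_def)
qed

text \<open>
  For a root \<open>\<zeta>\<close> of the characteristic polynomial of the product, the functional \<open>f\<close> below is an
  eigenfunctional with eigenvalue \<open>\<zeta>\<close>, so \<open>\<zeta>\<close> is a root of unity. This treats rotations, boosts and
  mixed signs of the two norms at once. For \<open>\<kappa> = 1\<close> the product is unipotent and moves the test vector
  linearly, so it does not have finite order.
\<close>

lemma product_finite_order:
  assumes a: "a \<in> V" "\<beta> a a \<noteq> 0" and b: "b \<in> V" "\<beta> b b \<noteq> 0"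
    and ne: "\<exists>x\<in>V. refl a x \<noteq> refl b x"
    and fin: "0 < \<mu>" "\<And>x. x \<in> V \<Longrightarrow> ((refl a \<circ> refl b) ^^ \<mu>) x = x"
    and ab: "\<beta> a b \<noteq> 0"
  defines "\<kappa> \<equiv> (\<beta> a b)\<^sup>2 / (\<beta> a a * \<beta> b b)"
  shows "\<kappa> \<noteq> 1" "\<kappa> \<in> angle_set \<mu>"
proof -
  define p where "p = \<beta> a b / \<beta> b b"
  define q where "q = \<beta> a b / \<beta> a a"
  have pq: "p * q = \<kappa>" by (simp add: p_def q_def \<kappa>_def power2_eq_square)
  have q0: "q \<noteq> 0" and p0: "p \<noteq> 0" using ab a b by (simp_all add: q_def p_def)
  define g where "g = refl a \<circ> refl b"
  have ba: "\<beta> b a = \<beta> a b" using \<beta>_sym a b by simp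
  have gV: "(g ^^ i) x \<in> V" if "x \<in> V" for i x using that a b by (induction i) (auto simp: g_def)
  have ga: "\<beta> (g x) a = - \<beta> x a + 2 * p * \<beta> x b" if "x \<in> V" for x
    using that a b ba by (simp add: g_def \<beta>_refl_self) (simp add: \<beta>_refl p_def)
  have gb: "\<beta> (g x) b = - 2 * q * \<beta> x a + (4 * \<kappa> - 1) * \<beta> x b" if "x \<in> V" for x
  proof -
    have "\<beta> (g x) b = \<beta> (refl b x) b - 2 * (\<beta> (refl b x) a / \<beta> a a) * \<beta> a b"
      using that a b by (simp add: g_def \<beta>_refl)
    also have "\<dots> = - \<beta> x b - 2 * q * \<beta> (refl b x) a" using that a b by (simp add: \<beta>_refl_self q_def)
    also have "\<beta> (refl b x) a = \<beta> x a - 2 * p * \<beta> x b" using that a b ba by (simp add: \<beta>_refl p_def)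
    finally show ?thesis unfolding pq[symmetric] by (simp add: algebra_simps)
  qed
  obtain x where x: "x \<in> V" "\<beta> x b = 0" "\<beta> x a \<noteq> 0" using separating_vector[OF a(1) b a(2) ne] by blast
  show "\<kappa> \<noteq> 1"
  proof
    assume k1: "\<kappa> = 1"
    have "q * \<beta> ((g ^^ i) x) a - \<beta> ((g ^^ i) x) b = q * \<beta> x a \<and>
        \<beta> ((g ^^ i) x) a = \<beta> x a - 2 * i * (p * (q * \<beta> x a))" for i
    proof (induction i)
      case 0
      then show ?case using x by simp
    next
      case (Suc i)
      let ?y = "(g ^^ i) x"
      have y: "?y \<in> V" using gV x by blast
        have g: "(g ^^ Suc i) x = g ?y" by simp
      have yb: "\<beta> ?y b = q * \<beta> ?y a - q * \<beta> x a" using conjunct1[OF Suc] by linarith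
      have "\<beta> (g ?y) a = (2 * (p * q) - 1) * \<beta> ?y a - 2 * (p * (q * \<beta> x a))"
        using ga[OF y] yb by (simp add: algebra_simps)
      hence A: "\<beta> (g ?y) a = \<beta> ?y a - 2 * (p * (q * \<beta> x a))" using pq k1 by simp
      have "q * \<beta> (g ?y) a - \<beta> (g ?y) b = q * \<beta> ?y a + (2 * (p * q) + 1 - 4 * \<kappa>) * \<beta> ?y b"
        unfolding ga[OF y] gb[OF y] by (simp add: algebra_simps)
      hence B: "q * \<beta> (g ?y) a - \<beta> (g ?y) b = q * \<beta> ?y a - \<beta> ?y b" using pq k1 by simp
      have "q * \<beta> (g ?y) a - \<beta> (g ?y) b = q * \<beta> x a" using B conjunct1[OF Suc] by linarith
      moreover have "\<beta> (g ?y) a = \<beta> x a - 2 * real (Suc i) * (p * (q * \<beta> x a))"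
        unfolding A conjunct2[OF Suc] by (simp add: algebra_simps)
      ultimately show ?case unfolding g by blast
    qed
    hence "\<beta> x a = \<beta> x a - 2 * real \<mu> * (p * (q * \<beta> x a))" using fin(2)[OF x(1), folded g_def] by metis
    thus False using fin(1) p0 q0 x by simp
  qed
  obtain \<zeta> :: complex where \<zeta>: "\<zeta>\<^sup>2 + 1 = (4 * \<kappa> - 2) * \<zeta>"
  proof -
    define r where "r = csqrt ((2 * \<kappa> - 1)\<^sup>2 - 1)"
    have "r\<^sup>2 = (2 * \<kappa> - 1)\<^sup>2 - 1" by (simp add: r_def)
    hence "((2 * \<kappa> - 1) + r)\<^sup>2 + 1 = (4 * \<kappa> - 2) * ((2 * \<kappa> - 1) + r)"
      by (simp add: power2_eq_square algebra_simps)
    thus thesis using that by blast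
  qed
  (* a left eigenvector of the matrix of g in the coordinates given by a and b *)
  let ?f = "\<lambda>y. 2 * q * \<beta> y a - (1 + \<zeta>) * \<beta> y b :: complex"
  have f: "?f (g y) = \<zeta> * ?f y" if "y \<in> V" for y
  proof -
    have "?f (g y) = 2 * q * (- \<beta> y a + 2 * p * \<beta> y b) - (1 + \<zeta>) * (- 2 * q * \<beta> y a + (4 * \<kappa> - 1) * \<beta> y b)"
      unfolding ga[OF that] gb[OF that] by simp
    also have "\<dots> = 2 * q * \<zeta> * \<beta> y a + (4 * (complex_of_real p * q) + (1 + \<zeta>) - 4 * \<kappa> - 4 * \<kappa> * \<zeta>) * \<beta> y b"
      by (simp add: algebra_simps)
    also have "complex_of_real p * q = \<kappa>" using pq by (metis of_real_mult)
    also have "4 * complex_of_real \<kappa> + (1 + \<zeta>) - 4 * \<kappa> - 4 * \<kappa> * \<zeta> = - \<zeta> * (1 + \<zeta>)"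
      using \<zeta> by (simp add: power2_eq_square algebra_simps)
    finally show ?thesis by (simp add: algebra_simps)
  qed
  have "?f ((g ^^ i) x) = \<zeta> ^ i * ?f x" for i
  proof (induction i)
    case (Suc i)
    have "?f ((g ^^ Suc i) x) = \<zeta> * ?f ((g ^^ i) x)" using f[OF gV[OF x(1), of i]] by simp
    also have "\<dots> = \<zeta> * (\<zeta> ^ i * ?f x)" by (simp only: Suc)
    finally show ?case by simp
  qed simp
  hence "?f x = \<zeta> ^ \<mu> * ?f x" using fin(2)[OF x(1), folded g_def] by metis
  moreover have "?f x \<noteq> 0" using x q0 by simp
  ultimately have "\<zeta> ^ \<mu> = 1" by (metis mult_cancel_right1)
  thus "\<kappa> \<in> angle_set \<mu>" using \<zeta> by (auto simp: angle_set_def)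
qed

end

lemma angle_set_unit:
  assumes "0 < \<mu>" "\<kappa> \<in> angle_set \<mu>" shows "0 \<le> \<kappa>" "\<kappa> \<le> 1"
proof -
  obtain \<zeta> :: complex where z: "\<zeta> ^ \<mu> = 1" "\<zeta>\<^sup>2 + 1 = (4 * \<kappa> - 2) * \<zeta>"
    using assms by (auto simp: angle_set_def)
  have "norm \<zeta> ^ \<mu> = 1" using z(1) by (metis norm_one norm_power)
  hence n: "norm \<zeta> = 1" using assms(1) power_eq_1_iff by (metis abs_norm_cancel real_norm_def neq0_conv)
  hence "\<zeta> * cnj \<zeta> = 1" by (simp add: complex_norm_square[symmetric])
  hence "cnj \<zeta> * (\<zeta>\<^sup>2 + 1) = \<zeta> + cnj \<zeta>" by (simp add: power2_eq_square algebra_simps)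
  moreover have "cnj \<zeta> * ((4 * \<kappa> - 2) * \<zeta>) = 4 * \<kappa> - 2"
    using \<open>\<zeta> * cnj \<zeta> = 1\<close> by (simp add: mult.left_commute mult.commute)
  ultimately have "\<zeta> + cnj \<zeta> = complex_of_real (4 * \<kappa> - 2)" using z(2) by simp
  hence "2 * Re \<zeta> = 4 * \<kappa> - 2" by (simp add: complex_eq_iff)
  moreover have "\<bar>Re \<zeta>\<bar> \<le> 1" using abs_Re_le_cmod[of \<zeta>] n by simp
  ultimately show "0 \<le> \<kappa>" "\<kappa> \<le> 1" by linarith+
qed

lemma finite_angle_set: assumes "0 < \<mu>" shows "finite (angle_set \<mu>)"
proof -
  have "angle_set \<mu> \<subseteq> (\<lambda>z. Re (((z\<^sup>2 + 1) / z + 2) / 4)) ` {z::complex. z ^ \<mu> = 1}"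
  proof
    fix \<kappa> assume "\<kappa> \<in> angle_set \<mu>"
    then obtain \<zeta> :: complex where z: "\<zeta> ^ \<mu> = 1" "\<zeta>\<^sup>2 + 1 = (4 * \<kappa> - 2) * \<zeta>"
      by (auto simp: angle_set_def)
    have "\<zeta> \<noteq> 0" using z(1) assms by (auto simp: power_0_left)
    hence "((\<zeta>\<^sup>2 + 1) / \<zeta> + 2) / 4 = complex_of_real \<kappa>" using z(2) by (simp add: field_simps)
    thus "\<kappa> \<in> (\<lambda>z. Re (((z\<^sup>2 + 1) / z + 2) / 4)) ` {z::complex. z ^ \<mu> = 1}"
      using z(1) by (intro image_eqI[of _ _ \<zeta>]) auto
  qed
  moreover have "finite {z::complex. z ^ \<mu> = 1}" using assms by (intro finite_roots_unity) simp
  ultimately show ?thesis using finite_surj by blast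
qed

text \<open>
  A common value determines \<open>\<zeta>\<close> up to inversion, so \<open>\<zeta>\<close> has order dividing the greatest common divisor 2.
\<close>

lemma angle_set_inter:
  assumes "gcd \<mu> \<nu> = 2" "\<mu> \<noteq> 0" "\<kappa> \<in> angle_set \<mu>" "\<kappa> \<in> angle_set \<nu>"
  shows "\<kappa> = 0 \<or> \<kappa> = 1"
proof -
  obtain z :: complex where z: "z ^ \<mu> = 1" "z\<^sup>2 + 1 = (4 * \<kappa> - 2) * z" using assms by (auto simp: angle_set_def)
  obtain w :: complex where w: "w ^ \<nu> = 1" "w\<^sup>2 + 1 = (4 * \<kappa> - 2) * w" using assms by (auto simp: angle_set_def)
  have "(w - z) * (w * z - 1) = z * (w\<^sup>2 + 1) - w * (z\<^sup>2 + 1)"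
    by (simp add: power2_eq_square algebra_simps)
  also have "\<dots> = 0" unfolding z(2) w(2) by (simp add: algebra_simps)
  finally have "w = z \<or> w * z = 1" by simp
  hence zn: "z ^ \<nu> = 1"
  proof
    assume "w * z = 1"
    hence "w ^ \<nu> * z ^ \<nu> = 1" by (metis power_mult_distrib power_one)
    thus ?thesis using w(1) by simp
  qed (use w in simp)
  obtain x y where xy: "\<mu> * x = \<nu> * y + 2" using bezout_nat[OF assms(2), of \<nu>] assms(1) by auto
  have "z ^ (\<mu> * x) = 1" using z(1) by (simp add: power_mult)
  hence "z ^ (\<nu> * y) * z\<^sup>2 = 1" unfolding xy by (simp only: power_add)
  hence z2: "z\<^sup>2 = 1" using zn by (simp add: power_mult)
  hence "z = 1 \<or> z = -1" by (simp add: power2_eq_1_iff)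
  thus ?thesis
  proof
    assume "z = 1"
    hence "complex_of_real (4 * \<kappa> - 2) = complex_of_real 2" using z(2) by simp
    hence "4 * \<kappa> - 2 = 2" by (simp only: of_real_eq_iff)
    thus ?thesis by simp
  next
    assume "z = -1"
    hence "complex_of_real (4 * \<kappa> - 2) = complex_of_real (-2)" using z(2) by (simp add: algebra_simps)
    hence "4 * \<kappa> - 2 = - 2" by (simp only: of_real_eq_iff)
    thus ?thesis by simp
  qed
qed

section \<open>Embeddings as reflection groups\<close>

lemma mat_eq_by_vectors:
  fixes A A' :: "real mat"
  assumes "A \<in> carrier_mat n n" "A' \<in> carrier_mat n n"
    and "\<And>x. x \<in> carrier_vec n \<Longrightarrow> A *\<^sub>v x = A' *\<^sub>v x"
  shows "A = A'"
proof (rule eq_matI)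
  fix i j assume ij: "i < dim_row A'" "j < dim_col A'"
  hence "(A *\<^sub>v unit_vec n j) $ i = (A' *\<^sub>v unit_vec n j) $ i" using assms(3)[of "unit_vec n j"] by simp
  thus "A $$ (i, j) = A' $$ (i, j)" using ij assms(1,2) by simp
qed (use assms in auto)

locale reflection_representation =
  bipartite_coxeter I m A B + nondegenerate_form n F
  for I m A B n F +
  fixes \<phi> :: "nat list set \<Rightarrow> real mat"
  assumes embedding: "reflection_embedding W S F \<phi>"
begin

abbreviation OG where "OG \<equiv> pseudo_orthogonal F"

lemma dim_F: "dim_row F = n" using form_carrier by simp

lemma group_O: "group OG" by (rule group_pseudo_orthogonal)

sublocale \<phi>: group_hom W OG \<phi>
  using embedding group_W group_O
  by (auto simp: group_hom_def group_hom_axioms_def reflection_embedding_def)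

declare \<phi>.hom_mult [simp del] \<phi>.hom_inv [simp del]

lemma inj_\<phi>: "inj_on \<phi> (carrier W)" using embedding by (simp add: reflection_embedding_def)

lemma O_carrier: "M \<in> carrier OG \<Longrightarrow> M \<in> carrier_mat n n"
  and O_isometry: "M \<in> carrier OG \<Longrightarrow> x \<in> V \<Longrightarrow> y \<in> V \<Longrightarrow> \<beta> (M *\<^sub>v x) (M *\<^sub>v y) = \<beta> x y"
  by (simp_all add: pseudo_orthogonal_def dim_F)

lemma O_one: "\<one>\<^bsub>OG\<^esub> = 1\<^sub>m n" and O_mult: "M \<otimes>\<^bsub>OG\<^esub> M' = M * M'"
  by (simp_all add: pseudo_orthogonal_def dim_F)

lemma \<phi>_mat: "g \<in> carrier W \<Longrightarrow> \<phi> g \<in> carrier_mat n n"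
  using O_carrier \<phi>.hom_closed by blast

lemma \<phi>_closed [simp]: "g \<in> carrier W \<Longrightarrow> x \<in> V \<Longrightarrow> \<phi> g *\<^sub>v x \<in> V"
  using \<phi>_mat by (meson mult_mat_vec_carrier)

lemma \<phi>_mult: "g \<in> carrier W \<Longrightarrow> h \<in> carrier W \<Longrightarrow> x \<in> V \<Longrightarrow>
    \<phi> (g \<star> h) *\<^sub>v x = \<phi> g *\<^sub>v (\<phi> h *\<^sub>v x)"
  using assoc_mult_mat_vec[OF \<phi>_mat[of g] \<phi>_mat[of h], of x] by (simp add: \<phi>.hom_mult O_mult)

lemma \<phi>_diff:
  assumes "g \<in> carrier W" "x \<in> V" "e \<in> V"
  shows "\<phi> g *\<^sub>v (x - c \<cdot>\<^sub>v e) = \<phi> g *\<^sub>v x - c \<cdot>\<^sub>v (\<phi> g *\<^sub>v e)"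
  using mult_minus_distrib_mat_vec[OF \<phi>_mat[OF assms(1)] assms(2), of "c \<cdot>\<^sub>v e"]
    mult_mat_vec[OF \<phi>_mat[OF assms(1)] assms(3), of c] assms(3) by simp

lemma \<phi>_one: "x \<in> V \<Longrightarrow> \<phi> \<one>\<^bsub>W\<^esub> *\<^sub>v x = x"
  using \<phi>.hom_one by (simp add: O_one)

lemma \<phi>_isometry: "g \<in> carrier W \<Longrightarrow> x \<in> V \<Longrightarrow> y \<in> V \<Longrightarrow> \<beta> (\<phi> g *\<^sub>v x) (\<phi> g *\<^sub>v y) = \<beta> x y"
  using O_isometry \<phi>.hom_closed by blast

lemma \<phi>_faithful:
  assumes "g \<in> carrier W" "h \<in> carrier W" "\<And>x. x \<in> V \<Longrightarrow> \<phi> g *\<^sub>v x = \<phi> h *\<^sub>v x"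
  shows "g = h"
proof -
  have "\<phi> g = \<phi> h" using mat_eq_by_vectors[OF \<phi>_mat[OF assms(1)] \<phi>_mat[OF assms(2)]] assms(3) by blast
  thus ?thesis using inj_\<phi> assms(1,2) by (auto dest: inj_onD)
qed

text \<open>
  The kernel of the parity homomorphism of the generator \<open>i\<close>.
\<close>

definition even_in :: "nat \<Rightarrow> nat list set set" where
  "even_in i = {cls u | u. u \<in> lists I \<and> even (count_list u i)}"

lemma even_in_carrier: "g \<in> even_in i \<Longrightarrow> g \<in> carrier W"
  unfolding even_in_def using cls_closed by blast

lemma gen_not_even_in: "gen i \<notin> even_in i"
proof
  assume "gen i \<in> even_in i"
  then obtain u where u: "gen i = cls u" "even (count_list u i)" unfolding even_in_def by blast
  hence "eqv [i] u" by (simp add: gen_def cls_eq)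
  thus False using eqv_parity[of "[i]" u i] u(2) by simp
qed

lemma even_in_mult: "g \<in> even_in i \<Longrightarrow> h \<in> even_in i \<Longrightarrow> g \<star> h \<in> even_in i"
proof -
  assume "g \<in> even_in i" "h \<in> even_in i"
  then obtain u v where "u \<in> lists I" "even (count_list u i)" "g = cls u"
    "v \<in> lists I" "even (count_list v i)" "h = cls v" unfolding even_in_def by blast
  thus ?thesis unfolding even_in_def
    by (intro CollectI exI[of _ "u @ v"]) (auto simp: W_mult)
qed

lemma even_in_inv: "g \<in> even_in i \<Longrightarrow> inv\<^bsub>W\<^esub> g \<in> even_in i"
proof -
  assume "g \<in> even_in i"
  then obtain u where "u \<in> lists I" "even (count_list u i)" "g = cls u" unfolding even_in_def by blast
  thus ?thesis unfolding even_in_def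
    by (intro CollectI exI[of _ "rev u"]) (auto simp: inv_cls in_lists_conv_set)
qed

lemma conj_even_in:
  assumes "g \<in> carrier W" "j \<in> I" "j \<noteq> i"
  shows "g \<star> gen j \<star> inv\<^bsub>W\<^esub> g \<in> even_in i"
proof -
  obtain u where u: "u \<in> lists I" "g = cls u" using assms(1) by (auto simp: W_carrier)
  have "g \<star> gen j \<star> inv\<^bsub>W\<^esub> g = cls (u @ [j] @ rev u)"
    using u by (simp add: inv_cls gen_def W_mult)
  moreover have "u @ [j] @ rev u \<in> lists I" using u(1) assms(2) by (auto simp: in_lists_conv_set)
  moreover have "even (count_list (u @ [j] @ rev u) i)" using assms(3) by simp
  ultimately show ?thesis unfolding even_in_def by blast
qed

text \<open>
  Otherwise all generators of the image come from the kernel of the parity homomorphism of \<open>i\<close>, which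
  does not contain the generator \<open>i\<close>.
\<close>

lemma conjugate_is_linear_reflection:
  assumes i: "i \<in> I"
  shows "\<exists>g\<in>carrier W. \<phi> (g \<star> gen i \<star> inv\<^bsub>W\<^esub> g) \<in> linear_reflections F"
proof (rule ccontr)
  assume none: "\<not> ?thesis"
  obtain R where R: "R \<subseteq> reflections W S" "\<phi> ` R \<subseteq> linear_reflections F"
    "generate OG (\<phi> ` R) = \<phi> ` carrier W"
    using embedding unfolding reflection_embedding_def by blast
  have RH: "R \<subseteq> even_in i"
  proof
    fix r assume r: "r \<in> R"
    then obtain g j where g: "g \<in> carrier W" "j \<in> I" "r = g \<star> gen j \<star> inv\<^bsub>W\<^esub> g"
      using R(1) unfolding reflections_def S_def by blast
    have "j \<noteq> i" using none g r R(2) by blast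
    thus "r \<in> even_in i" using conj_even_in g by blast
  qed
  have "h \<in> \<phi> ` even_in i" if "h \<in> generate OG (\<phi> ` R)" for h
    using that
  proof (induction rule: generate.induct)
    case one
    have "\<one>\<^bsub>W\<^esub> \<in> even_in i" unfolding even_in_def by (intro CollectI exI[of _ "[]"]) (simp add: W_one)
    then show ?case using \<phi>.hom_one by (metis image_eqI)
  next
    case (incl h)
    then show ?case using RH by blast
  next
    case (inv h)
    then obtain r where r: "r \<in> even_in i" "h = \<phi> r" using RH by blast
    hence "inv\<^bsub>OG\<^esub> h = \<phi> (inv\<^bsub>W\<^esub> r)" using \<phi>.hom_inv even_in_carrier by simp
    then show ?case using even_in_inv[OF r(1)] by blast
  next
    case (eng h1 h2)
    then obtain r1 r2 where r: "r1 \<in> even_in i" "h1 = \<phi> r1" "r2 \<in> even_in i" "h2 = \<phi> r2" by blast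
    hence "h1 \<otimes>\<^bsub>OG\<^esub> h2 = \<phi> (r1 \<star> r2)" using \<phi>.hom_mult even_in_carrier by simp
    then show ?case using even_in_mult[OF r(1,3)] by blast
  qed
  hence "\<phi> (gen i) \<in> \<phi> ` even_in i" using R(3) gen_closed[OF i] by blast
  then obtain g where g: "g \<in> even_in i" "\<phi> (gen i) = \<phi> g" by blast
  hence "gen i = g" using inj_\<phi> gen_closed[OF i] even_in_carrier by (meson inj_onD)
  thus False using g gen_not_even_in by blast
qed

text \<open>
  A conjugate of a linear reflection by an isometry is the reflection in the transported vector.
\<close>

lemma gen_is_reflection:
  assumes i: "i \<in> I"
  shows "\<exists>e\<in>V. \<beta> e e \<noteq> 0 \<and> (\<forall>x\<in>V. \<phi> (gen i) *\<^sub>v x = refl e x)"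
proof -
  obtain g where g: "g \<in> carrier W" "\<phi> (g \<star> gen i \<star> inv\<^bsub>W\<^esub> g) \<in> linear_reflections F"
    using conjugate_is_linear_reflection[OF i] by blast
  let ?r = "g \<star> gen i \<star> inv\<^bsub>W\<^esub> g"
  have ig: "inv\<^bsub>W\<^esub> g \<in> carrier W" "gen i \<in> carrier W" using g i by auto
  obtain e where e: "e \<in> V" "\<beta> e e \<noteq> 0" "\<And>x. x \<in> V \<Longrightarrow> \<phi> ?r *\<^sub>v x = refl e x"
    using g(2) unfolding linear_reflections_def refl_def dim_F by blast
  define e' where "e' = \<phi> (inv\<^bsub>W\<^esub> g) *\<^sub>v e"
  have e'V: "e' \<in> V" using ig e by (simp add: e'_def)
  have gi: "\<phi> (inv\<^bsub>W\<^esub> g) *\<^sub>v (\<phi> g *\<^sub>v x) = x" if "x \<in> V" for x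
    using \<phi>_mult[OF ig(1) g(1) that] g(1) \<phi>_one that by simp
  have "\<beta> e' e' = \<beta> e e" unfolding e'_def using \<phi>_isometry ig e by blast
  moreover have "\<phi> (gen i) *\<^sub>v x = refl e' x" if x: "x \<in> V" for x
  proof -
    have r: "?r \<in> carrier W" "?r \<star> g \<in> carrier W" using g(1) ig by auto
    have eq: "inv\<^bsub>W\<^esub> g \<star> (?r \<star> g) = gen i" using g(1) ig by (simp add: W.m_assoc)
    have "\<phi> (gen i) *\<^sub>v x = \<phi> (inv\<^bsub>W\<^esub> g \<star> (?r \<star> g)) *\<^sub>v x" by (simp only: eq)
    also have "\<dots> = \<phi> (inv\<^bsub>W\<^esub> g) *\<^sub>v (\<phi> (?r \<star> g) *\<^sub>v x)" by (rule \<phi>_mult[OF ig(1) r(2) x])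
    also have "\<phi> (?r \<star> g) *\<^sub>v x = \<phi> ?r *\<^sub>v (\<phi> g *\<^sub>v x)" by (rule \<phi>_mult[OF r(1) g(1) x])
    also have "\<phi> ?r *\<^sub>v (\<phi> g *\<^sub>v x) = refl e (\<phi> g *\<^sub>v x)" using e(3) g x by simp
    also have "\<phi> (inv\<^bsub>W\<^esub> g) *\<^sub>v refl e (\<phi> g *\<^sub>v x) =
        x - (2 * (\<beta> (\<phi> g *\<^sub>v x) e / \<beta> e e)) \<cdot>\<^sub>v e'"
      unfolding refl_def e'_def \<phi>_diff[OF ig(1) \<phi>_closed[OF g(1) x] e(1)] gi[OF x] ..
    also have "\<beta> (\<phi> g *\<^sub>v x) e = \<beta> x e'"
      using \<phi>_isometry[OF ig(1), of "\<phi> g *\<^sub>v x" e] gi[OF x] g x e by (simp add: e'_def)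
    finally show ?thesis using \<open>\<beta> e' e' = \<beta> e e\<close> by (simp add: refl_def)
  qed
  ultimately show ?thesis using e'V e(2) by (intro bexI[of _ e']) auto
qed

lemma gen_unit_vector:
  assumes i: "i \<in> I"
  shows "\<exists>e. e \<in> V \<and> \<bar>\<beta> e e\<bar> = 1 \<and> (\<forall>x\<in>V. \<phi> (gen i) *\<^sub>v x = refl e x)"
proof -
  obtain e where e: "e \<in> V" "\<beta> e e \<noteq> 0" "\<forall>x\<in>V. \<phi> (gen i) *\<^sub>v x = refl e x"
    using gen_is_reflection[OF i] by blast
  define c where "c = 1 / sqrt \<bar>\<beta> e e\<bar>"
  have "\<beta> (c \<cdot>\<^sub>v e) (c \<cdot>\<^sub>v e) = c\<^sup>2 * \<beta> e e" using e by (simp add: \<beta>_smult \<beta>_smult_right power2_eq_square)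
  also have "c\<^sup>2 = 1 / \<bar>\<beta> e e\<bar>" by (simp add: c_def power_divide)
  finally have "\<bar>\<beta> (c \<cdot>\<^sub>v e) (c \<cdot>\<^sub>v e)\<bar> = 1" using e by (simp add: abs_mult)
  moreover have "c \<noteq> 0" using e by (simp add: c_def)
  ultimately show ?thesis using e refl_scale by (intro exI[of _ "c \<cdot>\<^sub>v e"]) auto
qed

text \<open>
  A vector of the reflection, a root in the language of Coxeter groups.
\<close>

definition rt :: "nat \<Rightarrow> real vec" where
  "rt i = (SOME e. e \<in> V \<and> \<bar>\<beta> e e\<bar> = 1 \<and> (\<forall>x\<in>V. \<phi> (gen i) *\<^sub>v x = refl e x))"

lemma rt_props: "i \<in> I \<Longrightarrow> rt i \<in> V \<and> \<bar>\<beta> (rt i) (rt i)\<bar> = 1 \<and> (\<forall>x\<in>V. \<phi> (gen i) *\<^sub>v x = refl (rt i) x)"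
  unfolding rt_def by (rule someI_ex) (rule gen_unit_vector)

lemma rt_closed: "i \<in> I \<Longrightarrow> rt i \<in> V"
  and rt_norm: "i \<in> I \<Longrightarrow> \<bar>\<beta> (rt i) (rt i)\<bar> = 1"
  and rt_refl: "i \<in> I \<Longrightarrow> x \<in> V \<Longrightarrow> \<phi> (gen i) *\<^sub>v x = refl (rt i) x"
  using rt_props by blast+

lemma rt_nonisotropic: "i \<in> I \<Longrightarrow> \<beta> (rt i) (rt i) \<noteq> 0" using rt_norm by fastforce

lemma rt_distinct:
  assumes "i \<in> I" "j \<in> I" "i \<noteq> j" shows "\<exists>x\<in>V. refl (rt i) x \<noteq> refl (rt j) x"
proof (rule ccontr)
  assume "\<not> ?thesis"
  hence "gen i = gen j" using \<phi>_faithful[of "gen i" "gen j"] rt_refl assms by simp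
  thus False using gen_inj assms by blast
qed

lemma gen_mult_refl:
  "i \<in> I \<Longrightarrow> j \<in> I \<Longrightarrow> x \<in> V \<Longrightarrow> \<phi> (gen i \<star> gen j) *\<^sub>v x = refl (rt i) (refl (rt j) x)"
  using \<phi>_mult rt_refl rt_closed by simp

lemma rt_orthogonal:
  assumes "a \<in> A" "a' \<in> A" "a \<noteq> a'" shows "\<beta> (rt a) (rt a') = 0"
proof -
  have I: "a \<in> I" "a' \<in> I" using assms A_sub by auto
  show ?thesis
  proof (rule commuting_reflections)
    fix x assume x: "x \<in> V"
    show "refl (rt a) (refl (rt a') x) = refl (rt a') (refl (rt a) x)"
      using gen_mult_refl[OF I x] gen_mult_refl[OF I(2,1) x] A_commute[OF assms(1,2)] by simp
  qed (use rt_closed rt_nonisotropic rt_distinct I assms in auto)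
qed

lemma gen_noncommuting:
  assumes "i \<in> I" "j \<in> I" "i \<noteq> j" "8 \<le> m i j"
  shows "gen i \<star> gen j \<noteq> gen j \<star> gen i"
proof -
  define w where "w = cis (2 * pi / m i j)"
  have w: "w * cnj w = 1" by (simp add: w_def cis_cnj cis_mult)
  have w23: "w ^ 2 \<noteq> 1" "w ^ 3 \<noteq> 1"
    using cis_not_one[of 2 "m i j"] cis_not_one[of 3 "m i j"] assms(4) by (simp_all add: w_def)
  have f: "fold (dihedral i j) [i] = (\<lambda>z. 1 * cnj z)" "fold (dihedral i j) [j] = (\<lambda>z. w * cnj z)"
    using assms by (auto simp: dihedral_def w_def fun_eq_iff)
  have l: "[i] \<in> lists I" "[j] \<in> lists I" using assms by auto
  show ?thesis
    using plane_reflections(1)[OF action_dihedral[OF assms(1-3)] l(1) f(1) l(2) f(2)] w w23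
    by (simp add: gen_def)
qed

lemma gen_pow_refl:
  assumes "i \<in> I" "j \<in> I" "x \<in> V"
  shows "\<phi> ((gen i \<star> gen j) [^]\<^bsub>W\<^esub> \<mu>) *\<^sub>v x = ((refl (rt i) \<circ> refl (rt j)) ^^ \<mu>) x"
  using assms(3)
proof (induction \<mu> arbitrary: x)
  case 0
  then show ?case using \<phi>_one by simp
next
  case (Suc \<mu>)
  have c: "gen i \<star> gen j \<in> carrier W" using assms by simp
  have "\<phi> ((gen i \<star> gen j) [^]\<^bsub>W\<^esub> Suc \<mu>) *\<^sub>v x =
      \<phi> ((gen i \<star> gen j) [^]\<^bsub>W\<^esub> \<mu>) *\<^sub>v (\<phi> (gen i \<star> gen j) *\<^sub>v x)"
    using \<phi>_mult[of "(gen i \<star> gen j) [^]\<^bsub>W\<^esub> \<mu>" "gen i \<star> gen j" x] c Suc.prems by simp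
  also have "\<phi> (gen i \<star> gen j) *\<^sub>v x = (refl (rt i) \<circ> refl (rt j)) x"
    using gen_mult_refl[OF assms(1,2) Suc.prems] by simp
  also have "\<phi> ((gen i \<star> gen j) [^]\<^bsub>W\<^esub> \<mu>) *\<^sub>v \<dots> =
      ((refl (rt i) \<circ> refl (rt j)) ^^ \<mu>) ((refl (rt i) \<circ> refl (rt j)) x)"
    using Suc.prems rt_closed assms by (intro Suc.IH) simp
  also have "\<dots> = ((refl (rt i) \<circ> refl (rt j)) ^^ Suc \<mu>) x" by (simp only: funpow_Suc_right comp_apply)
  finally show ?case .
qed

text \<open>
  The squared inner product divided by the product of the norms lies in \<open>[0, 1]\<close>, and it is not 0 since
  the generators do not commute. So the two norms have the same sign.
\<close>

lemma rt_angle: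
  assumes "i \<in> I" "j \<in> I" "i \<noteq> j" "8 \<le> m i j"
  shows "\<beta> (rt i) (rt i) = \<beta> (rt j) (rt j)" "(\<beta> (rt i) (rt j))\<^sup>2 \<in> angle_set (m i j)"
    "(\<beta> (rt i) (rt j))\<^sup>2 \<noteq> 0" "(\<beta> (rt i) (rt j))\<^sup>2 \<noteq> 1"
proof -
  have c: "rt i \<in> V" "rt j \<in> V" "\<beta> (rt i) (rt i) \<noteq> 0" "\<beta> (rt j) (rt j) \<noteq> 0"
    using assms rt_closed rt_nonisotropic by auto
  have ne: "\<beta> (rt i) (rt j) \<noteq> 0"
  proof
    assume o: "\<beta> (rt i) (rt j) = 0"
    have "gen i \<star> gen j = gen j \<star> gen i"
      by (rule \<phi>_faithful)
        (use assms gen_mult_refl orthogonal_reflections_commute[OF c(1,2) o] in auto)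
    thus False using gen_noncommuting assms by blast
  qed
  let ?\<kappa> = "(\<beta> (rt i) (rt j))\<^sup>2 / (\<beta> (rt i) (rt i) * \<beta> (rt j) (rt j))"
  have fin: "((refl (rt i) \<circ> refl (rt j)) ^^ m i j) x = x" if "x \<in> V" for x
    using gen_pow_refl[OF assms(1,2) that, of "m i j"] gen_order[OF assms(1-3)] \<phi>_one[OF that] by simp
  have m0: "0 < m i j" using assms by simp
  have k: "?\<kappa> \<noteq> 1" "?\<kappa> \<in> angle_set (m i j)"
    using product_finite_order[OF c(1,3,2,4) rt_distinct[OF assms(1-3)] m0 fin ne] by auto
  have "0 \<le> ?\<kappa>" using angle_set_unit(1)[OF m0 k(2)] .
  moreover have "?\<kappa> \<noteq> 0" using ne c by simp
  ultimately have "0 < ?\<kappa>" by linarith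
  hence pos: "0 < \<beta> (rt i) (rt i) * \<beta> (rt j) (rt j)" using ne by (simp add: zero_less_divide_iff)
  have n: "\<bar>\<beta> (rt i) (rt i)\<bar> = 1" "\<bar>\<beta> (rt j) (rt j)\<bar> = 1" using rt_norm assms by auto
  show eq: "\<beta> (rt i) (rt i) = \<beta> (rt j) (rt j)"
    using pos n by (auto simp: abs_if zero_less_mult_iff split: if_splits)
  have "\<beta> (rt i) (rt i) * \<beta> (rt j) (rt j) = 1" using pos n by (metis abs_mult abs_of_pos mult_1)
  hence "?\<kappa> = (\<beta> (rt i) (rt j))\<^sup>2" by simp
  thus "(\<beta> (rt i) (rt j))\<^sup>2 \<in> angle_set (m i j)" "(\<beta> (rt i) (rt j))\<^sup>2 \<noteq> 1" using k by auto
  show "(\<beta> (rt i) (rt j))\<^sup>2 \<noteq> 0" using ne by simp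
qed

end

text \<open>
  In the coordinates of a diagonalizing basis the form is a sum of squares with coefficients. None of
  them vanishes, because the two inertia indices add up to the dimension.
\<close>

lemma symmetric_form_coordinates:
  assumes F: "symmetric_form p q F"
  obtains D :: "nat \<Rightarrow> real" and crd :: "real vec \<Rightarrow> nat \<Rightarrow> real" where
    "card {l. l < p + q \<and> D l < 0} = q"
    "\<And>x y. x \<in> carrier_vec (p + q) \<Longrightarrow> y \<in> carrier_vec (p + q) \<Longrightarrow>
        bform F x y = (\<Sum>l<p + q. D l * crd x l * crd y l)"
    "nondegenerate_form (p + q) F"
proof -
  let ?n = "p + q"
  obtain P where FP: "F \<in> carrier_mat ?n ?n" "transpose_mat F = F" "P \<in> carrier_mat ?n ?n" "invertible_mat P"
    "diagonal_mat (transpose_mat P * F * P)"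
    "card {i. i < ?n \<and> (transpose_mat P * F * P) $$ (i, i) > 0} = p"
    "card {i. i < ?n \<and> (transpose_mat P * F * P) $$ (i, i) < 0} = q"
    using F unfolding symmetric_form_def Let_def by blast
  obtain P' where P': "P * P' = 1\<^sub>m ?n" "P' * P = 1\<^sub>m ?n" "P' \<in> carrier_mat ?n ?n"
  proof -
    from FP(4) obtain C where C: "P * C = 1\<^sub>m (dim_row P)" "C * P = 1\<^sub>m (dim_row C)"
      by (auto simp: invertible_mat_def inverts_mat_def)
    have "dim_col C = ?n" using arg_cong[OF C(1), of dim_col] FP(3) by simp
    moreover have "dim_row C = ?n" using arg_cong[OF C(2), of dim_col] FP(3) by simp
    ultimately show thesis using that C FP(3) by auto
  qed
  define D where "D = (\<lambda>l. (transpose_mat P * F * P) $$ (l, l))"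
  define crd where "crd = (\<lambda>x l. (P' *\<^sub>v x) $ l)"
  define M where "M = transpose_mat P * F * P"
  have M: "M \<in> carrier_mat ?n ?n" using FP by (simp add: M_def)
  have PP: "P *\<^sub>v (P' *\<^sub>v x) = x" "P' *\<^sub>v (P *\<^sub>v x) = x" if "x \<in> carrier_vec ?n" for x
    using that P' FP(3) by (metis assoc_mult_mat_vec one_mult_mat_vec)+
  have Mv: "(M *\<^sub>v w) $ l = D l * w $ l" if w: "w \<in> carrier_vec ?n" and l: "l < ?n" for w l
  proof -
    have "(M *\<^sub>v w) $ l = (\<Sum>i\<in>{0..<?n}. M $$ (l, i) * w $ i)"
      using M w l by (simp add: scalar_prod_def)
    also have "\<dots> = (\<Sum>i\<in>{0..<?n}. if i = l then D l * w $ l else 0)"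
    proof (intro sum.cong refl)
      fix i assume "i \<in> {0..<?n}"
      thus "M $$ (l, i) * w $ i = (if i = l then D l * w $ l else 0)"
        using FP(5)[folded M_def] M l unfolding diagonal_mat_def D_def M_def[symmetric] by auto
    qed
    also have "\<dots> = D l * w $ l" using l by simp
    finally show ?thesis .
  qed
  have form: "bform F x y = (\<Sum>l<?n. D l * crd x l * crd y l)"
    if xy: "x \<in> carrier_vec ?n" "y \<in> carrier_vec ?n" for x y
  proof -
    let ?u = "P' *\<^sub>v x" and ?w = "P' *\<^sub>v y"
    have u: "?u \<in> carrier_vec ?n" "?w \<in> carrier_vec ?n" using P'(3) xy by auto
    have FPw: "F *\<^sub>v (P *\<^sub>v ?w) \<in> carrier_vec ?n" using FP u by simp
    have "bform F x y = (P *\<^sub>v ?u) \<bullet> (F *\<^sub>v (P *\<^sub>v ?w))" using PP xy by (simp add: bform_def)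
    also have "\<dots> = (F *\<^sub>v (P *\<^sub>v ?w)) \<bullet> (P *\<^sub>v ?u)" using comm_scalar_prod FPw FP(3) u by (metis mult_mat_vec_carrier)
    also have "\<dots> = (transpose_mat P *\<^sub>v (F *\<^sub>v (P *\<^sub>v ?w))) \<bullet> ?u"
      using transpose_vec_mult_scalar[OF FP(3) u(1) FPw] by simp
    also have "transpose_mat P *\<^sub>v (F *\<^sub>v (P *\<^sub>v ?w)) = M *\<^sub>v ?w"
      unfolding M_def using FP(1,3) u(2) by (simp add: assoc_mult_mat_vec[of _ ?n ?n _ ?n])
    also have "(M *\<^sub>v ?w) \<bullet> ?u = (\<Sum>l\<in>{0..<?n}. (M *\<^sub>v ?w) $ l * ?u $ l)"
      using u(1) P'(3) by (simp add: scalar_prod_def)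
    also have "\<dots> = (\<Sum>l<?n. D l * crd x l * crd y l)"
      using Mv[OF u(2)] by (intro sum.cong) (auto simp: crd_def)
    finally show ?thesis .
  qed
  have D0: "D l \<noteq> 0" if "l < ?n" for l
  proof -
    let ?A = "{i. i < ?n \<and> D i > 0}" and ?B = "{i. i < ?n \<and> D i < 0}"
    have "card (?A \<union> ?B) = p + q" using FP(6,7) by (subst card_Un_disjoint) (auto simp: D_def)
    hence eq: "?A \<union> ?B = {..<?n}" by (intro card_subset_eq) auto
    have "l \<in> ?A \<union> ?B" unfolding eq using that by simp
    thus ?thesis by auto
  qed
  have "nondegenerate_form ?n F"
  proof
    fix x assume x: "x \<in> carrier_vec ?n" and z: "\<And>y. y \<in> carrier_vec ?n \<Longrightarrow> bform F x y = 0"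
    have "P' *\<^sub>v x = 0\<^sub>v ?n"
    proof (rule eq_vecI)
      fix l assume "l < dim_vec (0\<^sub>v ?n)"
      hence l: "l < ?n" by simp
      let ?y = "P *\<^sub>v unit_vec ?n l"
      have y: "?y \<in> carrier_vec ?n" using FP(3) by simp
      have "crd ?y i = (if i = l then 1 else 0)" if "i < ?n" for i
        using PP(2)[of "unit_vec ?n l"] that l by (simp add: crd_def)
      hence "bform F x ?y = (\<Sum>i<?n. if i = l then D l * crd x l else 0)"
        unfolding form[OF x y] by (intro sum.cong) auto
      hence "D l * crd x l = 0" using z[OF y] l by simp
      thus "(P' *\<^sub>v x) $ l = 0\<^sub>v ?n $ l" using D0[OF l] l by (simp add: crd_def)
    qed (use P'(3) in simp)
    hence "x = P *\<^sub>v 0\<^sub>v ?n" using PP(1)[OF x] by simp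
    also have "\<dots> = 0\<^sub>v ?n" using FP(3) by (intro eq_vecI) auto
    finally show "x = 0\<^sub>v ?n" .
  qed (use FP in auto)
  thus thesis using that[of D crd] FP(7) form by (simp add: D_def del: index_mult_mat)
qed

section \<open>Counting negative squares\<close>

text \<open>
  Gaussian elimination of one equation and one unknown at a time.
\<close>

lemma homogeneous_system:
  fixes w :: "'j \<Rightarrow> 'i \<Rightarrow> real"
  assumes "finite S" "finite J" "card S < card J"
  shows "\<exists>v. (\<exists>j\<in>J. v j \<noteq> 0) \<and> (\<forall>i\<in>S. (\<Sum>j\<in>J. v j * w j i) = 0)"
  using assms
proof (induction S arbitrary: J w rule: finite_induct)
  case empty
  then obtain j where "j \<in> J" by fastforce
  then show ?case by (intro exI[of _ "\<lambda>_. 1"]) auto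
next
  case (insert i0 S)
  show ?case
  proof (cases "\<forall>j\<in>J. w j i0 = 0")
    case True
    have "card S < card J" using insert by simp
    then obtain v where "\<exists>j\<in>J. v j \<noteq> 0" "\<forall>i\<in>S. (\<Sum>j\<in>J. v j * w j i) = 0"
      using insert.IH[OF insert.prems(1)] by blast
    thus ?thesis using True by (intro exI[of _ v]) auto
  next
    case False
    then obtain j0 where j0: "j0 \<in> J" "w j0 i0 \<noteq> 0" by blast
    let ?J = "J - {j0}"
    (* eliminate the unknown j0 with the equation i0 *)
    define w' where "w' = (\<lambda>j i. w j i - w j i0 / w j0 i0 * w j0 i)"
    have "card S < card ?J" "finite ?J" using insert j0 by auto
    then obtain v where v: "\<exists>j\<in>?J. v j \<noteq> 0" "\<forall>i\<in>S. (\<Sum>j\<in>?J. v j * w' j i) = 0"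
      using insert.IH[of ?J w'] by blast
    define c where "c = - (\<Sum>j\<in>?J. v j * (w j i0 / w j0 i0))"
    define v' where "v' = v(j0 := c)"
    have sum: "(\<Sum>j\<in>J. v' j * w j i) = (\<Sum>j\<in>?J. v j * w' j i)" for i
    proof -
      have "(\<Sum>j\<in>J. v' j * w j i) = c * w j0 i + (\<Sum>j\<in>?J. v j * w j i)"
        unfolding sum.remove[OF insert.prems(1) j0(1)] v'_def by (simp cong: sum.cong_simp)
      also have "c * w j0 i = - (\<Sum>j\<in>?J. v j * (w j i0 / w j0 i0 * w j0 i))"
        unfolding c_def by (simp add: sum_distrib_right mult.assoc)
      also have "- (\<Sum>j\<in>?J. v j * (w j i0 / w j0 i0 * w j0 i)) + (\<Sum>j\<in>?J. v j * w j i) =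
          (\<Sum>j\<in>?J. v j * w' j i)"
        unfolding w'_def by (simp add: right_diff_distrib sum_subtractf)
      finally show ?thesis .
    qed
    have "(\<Sum>j\<in>J. v' j * w j i0) = 0" unfolding sum using j0 by (simp add: w'_def)
    moreover have "\<exists>j\<in>J. v' j \<noteq> 0" using v(1) by (auto simp: v'_def)
    ultimately show ?thesis using v(2) sum by (intro exI[of _ v']) auto
  qed
qed

text \<open>
  With fewer negative squares than vectors, some nontrivial combination of the vectors has zero
  coordinates at all of them.
\<close>

lemma negative_index_bound:
  fixes D :: "nat \<Rightarrow> real" and w :: "'j \<Rightarrow> nat \<Rightarrow> real"
  assumes J: "finite J" and neg: "\<And>v. \<exists>j\<in>J. v j \<noteq> 0 \<Longrightarrow> (\<Sum>i<n. D i * (\<Sum>j\<in>J. v j * w j i)\<^sup>2) < 0"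
  shows "card J \<le> card {i. i < n \<and> D i < 0}"
proof (rule ccontr)
  assume "\<not> ?thesis"
  hence "card {i. i < n \<and> D i < 0} < card J" by simp
  then obtain v where v: "\<exists>j\<in>J. v j \<noteq> 0" "\<forall>i\<in>{i. i < n \<and> D i < 0}. (\<Sum>j\<in>J. v j * w j i) = 0"
    using homogeneous_system[of "{i. i < n \<and> D i < 0}" J w] J by auto
  have "0 \<le> (\<Sum>i<n. D i * (\<Sum>j\<in>J. v j * w j i)\<^sup>2)"
  proof (rule sum_nonneg)
    fix i assume "i \<in> {..<n}"
    thus "0 \<le> D i * (\<Sum>j\<in>J. v j * w j i)\<^sup>2" using v(2) by (cases "D i < 0") auto
  qed
  thus False using neg[OF v(1)] by simp
qed

definition bil :: "nat \<Rightarrow> (nat \<Rightarrow> real) \<Rightarrow> (nat \<Rightarrow> real) \<Rightarrow> (nat \<Rightarrow> real) \<Rightarrow> real" where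
  "bil n D f g = (\<Sum>i<n. D i * f i * g i)"

lemma bil_sum_left: "bil n D (\<lambda>i. \<Sum>j\<in>J. v j * f j i) g = (\<Sum>j\<in>J. v j * bil n D (f j) g)"
proof -
  have "bil n D (\<lambda>i. \<Sum>j\<in>J. v j * f j i) g = (\<Sum>i<n. \<Sum>j\<in>J. v j * (D i * f j i * g i))"
    unfolding bil_def by (simp add: sum_distrib_left sum_distrib_right mult_ac)
  also have "\<dots> = (\<Sum>j\<in>J. \<Sum>i<n. v j * (D i * f j i * g i))" by (rule sum.swap)
  finally show ?thesis unfolding bil_def by (simp add: sum_distrib_left)
qed

lemma bil_commute: "bil n D f g = bil n D g f" unfolding bil_def by (simp add: mult_ac)

lemma bil_diff_left: "bil n D (\<lambda>i. f i - f' i) g = bil n D f g - bil n D f' g"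
  unfolding bil_def by (simp add: algebra_simps sum_subtractf)

text \<open>
  Bessel's identity for the orthogonal complement of an orthonormal family.
\<close>

lemma bil_projection:
  assumes A: "finite A" and on: "\<And>a a'. a \<in> A \<Longrightarrow> a' \<in> A \<Longrightarrow> bil n D (c a) (c a') = (if a = a' then 1 else 0)"
  defines "S \<equiv> \<lambda>y a. bil n D y (c a)"
  shows "bil n D (\<lambda>i. y i - (\<Sum>a\<in>A. S y a * c a i)) (\<lambda>i. y i - (\<Sum>a\<in>A. S y a * c a i)) =
    bil n D y y - (\<Sum>a\<in>A. (S y a)\<^sup>2)"
proof -
  let ?z = "\<lambda>i. \<Sum>a\<in>A. S y a * c a i"
  have zc: "bil n D ?z (c a') = S y a'" if "a' \<in> A" for a'
  proof -
    have "bil n D ?z (c a') = (\<Sum>a\<in>A. S y a * (if a = a' then 1 else 0))"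
      unfolding bil_sum_left using on that by (intro sum.cong) auto
    thus ?thesis using A that by (simp add: if_distrib cong: if_cong)
  qed
  have zy: "bil n D ?z y = (\<Sum>a\<in>A. (S y a)\<^sup>2)"
    unfolding bil_sum_left by (simp add: S_def bil_commute[of n D "c _" y] power2_eq_square)
  have zz: "bil n D ?z ?z = (\<Sum>a\<in>A. (S y a)\<^sup>2)"
  proof -
    have "bil n D ?z ?z = (\<Sum>a\<in>A. S y a * bil n D (c a) ?z)" by (rule bil_sum_left)
    also have "\<dots> = (\<Sum>a\<in>A. (S y a)\<^sup>2)"
      by (intro sum.cong) (simp_all add: bil_commute[of n D "c _" ?z] zc power2_eq_square)
    finally show ?thesis .
  qed
  let ?w = "\<lambda>i. y i - ?z i"
  have "bil n D ?w ?w = bil n D y ?w - bil n D ?z ?w" by (rule bil_diff_left)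
  also have "bil n D y ?w = bil n D y y - bil n D ?z y"
    unfolding bil_commute[of n D y ?w] by (rule bil_diff_left)
  also have "bil n D ?z ?w = bil n D ?z y - bil n D ?z ?z"
    unfolding bil_commute[of n D ?z ?w] bil_diff_left bil_commute[of n D y ?z] ..
  finally show ?thesis using zy zz by simp
qed

lemma gram_upper_bound:
  fixes G :: "'j \<Rightarrow> 'j \<Rightarrow> real" and v :: "'j \<Rightarrow> real"
  assumes "finite J" "\<And>i j. i \<in> J \<Longrightarrow> j \<in> J \<Longrightarrow> \<bar>G i j\<bar> \<le> 1"
  shows "(\<Sum>i\<in>J. \<Sum>j\<in>J. v i * v j * G i j) \<le> card J * (\<Sum>i\<in>J. (v i)\<^sup>2)"
proof -
  have "v i * v j * G i j \<le> (v i)\<^sup>2 / 2 + (v j)\<^sup>2 / 2" if "i \<in> J" "j \<in> J" for i j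
  proof -
    have "v i * v j * G i j \<le> \<bar>v i * v j\<bar> * \<bar>G i j\<bar>" by (metis abs_ge_self abs_mult)
    also have "\<dots> \<le> \<bar>v i * v j\<bar>" using mult_left_mono[OF assms(2)[OF that], of "\<bar>v i * v j\<bar>"] by simp
    also have "\<dots> \<le> (v i)\<^sup>2 / 2 + (v j)\<^sup>2 / 2"
    proof -
      have "0 \<le> (\<bar>v i\<bar> - \<bar>v j\<bar>)\<^sup>2" by simp
      thus ?thesis by (simp add: power2_diff abs_mult)
    qed
    finally show ?thesis .
  qed
  hence "(\<Sum>i\<in>J. \<Sum>j\<in>J. v i * v j * G i j) \<le> (\<Sum>i\<in>J. \<Sum>j\<in>J. (v i)\<^sup>2 / 2 + (v j)\<^sup>2 / 2)"
    by (intro sum_mono) auto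
  also have "\<dots> = card J * (\<Sum>i\<in>J. (v i)\<^sup>2)"
    by (simp add: sum.distrib sum_distrib_left[symmetric] sum_divide_distrib[symmetric])
  finally show ?thesis .
qed

text \<open>
  Pigeonhole principle for rows with entries in a finite set.
\<close>

lemma agreeing_pair:
  fixes Vals :: "real set" and R :: "nat \<Rightarrow> nat \<Rightarrow> real"
  assumes "finite Vals" "L > card Vals ^ card J" "finite J"
    and "\<And>l j. l < L \<Longrightarrow> j \<in> J \<Longrightarrow> R l j \<in> Vals"
  shows "\<exists>l l'. l < L \<and> l' < L \<and> l \<noteq> l' \<and> (\<forall>j\<in>J. R l j = R l' j)"
proof -
  let ?f = "\<lambda>l. restrict (R l) J"
  have "?f ` {..<L} \<subseteq> J \<rightarrow>\<^sub>E Vals" using assms(4) by auto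
  hence "card (?f ` {..<L}) \<le> card (J \<rightarrow>\<^sub>E Vals)" using assms by (intro card_mono finite_PiE) auto
  also have "\<dots> < card {..<L}" using assms by (simp add: card_PiE)
  finally have "\<not> inj_on ?f {..<L}" by (metis card_image less_irrefl)
  then obtain l l' where l: "l < L" "l' < L" "l \<noteq> l'" "?f l = ?f l'" by (auto simp: inj_on_def)
  hence "\<forall>j\<in>J. R l j = R l' j" by (metis restrict_apply')
  thus ?thesis using l by blast
qed

text \<open>
  Two rows that differ in the column \<open>j0\<close> only: the difference of their products with \<open>v\<close> isolates the
  coordinate \<open>v j0\<close>.
\<close>

lemma row_pair_bound:
  fixes s s' v :: "'j \<Rightarrow> real"
  assumes J: "finite J" "j0 \<in> J" and eq: "\<And>j. j \<in> J \<Longrightarrow> j \<noteq> j0 \<Longrightarrow> s j = s' j"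
    and \<delta>: "\<delta> \<le> \<bar>s j0 - s' j0\<bar>" "0 \<le> \<delta>"
  shows "(v j0)\<^sup>2 * \<delta>\<^sup>2 / 2 \<le> (\<Sum>j\<in>J. v j * s j)\<^sup>2 + (\<Sum>j\<in>J. v j * s' j)\<^sup>2"
proof -
  let ?S = "\<Sum>j\<in>J. v j * s j" and ?S' = "\<Sum>j\<in>J. v j * s' j"
  have "?S - ?S' = (\<Sum>j\<in>J. v j * (s j - s' j))" by (simp add: sum_subtractf right_diff_distrib)
  also have "\<dots> = v j0 * (s j0 - s' j0)"
    unfolding sum.remove[OF J] using eq by simp
  finally have d: "?S - ?S' = v j0 * (s j0 - s' j0)" .
  have "\<delta>\<^sup>2 \<le> (s j0 - s' j0)\<^sup>2" using \<delta> by (metis abs_le_square_iff abs_of_nonneg)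
  hence "(v j0)\<^sup>2 * \<delta>\<^sup>2 \<le> (?S - ?S')\<^sup>2" unfolding d power_mult_distrib by (simp add: mult_left_mono)
  also have "\<dots> \<le> 2 * (?S\<^sup>2 + ?S'\<^sup>2)"
  proof -
    have "0 \<le> (?S + ?S')\<^sup>2" by simp
    thus ?thesis by (simp add: power2_sum power2_diff)
  qed
  finally show ?thesis by simp
qed

lemma sum_two_le:
  fixes f :: "'a \<Rightarrow> real"
  assumes "finite I" "i \<in> I" "j \<in> I" "i \<noteq> j" "\<And>x. x \<in> I \<Longrightarrow> 0 \<le> f x"
  shows "f i + f j \<le> sum f I"
proof -
  have "sum f {i, j} \<le> sum f I" using assms by (intro sum_mono2) auto
  thus ?thesis using assms by simp
qed

text \<open>
  \<open>R j0 l c\<close> is the row of the \<open>c\<close>-th copy of variant \<open>l\<close> for the column \<open>j0\<close>. For each \<open>j0\<close> and \<open>c\<close>, two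
  of the variants agree outside \<open>j0\<close> and bound the coordinate \<open>v j0\<close>.
\<close>

lemma gram_lower_bound:
  fixes R :: "nat \<Rightarrow> nat \<Rightarrow> nat \<Rightarrow> nat \<Rightarrow> real" and v :: "nat \<Rightarrow> real"
  assumes Vals: "finite Vals" "L > card Vals ^ (k - 1)"
    and R: "\<And>j0 l c j. j0 < k \<Longrightarrow> l < L \<Longrightarrow> c < t \<Longrightarrow> j < k \<Longrightarrow> j \<noteq> j0 \<Longrightarrow> R j0 l c j \<in> Vals"
    and \<delta>: "0 \<le> \<delta>" "\<And>j0 l l' c. j0 < k \<Longrightarrow> l < L \<Longrightarrow> l' < L \<Longrightarrow> l \<noteq> l' \<Longrightarrow> c < t \<Longrightarrow>
        \<delta> \<le> \<bar>R j0 l c j0 - R j0 l' c j0\<bar>"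
  shows "t * (\<delta>\<^sup>2 / 2) * (\<Sum>j<k. (v j)\<^sup>2) \<le>
    (\<Sum>j0<k. \<Sum>l<L. \<Sum>c<t. (\<Sum>j<k. v j * R j0 l c j)\<^sup>2)"
proof -
  have "(v j0)\<^sup>2 * \<delta>\<^sup>2 / 2 \<le> (\<Sum>l<L. (\<Sum>j<k. v j * R j0 l c j)\<^sup>2)" if j0: "j0 < k" and c: "c < t" for j0 c
  proof -
    let ?J = "{..<k} - {j0}"
    have "card ?J = k - 1" using j0 by simp
    hence "L > card Vals ^ card ?J" using Vals(2) by simp
    moreover have "R j0 l c j \<in> Vals" if "l < L" "j \<in> ?J" for l j using R[OF j0 that(1) c] that(2) by auto
    ultimately obtain l l' where l: "l < L" "l' < L" "l \<noteq> l'" "\<forall>j\<in>?J. R j0 l c j = R j0 l' c j"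
      using agreeing_pair[OF Vals(1), where J = ?J and L = L and R = "\<lambda>l. R j0 l c"] by auto
    have "(v j0)\<^sup>2 * \<delta>\<^sup>2 / 2 \<le> (\<Sum>j<k. v j * R j0 l c j)\<^sup>2 + (\<Sum>j<k. v j * R j0 l' c j)\<^sup>2"
      using j0 l c \<delta> by (intro row_pair_bound) auto
    also have "\<dots> \<le> (\<Sum>l<L. (\<Sum>j<k. v j * R j0 l c j)\<^sup>2)" using l by (intro sum_two_le) auto
    finally show ?thesis .
  qed
  hence "(\<Sum>j0<k. \<Sum>c<t. (v j0)\<^sup>2 * \<delta>\<^sup>2 / 2) \<le> (\<Sum>j0<k. \<Sum>c<t. \<Sum>l<L. (\<Sum>j<k. v j * R j0 l c j)\<^sup>2)"
    by (intro sum_mono) auto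
  moreover have "(\<Sum>j0<k. \<Sum>c<t. (v j0)\<^sup>2 * \<delta>\<^sup>2 / 2) = t * (\<delta>\<^sup>2 / 2) * (\<Sum>j<k. (v j)\<^sup>2)"
    by (simp add: sum_distrib_left sum_distrib_right mult_ac)
  moreover have "(\<Sum>c<t. \<Sum>l<L. (\<Sum>j<k. v j * R j0 l c j)\<^sup>2) = (\<Sum>l<L. \<Sum>c<t. (\<Sum>j<k. v j * R j0 l c j)\<^sup>2)" for j0
    by (rule sum.swap)
  ultimately show ?thesis by simp
qed

section \<open>The labels and the theorem\<close>

text \<open>
  The element of \<open>A\<close> for column \<open>j0\<close>, variant \<open>l\<close> and copy \<open>c\<close>; the numbers below \<open>k\<close> are the elements
  of \<open>B\<close>.
\<close>

definition row_index :: "nat \<Rightarrow> nat \<Rightarrow> nat \<Rightarrow> nat \<Rightarrow> nat" where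
  "row_index k j0 l c = k + prod_encode (j0, prod_encode (l, c))"

definition rows :: "nat \<Rightarrow> nat \<Rightarrow> nat \<Rightarrow> nat set" where
  "rows k L t = {row_index k j0 l c | j0 l c. j0 < k \<and> l < L \<and> c < t}"

definition row_label :: "nat \<Rightarrow> (nat \<Rightarrow> nat) \<Rightarrow> nat \<Rightarrow> nat \<Rightarrow> nat" where
  "row_label k P a j = (case prod_decode (a - k) of (j0, x) \<Rightarrow> if j = j0 then 2 * P (fst (prod_decode x)) else 8)"

definition labels :: "nat \<Rightarrow> (nat \<Rightarrow> nat) \<Rightarrow> nat \<Rightarrow> nat \<Rightarrow> nat" where
  "labels k P i j =
    (if i < k then if j < k then 8 else row_label k P j i
     else if j < k then row_label k P i j else 2)"

lemma row_index_inj: "row_index k j0 l c = row_index k j0' l' c' \<longleftrightarrow> j0 = j0' \<and> l = l' \<and> c = c'"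
  by (auto simp: row_index_def)

lemma labels_row: "j < k \<Longrightarrow> labels k P (row_index k j0 l c) j = (if j = j0 then 2 * P l else 8)"
  by (simp add: labels_def row_label_def row_index_def)

lemma labels_sym: "labels k P i j = labels k P j i"
  by (simp add: labels_def)

lemma row_label_even: "even (row_label k P a j)"
  by (simp add: row_label_def split: prod.split)

lemma finite_rows: "finite (rows k L t)"
proof -
  have "rows k L t \<subseteq> (\<lambda>(j0, l, c). row_index k j0 l c) ` ({..<k} \<times> {..<L} \<times> {..<t})"
    unfolding rows_def by force
  thus ?thesis using finite_subset by blast
qed

lemma sum_rows: "(\<Sum>a\<in>rows k L t. f a) = (\<Sum>j0<k. \<Sum>l<L. \<Sum>c<t. f (row_index k j0 l c))"
proof -
  let ?g = "\<lambda>(j0, l, c). row_index k j0 l c"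
  have "rows k L t = ?g ` ({..<k} \<times> {..<L} \<times> {..<t})" unfolding rows_def by force
  moreover have "inj_on ?g ({..<k} \<times> {..<L} \<times> {..<t})" by (auto simp: inj_on_def row_index_inj)
  ultimately have "(\<Sum>a\<in>rows k L t. f a) = (\<Sum>x\<in>{..<k} \<times> {..<L} \<times> {..<t}. f (?g x))"
    by (simp add: sum.reindex)
  thus ?thesis by (simp add: sum.cartesian_product case_prod_unfold)
qed

lemma bipartite_labels:
  assumes P: "\<And>l. 4 \<le> P l"
  shows "bipartite_coxeter ({..<k} \<union> rows k L t) (labels k P) (rows k L t) {..<k}"
proof
  have ge: "k \<le> a" if "a \<in> rows k L t" for a using that by (auto simp: rows_def row_index_def)
  have lab: "8 \<le> row_label k P a j" for a j
    by (simp add: row_label_def P split: prod.split)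
  show "finite ({..<k} \<union> rows k L t)" using finite_rows by simp
  show "labels k P i j = labels k P j i" for i j by (rule labels_sym)
  show "even (labels k P i j)" for i j by (simp add: labels_def row_label_even)
  show "2 \<le> labels k P i j" for i j
    using lab[of i j] lab[of j i] by (auto simp: labels_def)
  show "rows k L t \<inter> {..<k} = {}" using ge by fastforce
  show "labels k P a a' = 2" if "a \<in> rows k L t" "a' \<in> rows k L t" for a a'
    using ge[OF that(1)] ge[OF that(2)] by (simp add: labels_def)
  show "8 \<le> labels k P a b" if "a \<in> rows k L t" "b \<in> {..<k}" for a b
    using ge[OF that(1)] that(2) lab by (simp add: labels_def)
  show "8 \<le> labels k P b b'" if "b \<in> {..<k}" "b' \<in> {..<k}" for b b'
    using that by (simp add: labels_def)
qed auto

text \<open>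
  The possible inner products of two unit vectors whose reflections have a product of order dividing
  \<open>\<mu>\<close>, apart from orthogonal and parallel vectors.
\<close>

definition cosines :: "nat \<Rightarrow> real set" where
  "cosines \<mu> = {x. x\<^sup>2 \<in> angle_set \<mu> \<and> x\<^sup>2 \<noteq> 0 \<and> x\<^sup>2 \<noteq> 1}"

lemma finite_cosines: assumes "0 < \<mu>" shows "finite (cosines \<mu>)"
proof -
  have "cosines \<mu> \<subseteq> sqrt ` angle_set \<mu> \<union> (\<lambda>s. - sqrt s) ` angle_set \<mu>"
  proof
    fix x assume "x \<in> cosines \<mu>"
    hence x: "x\<^sup>2 \<in> angle_set \<mu>" by (simp add: cosines_def)
    have "x = sqrt (x\<^sup>2) \<or> x = - sqrt (x\<^sup>2)" by auto
    thus "x \<in> sqrt ` angle_set \<mu> \<union> (\<lambda>s. - sqrt s) ` angle_set \<mu>" using x by blast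
  qed
  thus ?thesis using finite_angle_set[OF assms] finite_subset by blast
qed

lemma cosines_disjoint:
  assumes "prime p" "prime q" "p \<noteq> q" "x \<in> cosines (2 * p)" "y \<in> cosines (2 * q)"
  shows "x \<noteq> y"
proof
  assume "x = y"
  have "coprime p q" using assms primes_coprime by blast
  hence "gcd (2 * p) (2 * q) = 2" by (simp add: gcd_mult_distrib_nat[symmetric])
  moreover have "2 * p \<noteq> 0" using prime_gt_0_nat[OF assms(1)] by simp
  ultimately show False using angle_set_inter[of "2 * p" "2 * q" "x\<^sup>2"] assms(4,5) \<open>x = y\<close> by (auto simp: cosines_def)
qed

text \<open>
  The number of variants \<open>L\<close> exceeds the number of choices of entries outside one column, \<open>\<delta>\<close> separates
  the possible entries for distinct labels, and the number of copies \<open>t\<close> makes the rows outweigh the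
  Gram matrix of \<open>B\<close>.
\<close>

theorem no_reflection_embedding:
  fixes k L t :: nat and P :: "nat \<Rightarrow> nat" and \<delta> :: real and \<phi> :: "nat list set \<Rightarrow> real mat"
  defines "I \<equiv> {..<k} \<union> rows k L t"
  assumes k: "1 \<le> k" and P: "\<And>l. 4 \<le> P l"
    and L: "card (cosines 8) ^ (k - 1) < L"
    and \<delta>: "0 < \<delta>" "\<And>l l' x y. l < L \<Longrightarrow> l' < L \<Longrightarrow> l \<noteq> l' \<Longrightarrow> x \<in> cosines (2 * P l) \<Longrightarrow>
        y \<in> cosines (2 * P l') \<Longrightarrow> \<delta> \<le> \<bar>x - y\<bar>"
    and t: "real k < real t * (\<delta>\<^sup>2 / 2)"
    and F: "symmetric_form p (k - 1) F"
  shows "\<not> reflection_embedding (even_coxeter_matrix.W I (labels k P)) (even_coxeter_matrix.S I (labels k P)) F \<phi>"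
proof
  assume emb: "reflection_embedding (even_coxeter_matrix.W I (labels k P)) (even_coxeter_matrix.S I (labels k P)) F \<phi>"
  let ?n = "p + (k - 1)" and ?A = "rows k L t"
  obtain D crd where D: "card {l. l < ?n \<and> D l < 0} = k - 1"
    and crd: "\<And>x y. x \<in> carrier_vec ?n \<Longrightarrow> y \<in> carrier_vec ?n \<Longrightarrow>
        bform F x y = (\<Sum>l<?n. D l * crd x l * crd y l)"
    and nd: "nondegenerate_form ?n F"
    using symmetric_form_coordinates[OF F] by blast
  interpret r: reflection_representation I "labels k P" ?A "{..<k}" ?n F \<phi>
    using bipartite_labels[OF P, of k L t] nd emb
    by (auto simp: reflection_representation_def reflection_representation_axioms_def I_def)
  define G where "G = (\<lambda>i j. bform F (r.rt i) (r.rt j))"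
  define x where "x = (\<lambda>i. crd (r.rt i))"
  have bI: "j \<in> I" if "j < k" for j using that by (simp add: I_def)
  have aI: "a \<in> I" if "a \<in> ?A" for a using that by (simp add: I_def)
  have bil: "bil ?n D (x i) (x j) = G i j" if "i \<in> I" "j \<in> I" for i j
    using crd[OF r.rt_closed[OF that(1)] r.rt_closed[OF that(2)]] by (simp add: bil_def x_def G_def)
  have ab: "a \<noteq> j" if "a \<in> ?A" "j < k" for a j using that r.AB_disjoint by auto
  have G_ab: "G a a = G j j" "(G a j)\<^sup>2 \<in> angle_set (labels k P a j)" "(G a j)\<^sup>2 \<noteq> 0" "(G a j)\<^sup>2 \<noteq> 1"
    if "a \<in> ?A" "j < k" for a j
    using r.rt_angle[OF aI[OF that(1)] bI[OF that(2)] ab[OF that]] r.m_AB[OF that(1), of j] that(2)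
    by (auto simp: G_def)
  have G_sym: "G i j = G j i" if "i \<in> I" "j \<in> I" for i j
    using r.\<beta>_sym r.rt_closed that by (simp add: G_def)
  have t0: "0 < t" using t by (cases t) auto
  have L0: "0 < L" using L by simp
  have row: "row_index k j l c \<in> ?A" if "j < k" "l < L" "c < t" for j l c
    using that by (auto simp: rows_def)
  have row0: "row_index k j 0 0 \<in> ?A" if "j < k" for j using row that L0 t0 by simp
  (* every row index is joined to every column, so all norms equal that of the column 0 *)
  define \<sigma> where "\<sigma> = G 0 0"
  have k0: "0 < k" using k by simp
  have G_aa: "G a a = \<sigma>" if "a \<in> ?A" for a using G_ab(1)[OF that k0] by (simp add: \<sigma>_def)
  have G_jj: "G j j = \<sigma>" if "j < k" for j using G_ab(1)[OF row0[OF k0] that] G_aa[OF row0[OF k0]] by simp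
  have G_orth: "G a a' = 0" if "a \<in> ?A" "a' \<in> ?A" "a \<noteq> a'" for a a'
    using r.rt_orthogonal[OF that] by (simp add: G_def)
  have "\<bar>\<sigma>\<bar> = 1" using r.rt_norm[OF bI[OF k0]] by (simp add: \<sigma>_def G_def)
  hence "\<sigma> = -1 \<or> \<sigma> = 1" by linarith
  hence "\<exists>w. \<forall>v. (\<exists>j<k. v j \<noteq> 0) \<longrightarrow> (\<Sum>i<?n. D i * (\<Sum>j<k. v j * w j i)\<^sup>2) < 0"
  proof
    assume s: "\<sigma> = -1"
    define w where "w = (\<lambda>j. x (row_index k j 0 0))"
    have "(\<Sum>i<?n. D i * (\<Sum>j<k. v j * w j i)\<^sup>2) < 0" if v: "\<exists>j<k. v j \<noteq> 0" for v
    proof -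
      let ?y = "\<lambda>i. \<Sum>j<k. v j * w j i"
      have "(\<Sum>i<?n. D i * (?y i)\<^sup>2) = bil ?n D ?y ?y" by (simp add: bil_def power2_eq_square mult.assoc)
      also have "\<dots> = (\<Sum>j<k. v j * (\<Sum>j'<k. v j' * bil ?n D (w j') (w j)))"
        unfolding bil_sum_left bil_commute[of ?n D _ ?y] ..
      also have "\<dots> = (\<Sum>j<k. v j * (\<Sum>j'<k. if j' = j then - v j else 0))"
      proof (intro sum.cong refl arg_cong2[where f = "(*)"])
        fix j j' assume jj: "j \<in> {..<k}" "j' \<in> {..<k}"
        have a: "row_index k j' 0 0 \<in> ?A" "row_index k j 0 0 \<in> ?A" using row0 jj by auto
        have "bil ?n D (w j') (w j) = G (row_index k j' 0 0) (row_index k j 0 0)"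
          unfolding w_def using bil aI a by blast
        also have "\<dots> = (if j' = j then -1 else 0)"
          using G_aa[OF a(1)] G_orth[OF a] s by (auto simp: row_index_inj)
        finally show "v j' * bil ?n D (w j') (w j) = (if j' = j then - v j else 0)" by simp
      qed
      also have "\<dots> = - (\<Sum>j<k. (v j)\<^sup>2)" by (simp add: power2_eq_square sum_negf)
      also have "\<dots> < 0"
      proof -
        obtain j where "j < k" "v j \<noteq> 0" using v by blast
        hence "0 < (\<Sum>j<k. (v j)\<^sup>2)" by (intro sum_pos2[of _ j]) auto
        thus ?thesis by simp
      qed
      finally show ?thesis .
    qed
    thus ?thesis by blast
  next
    assume s: "\<sigma> = 1"
    (* the projection of the j-th vector of B to the orthogonal complement of the vectors of A *)
    define w where "w = (\<lambda>j i. x j i - (\<Sum>a\<in>?A. G a j * x a i))"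
    have on: "bil ?n D (x a) (x a') = (if a = a' then 1 else 0)" if "a \<in> ?A" "a' \<in> ?A" for a a'
      using bil[OF aI[OF that(1)] aI[OF that(2)]] G_aa[OF that(1)] G_orth[OF that] s by auto
    have G_le: "\<bar>G i j\<bar> \<le> 1" if ij: "i < k" "j < k" for i j
    proof (cases "i = j")
      case True
      then show ?thesis using G_jj ij s by simp
    next
      case False
      have "(G i j)\<^sup>2 \<in> angle_set (labels k P i j)"
        using r.rt_angle(2)[OF bI[OF ij(1)] bI[OF ij(2)] False] r.m_BB[of i j] ij False by (simp add: G_def)
      moreover have "0 < labels k P i j" using ij by (simp add: labels_def)
      ultimately have "(G i j)\<^sup>2 \<le> 1" using angle_set_unit(2) by blast
      thus ?thesis by (simp add: abs_square_le_1)
    qed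
    have "(\<Sum>i<?n. D i * (\<Sum>j<k. v j * w j i)\<^sup>2) < 0" if v: "\<exists>j<k. v j \<noteq> 0" for v
    proof -
      let ?y = "\<lambda>i. \<Sum>j<k. v j * x j i"
      let ?S = "\<lambda>a. bil ?n D ?y (x a)"
      have S: "?S a = (\<Sum>j<k. v j * G a j)" if a: "a \<in> ?A" for a
        unfolding bil_sum_left using bil G_sym bI aI[OF a] by (intro sum.cong) auto
      have w: "(\<Sum>j<k. v j * w j i) = ?y i - (\<Sum>a\<in>?A. ?S a * x a i)" for i
      proof -
        have "(\<Sum>a\<in>?A. ?S a * x a i) = (\<Sum>a\<in>?A. \<Sum>j<k. v j * (G a j * x a i))"
          by (intro sum.cong refl) (simp only: S sum_distrib_right mult.assoc)
        also have "\<dots> = (\<Sum>j<k. v j * (\<Sum>a\<in>?A. G a j * x a i))"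
          unfolding sum_distrib_left by (rule sum.swap)
        finally show ?thesis unfolding w_def by (simp add: right_diff_distrib sum_subtractf)
      qed
      have "(\<Sum>i<?n. D i * (\<Sum>j<k. v j * w j i)\<^sup>2) =
          bil ?n D (\<lambda>i. ?y i - (\<Sum>a\<in>?A. ?S a * x a i)) (\<lambda>i. ?y i - (\<Sum>a\<in>?A. ?S a * x a i))"
        unfolding w by (simp add: bil_def power2_eq_square mult.assoc)
      also have "\<dots> = bil ?n D ?y ?y - (\<Sum>a\<in>?A. (?S a)\<^sup>2)"
        by (rule bil_projection[OF finite_rows on])
      also have "bil ?n D ?y ?y = (\<Sum>i<k. \<Sum>j<k. v i * v j * G i j)"
      proof -
        have "bil ?n D ?y ?y = (\<Sum>i<k. v i * (\<Sum>j<k. v j * bil ?n D (x j) (x i)))"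
          unfolding bil_sum_left bil_commute[of ?n D _ ?y] ..
        also have "\<dots> = (\<Sum>i<k. \<Sum>j<k. v i * v j * G i j)"
          unfolding sum_distrib_left using bil bI G_sym by (intro sum.cong refl) (simp add: mult.assoc)
        finally show ?thesis .
      qed
      also have "\<dots> \<le> k * (\<Sum>j<k. (v j)\<^sup>2)"
        using gram_upper_bound[of "{..<k}" G v] G_le by simp
      finally have up: "(\<Sum>i<?n. D i * (\<Sum>j<k. v j * w j i)\<^sup>2) \<le> k * (\<Sum>j<k. (v j)\<^sup>2) - (\<Sum>a\<in>?A. (?S a)\<^sup>2)"
        by simp
      have "t * (\<delta>\<^sup>2 / 2) * (\<Sum>j<k. (v j)\<^sup>2) \<le>
          (\<Sum>j0<k. \<Sum>l<L. \<Sum>c<t. (\<Sum>j<k. v j * G (row_index k j0 l c) j)\<^sup>2)"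
      proof (rule gram_lower_bound[OF _ L])
        show "finite (cosines 8)" by (rule finite_cosines) simp
        fix j0 l c j assume a: "j0 < k" "l < L" "c < t" "j < k" "j \<noteq> j0"
        show "G (row_index k j0 l c) j \<in> cosines 8"
          using G_ab(2-4)[OF row[OF a(1-3)] a(4)] a(4,5) by (simp add: labels_row cosines_def)
      next
        show "0 \<le> \<delta>" using \<delta>(1) by simp
        fix j0 l l' c assume a: "j0 < k" "l < L" "l' < L" "l \<noteq> l'" "c < t"
        have "G (row_index k j0 i c) j0 \<in> cosines (2 * P i)" if "i < L" for i
          using G_ab(2-4)[OF row[OF a(1) that a(5)] a(1)] a(1) by (simp add: labels_row cosines_def)
        thus "\<delta> \<le> \<bar>G (row_index k j0 l c) j0 - G (row_index k j0 l' c) j0\<bar>"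
          using \<delta>(2)[OF a(2-4)] a by blast
      qed
      also have "\<dots> = (\<Sum>a\<in>?A. (\<Sum>j<k. v j * G a j)\<^sup>2)" by (rule sum_rows[symmetric])
      also have "\<dots> = (\<Sum>a\<in>?A. (?S a)\<^sup>2)" by (intro sum.cong refl) (simp only: S)
      finally have low: "t * (\<delta>\<^sup>2 / 2) * (\<Sum>j<k. (v j)\<^sup>2) \<le> (\<Sum>a\<in>?A. (?S a)\<^sup>2)" .
      obtain j where "j < k" "v j \<noteq> 0" using v by blast
      hence "0 < (\<Sum>j<k. (v j)\<^sup>2)" by (intro sum_pos2[of _ j]) auto
      hence "k * (\<Sum>j<k. (v j)\<^sup>2) < t * (\<delta>\<^sup>2 / 2) * (\<Sum>j<k. (v j)\<^sup>2)" using t by simp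
      thus ?thesis using up low by linarith
    qed
    thus ?thesis by blast
  qed
  then obtain w where w: "\<And>v. \<exists>j<k. v j \<noteq> 0 \<Longrightarrow> (\<Sum>i<?n. D i * (\<Sum>j<k. v j * w j i)\<^sup>2) < 0" by blast
  have "card {..<k} \<le> card {i. i < ?n \<and> D i < 0}"
    using w by (intro negative_index_bound[where w = w]) auto
  thus False using D k by simp
qed

theorem theorem1:
  fixes k :: nat
  assumes "k \<ge> 1"
  shows "\<exists>(G :: nat list set monoid) S.
           coxeter_system G S \<and> word_hyperbolic G \<and>
           (\<forall>n B. symmetric_form n (k - 1) B \<longrightarrow>
              \<not> (\<exists>\<phi>. reflection_embedding G S B \<phi>))"
proof -
  define Pr where "Pr = {q::nat. prime q \<and> 4 < q}"
  have "infinite Pr"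
  proof
    assume "finite Pr"
    moreover have "{q::nat. prime q} \<subseteq> Pr \<union> {..4}" by (auto simp: Pr_def)
    ultimately show False using primes_infinite finite_subset by (metis finite_Un finite_atMost)
  qed
  define P where "P = enumerate Pr"
  have P: "prime (P l)" "4 \<le> P l" for l
    using enumerate_in_set[OF \<open>infinite Pr\<close>, of l] by (auto simp: P_def Pr_def)
  have P_inj: "P l \<noteq> P l'" if "l \<noteq> l'" for l l'
    using strict_mono_enumerate[OF \<open>infinite Pr\<close>] that by (simp add: P_def strict_mono_eq)
  define L where "L = Suc (card (cosines 8) ^ (k - 1))"
  (* the value 1 only keeps the set nonempty *)
  define gaps where "gaps = insert 1 (\<Union>l<L. \<Union>l'\<in>{..<L} - {l}.
      (\<lambda>(x, y). \<bar>x - y\<bar>) ` (cosines (2 * P l) \<times> cosines (2 * P l')))"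
  have fin: "finite gaps" unfolding gaps_def using P(2)
    by (intro finite.insertI finite_UN_I finite_imageI finite_cartesian_product finite_cosines)
      (auto simp: Suc_le_eq intro: order_less_le_trans[of 0 4])
  define \<delta> where "\<delta> = Min gaps"
  have pos: "0 < g" if "g \<in> gaps" for g
  proof -
    from that consider "g = 1" | l l' x y where "l \<noteq> l'" "x \<in> cosines (2 * P l)" "y \<in> cosines (2 * P l')"
      "g = \<bar>x - y\<bar>" unfolding gaps_def by fastforce
    thus ?thesis
    proof cases
      case 2
      then show ?thesis using cosines_disjoint[OF P(1) P(1) P_inj] by fastforce
    qed simp
  qed
  have "gaps \<noteq> {}" by (simp add: gaps_def)
  hence \<delta>: "0 < \<delta>" using pos Min_in[OF fin] by (simp add: \<delta>_def)
  have \<delta>_le: "\<delta> \<le> \<bar>x - y\<bar>" if "l < L" "l' < L" "l \<noteq> l'" "x \<in> cosines (2 * P l)" "y \<in> cosines (2 * P l')" for l l' x y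
  proof -
    have "\<bar>x - y\<bar> \<in> gaps" using that unfolding gaps_def by force
    thus ?thesis using Min_le[OF fin] by (simp add: \<delta>_def)
  qed
  obtain t :: nat where "real k / (\<delta>\<^sup>2 / 2) < t" using reals_Archimedean2 by blast
  hence t: "real k < real t * (\<delta>\<^sup>2 / 2)" using \<delta> by (simp add: pos_divide_less_eq)
  let ?I = "{..<k} \<union> rows k L t" and ?m = "labels k P"
  interpret b: bipartite_coxeter ?I ?m "rows k L t" "{..<k}"
    by (rule bipartite_labels[OF P(2)])
  have "\<not> reflection_embedding b.W b.S F \<phi>" if "symmetric_form n (k - 1) F" for n F \<phi>
    using no_reflection_embedding[OF assms P(2) _ \<delta> \<delta>_le t that] by (simp add: L_def)
  thus ?thesis using b.coxeter_system_W b.word_hyperbolic_W by blast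
qed

end
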